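(* Let $f:\mathbb{R}^2\to\mathbb{R}$ satisfy (f1)–(f7), with $\mathcal{R}$ the full measure set in (f6). For $\lambda\in\mathbb{R}$ consider the equation $$x'=f(t,x)+\lambda.\qquad (E_\lambda)$$ Let $\mathcal{B}_\lambda$, $a_\lambda$, $r_\lambda$ be as in the context. Let $\rho>0$ satisfy $f(t,x)<0$ if $|x|>\rho$ for all $t\in\mathcal{R}$, and let $m_\rho:=\big\|\sup_{|x|\le\rho}f(\cdot,x)\big\|_{L^\infty}$. There exists a unique $\lambda^*=\lambda^*(f)\in[-m_\rho,\|f(\cdot,0)\|_{L^\infty}]$ such that: (i) $\mathcal{B}_\lambda$ is empty if and only if $\lambda<\lambda^*$. (ii) If $\lambda^*\le\lambda_1<\lambda_2$, then $\mathcal{B}_{\lambda_1}\subsetneq\mathcal{B}_{\lambda_2}$. More precisely, $r_{\lambda_2}<r_{\lambda_1}\le a_{\lambda_1}<a_{\lambda_2}$. In addition, $\lim_{\lambda\to\infty}a_\lambda(t)=\infty$ and $\lim_{\lambda\to\infty}r_\lambda(t)=-\infty$ uniformly on $\mathbb{R}$. (iii) $\inf_{t\in\mathbb{R}}(a_{\lambda^*}(t)-r_{\lambda^*}(t))=0$, and $(E_{\lambda^*})$ has no hyperbolic solutions. (iv) If $\lambda>\lambda^*$, then $a_\lambda$ and $r_\lambda$ are uniformly separated and they are the unique hyperbolic solutions of $(E_\lambda)$. (v) $\lambda^*(f+\lambda)=\lambda^*(f)-\lambda$ for any $\lambda\in\mathbb{R}$.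
   Context: Conditions on a function $f:\mathbb{R}^2\to\mathbb{R}$ ("a.e. $t$" refers to Lebesgue measure on $\mathbb{R}$): (f1) $f$ is Borel measurable; (f2) for all $j\in\mathbb{N}$ there exists $m_j\in\mathbb{R}$ such that $\sup_{x\in[-j,j]}|f(t,x)|\le m_j$ for a.e. $t$; (f3) for all $j\in\mathbb{N}$ there exists $l_j\in\mathbb{R}$ such that $\sup_{x_1,x_2\in[-j,j],\,x_1\ne x_2}|f(t,x_2)-f(t,x_1)|/|x_2-x_1|\le l_j$ for a.e. $t$; (f4) for a.e. $t$, the map $x\mapsto f(t,x)$ is $C^1$; (f5) $f_x=\partial f/\partial x$ satisfies condition (f3); (f6) there exist a subset $\mathcal{R}\subseteq\mathbb{R}$ with full Lebesgue measure and $\delta>0$ such that $\limsup_{x\to\pm\infty}f(t,x)/x^2<-\delta$ uniformly on $t\in\mathcal{R}$; (f7) for all $j\in\mathbb{N}$ there exists $\delta_j>0$ such that $\sup_{x_1,x_2\in[-j,j],\,x_1\ne x_2}(f_x(t,x_2)-f_x(t,x_1))/(x_2-x_1)<-\delta_j$ for a.e. $t$. Solutions are Carathéodory solutions (absolutely continuous on compact intervals, satisfying the equation for a.e. $t$). $\mathcal{B}_\lambda$ is the (possibly empty) set of pairs $(s,x_0)\in\mathbb{R}^2$ such that the solution of $(E_\lambda)$ with value $x_0$ at $t=s$ is globally defined and bounded. If $\mathcal{B}_\lambda\neq\emptyset$, there exist bounded solutions $r_\lambda\le a_\lambda$ of $(E_\lambda)$ defined on $\mathbb{R}$ with $\mathcal{B}_\lambda=\{(s,x_0)\,|\;r_\lambda(s)\le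 x_0\le a_\lambda(s)\}$. Inequalities between functions are pointwise on $\mathbb{R}$. A bounded solution $\tilde b:\mathbb{R}\to\mathbb{R}$ of $(E_\lambda)$ is hyperbolic if there exist $k\ge1$ and $\beta>0$ such that either $\exp\int_s^t f_x(l,\tilde b(l))\,dl\le k\,e^{-\beta(t-s)}$ whenever $t\ge s$, or $\exp\int_s^t f_x(l,\tilde b(l))\,dl\le k\,e^{\beta(t-s)}$ whenever $t\le s$. Uniformly separated means $\inf_{t\in\mathbb{R}}(a_\lambda(t)-r_\lambda(t))>0$. *)

theory Defs
  imports "HOL-Probability.Essential_Supremum"
begin

text \<open>
  Suprema are taken in the extended reals, so that an unbounded set has supremum
  \<open>\<infinity>\<close> and the empty set (which occurs for \<open>j = 0\<close>, where no two distinct points exist) has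
  supremum \<open>-\<infinity>\<close>.  Almost-everywhere statements, the essential supremum and integrals refer to
  the completed Lebesgue measure \<open>lebesgue\<close>: functions such as \<open>t \<mapsto> sup f(t,\<cdot>)\<close> or
  \<open>t \<mapsto> f\<^sub>x(t,b(t))\<close> agree with a Borel function only outside a null set.
\<close>

definition partial_x :: "(real \<Rightarrow> real \<Rightarrow> real) \<Rightarrow> real \<Rightarrow> real \<Rightarrow> real" where
  "partial_x f t x = deriv (f t) x"

definition diff_quot :: "(real \<Rightarrow> real) \<Rightarrow> real \<times> real \<Rightarrow> real" where
  "diff_quot g = (\<lambda>(x1, x2). (g x2 - g x1) / (x2 - x1))"

definition distinct_pairs :: "nat \<Rightarrow> (real \<times> real) set" where
  "distinct_pairs j =
     {(x1, x2). x1 \<in> {- real j..real j} \<and> x2 \<in> {- real j..real j} \<and> x1 \<noteq> x2}"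

definition loc_bounded_ae :: "(real \<Rightarrow> real \<Rightarrow> real) \<Rightarrow> bool" where
  "loc_bounded_ae f \<longleftrightarrow>
     (\<forall>j::nat. \<exists>m::real. AE t in lebesgue.
        (SUP x\<in>{- real j..real j}. ereal \<bar>f t x\<bar>) \<le> ereal m)"

definition loc_lipschitz_ae :: "(real \<Rightarrow> real \<Rightarrow> real) \<Rightarrow> bool" where
  "loc_lipschitz_ae f \<longleftrightarrow>
     (\<forall>j::nat. \<exists>l::real. AE t in lebesgue.
        (SUP p\<in>distinct_pairs j. ereal \<bar>diff_quot (f t) p\<bar>) \<le> ereal l)"

definition C1_ae :: "(real \<Rightarrow> real \<Rightarrow> real) \<Rightarrow> bool" where
  "C1_ae f \<longleftrightarrow> (AE t in lebesgue. f t C1_differentiable_on UNIV)"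

text \<open>Uniformity in \<open>t \<in> R\<close> of the bound on the upper limits is expressed by taking the
  supremum over \<open>R\<close> before the upper limit.\<close>

definition coercive_on :: "real set \<Rightarrow> (real \<Rightarrow> real \<Rightarrow> real) \<Rightarrow> bool" where
  "coercive_on R f \<longleftrightarrow>
     - R \<in> null_sets lebesgue \<and>
     (\<exists>\<delta>>0.
        Limsup at_top (\<lambda>x. SUP t\<in>R. ereal (f t x / x\<^sup>2)) < ereal (- \<delta>) \<and>
        Limsup at_bot (\<lambda>x. SUP t\<in>R. ereal (f t x / x\<^sup>2)) < ereal (- \<delta>))"

definition strictly_concave_ae :: "(real \<Rightarrow> real \<Rightarrow> real) \<Rightarrow> bool" where
  "strictly_concave_ae f \<longleftrightarrow>
     (\<forall>j::nat. \<exists>\<delta>>0. AE t in lebesgue.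
        (SUP p\<in>distinct_pairs j. ereal (diff_quot (partial_x f t) p)) < ereal (- \<delta>))"

definition Linf_norm :: "(real \<Rightarrow> ereal) \<Rightarrow> ereal" where
  "Linf_norm g = esssup lebesgue (\<lambda>t. \<bar>g t\<bar>)"

definition abs_continuous_on :: "real \<Rightarrow> real \<Rightarrow> (real \<Rightarrow> real) \<Rightarrow> bool" where
  "abs_continuous_on a b x \<longleftrightarrow>
     (\<forall>\<epsilon>>0. \<exists>\<delta>>0. \<forall>D :: (real \<times> real) set.
        finite D \<and> (\<forall>(u, v)\<in>D. a \<le> u \<and> u \<le> v \<and> v \<le> b) \<and>
        disjoint_family_on (\<lambda>(u, v). {u<..<v}) D \<and> (\<Sum>(u, v)\<in>D. v - u) < \<delta>
        \<longrightarrow> (\<Sum>(u, v)\<in>D. \<bar>x v - x u\<bar>) < \<epsilon>)"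

text \<open>Caratheodory solutions, defined on all of \<open>\<real>\<close>, of \<open>x' = f(t,x) + \<lambda>\<close>; below, \<open>l\<close> stands
  for the parameter \<open>\<lambda>\<close>.\<close>

definition global_solution :: "(real \<Rightarrow> real \<Rightarrow> real) \<Rightarrow> real \<Rightarrow> (real \<Rightarrow> real) \<Rightarrow> bool" where
  "global_solution f l x \<longleftrightarrow>
     (\<forall>a b. abs_continuous_on a b x) \<and>
     (AE t in lebesgue. (x has_real_derivative f t (x t) + l) (at t))"

definition bounded_solution :: "(real \<Rightarrow> real \<Rightarrow> real) \<Rightarrow> real \<Rightarrow> (real \<Rightarrow> real) \<Rightarrow> bool" where
  "bounded_solution f l x \<longleftrightarrow> global_solution f l x \<and> bounded (range x)"

definition bdd_set :: "(real \<Rightarrow> real \<Rightarrow> real) \<Rightarrow> real \<Rightarrow> (real \<times> real) set" where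
  "bdd_set f l = {(s, x0). \<exists>x. bounded_solution f l x \<and> x s = x0}"

definition extremal_pair ::
  "(real \<Rightarrow> real \<Rightarrow> real) \<Rightarrow> real \<Rightarrow> (real \<Rightarrow> real) \<Rightarrow> (real \<Rightarrow> real) \<Rightarrow> bool" where
  "extremal_pair f l r a \<longleftrightarrow>
     bounded_solution f l r \<and> bounded_solution f l a \<and> r \<le> a \<and>
     bdd_set f l = {(s, x0). r s \<le> x0 \<and> x0 \<le> a s}"

text \<open>The functions \<open>a\<^sub>\<lambda>\<close> and \<open>r\<^sub>\<lambda>\<close>; they are meaningful only if \<open>bdd_set f l \<noteq> {}\<close>.\<close>

definition upper_sol :: "(real \<Rightarrow> real \<Rightarrow> real) \<Rightarrow> real \<Rightarrow> real \<Rightarrow> real" where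
  "upper_sol f l = (THE a. \<exists>r. extremal_pair f l r a)"

definition lower_sol :: "(real \<Rightarrow> real \<Rightarrow> real) \<Rightarrow> real \<Rightarrow> real \<Rightarrow> real" where
  "lower_sol f l = (THE r. \<exists>a. extremal_pair f l r a)"

text \<open>The interval integral is oriented, as needed for \<open>t \<le> s\<close>.\<close>

definition hyperbolic_solution ::
  "(real \<Rightarrow> real \<Rightarrow> real) \<Rightarrow> real \<Rightarrow> (real \<Rightarrow> real) \<Rightarrow> bool" where
  "hyperbolic_solution f l b \<longleftrightarrow>
     bounded_solution f l b \<and>
     (\<exists>k\<ge>1. \<exists>\<beta>>0.
        (\<forall>s t. s \<le> t \<longrightarrow>
           exp (interval_lebesgue_integral lebesgue (ereal s) (ereal t) (\<lambda>u. partial_x f u (b u)))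
             \<le> k * exp (- \<beta> * (t - s))) \<or>
        (\<forall>s t. t \<le> s \<longrightarrow>
           exp (interval_lebesgue_integral lebesgue (ereal s) (ereal t) (\<lambda>u. partial_x f u (b u)))
             \<le> k * exp (\<beta> * (t - s))))"

definition uniformly_separated :: "(real \<Rightarrow> real) \<Rightarrow> (real \<Rightarrow> real) \<Rightarrow> bool" where
  "uniformly_separated r a \<longleftrightarrow> 0 < (INF t. a t - r t)"

text \<open>The four blocks are the properties (i) to (iv) that characterise the number \<open>\<lambda>\<^sup>*\<close>,
  here called \<open>c\<close>.  The real infima are over sets bounded below by \<open>0\<close>, since the second block
  gives \<open>r\<^sub>\<lambda> \<le> a\<^sub>\<lambda>\<close> for all \<open>\<lambda> \<ge> c\<close>.\<close>

definition bifurcation_value :: "(real \<Rightarrow> real \<Rightarrow> real) \<Rightarrow> real \<Rightarrow> bool" where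
  "bifurcation_value f c \<longleftrightarrow>
     (\<forall>l. bdd_set f l = {} \<longleftrightarrow> l < c) \<and>

     ((\<forall>l1 l2. c \<le> l1 \<and> l1 < l2 \<longrightarrow>
         bdd_set f l1 \<subset> bdd_set f l2 \<and>
         (\<forall>t. lower_sol f l2 t < lower_sol f l1 t \<and>
              lower_sol f l1 t \<le> upper_sol f l1 t \<and>
              upper_sol f l1 t < upper_sol f l2 t)) \<and>
      (\<forall>K. \<forall>\<^sub>F l in at_top. \<forall>t. K \<le> upper_sol f l t) \<and>
      (\<forall>K. \<forall>\<^sub>F l in at_top. \<forall>t. lower_sol f l t \<le> K)) \<and>

     ((INF t. upper_sol f c t - lower_sol f c t) = 0 \<and>
      \<not> (\<exists>b. hyperbolic_solution f c b)) \<and>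

     (\<forall>l>c. uniformly_separated (lower_sol f l) (upper_sol f l) \<and>
        {b. hyperbolic_solution f l b} = {upper_sol f l, lower_sol f l})"

text \<open>The number \<open>\<lambda>\<^sup>*(f)\<close> as a function of \<open>f\<close>.  The interval in which it is located depends on
  an auxiliary constant \<open>\<rho>\<close> and is not part of the description.\<close>

definition lambda_star :: "(real \<Rightarrow> real \<Rightarrow> real) \<Rightarrow> real" where
  "lambda_star f = (THE c. bifurcation_value f c)"

end

theory Submission
  imports Defs "HOL-Real_Asymp.Real_Asymp"
begin

text \<open>
  All comparisons rest on a Gronwall inequality for locally Lipschitz functions.  Above any bounded
  subsolution the decreasing limit of the solutions starting at time \<open>-n\<close> on a high level is the
  maximal bounded solution \<open>a\<^sub>\<lambda>\<close>; the change of variables \<open>(t, x) \<mapsto> (-t, -x)\<close> preserves the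
  hypotheses and exchanges \<open>a\<^sub>\<lambda>\<close> with \<open>-r\<^sub>\<lambda>\<close>.  Since \<open>a\<^sub>\<lambda>\<close> is a strict subsolution for larger
  parameters, the parameters with bounded solutions form a half-line, closed by monotone limits.

  If \<open>a\<^sub>\<lambda> - r\<^sub>\<lambda> \<ge> \<epsilon> > 0\<close>, strict concavity makes \<open>a\<^sub>\<lambda> - r\<^sub>\<lambda>\<close> grow faster than the linearisation along
  \<open>a\<^sub>\<lambda>\<close>, and boundedness of \<open>a\<^sub>\<lambda> - r\<^sub>\<lambda>\<close> forces that linearisation to decay exponentially.
  Conversely, a hyperbolic solution can be perturbed along a bounded solution of its inhomogeneous
  linearisation to a bounded subsolution for a smaller parameter, which is impossible at \<open>\<lambda>\<^sup>*\<close>.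
\<close>

section \<open>Absolutely continuous functions and indefinite integrals\<close>

text \<open>The field is merely measurable in time and only locally Lipschitz in the state. For the
  first defect, the a.e. differential equation and its integral form are shown to be equivalent: an
  absolutely continuous function is the Henstock-Kurzweil integral of its derivative, and an
  indefinite integral has its integrand as derivative a.e. The integral form passes to limits, the
  differential form feeds the Gronwall inequality. For the second, the state is clamped to [-N, N]:
  the clamped field is bounded and globally Lipschitz, so its solutions are global, and a curve
  inside [-N, N] solves both equations or neither. Coercivity bounds all bounded solutions by a
  constant that is uniform for parameters below a given one, so a single N serves a whole limit
  process. The change of variables keeps the parameter, because x' and f + \<lambda> keep their sign
  under it, while f_x changes sign. It thus turns exponential decay into the past into decay into
  the future, and only the latter has to be analysed. The quadratic bounds come from (f7) for
  concavity and from (f5) for the error of linearisation.\<close>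

hide_const (open) Polynomial.content

text \<open>Tags where the derivative exists are handled by the straddle estimate. The intervals
  tagged in the null set \<open>N\<close> lie in an open set of measure below \<open>d\<close>, so
  absolute continuity makes the increments of \<open>x\<close> over them small.\<close>

lemma abs_continuous_has_integral:
  fixes x h :: "real \<Rightarrow> real"
  assumes ac: "abs_continuous_on a b x" and "a \<le> b"
    and der: "AE t in lebesgue. (x has_real_derivative h t) (at t)"
  shows "(h has_integral (x b - x a)) {a..b}"
proof -
  obtain N where N: "negligible N" "\<And>t. t \<notin> N \<Longrightarrow> (x has_real_derivative h t) (at t)"
    using der unfolding eventually_ae_filter_negligible by blast
  \<comment> \<open>With the value 0 on \<open>N\<close>, a term tagged there contributes only the
    increment of \<open>x\<close> over its interval.\<close>
  define h' where "h' = (\<lambda>t. if t \<in> N then 0 else h t)"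
  have "(h' has_integral (x b - x a)) {a..b}"
    unfolding has_integral_real
  proof (intro allI impI)
    fix e :: real assume "e > 0"
    obtain d where "d > 0" and d: "\<And>D :: (real \<times> real) set.
        finite D \<Longrightarrow> (\<And>u v. (u, v)\<in>D \<Longrightarrow> a \<le> u \<and> u \<le> v \<and> v \<le> b) \<Longrightarrow>
        disjoint_family_on (\<lambda>(u, v). {u<..<v}) D \<Longrightarrow> (\<Sum>(u, v)\<in>D. v - u) < d
        \<Longrightarrow> (\<Sum>(u, v)\<in>D. \<bar>x v - x u\<bar>) < e / 2"
    proof -
      have "e / 2 > 0" using \<open>e > 0\<close> by simp
      then obtain d where "d > 0" and d: "\<forall>D :: (real \<times> real) set.
        finite D \<and> (\<forall>(u, v)\<in>D. a \<le> u \<and> u \<le> v \<and> v \<le> b) \<and>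
        disjoint_family_on (\<lambda>(u, v). {u<..<v}) D \<and> (\<Sum>(u, v)\<in>D. v - u) < d
        \<longrightarrow> (\<Sum>(u, v)\<in>D. \<bar>x v - x u\<bar>) < e / 2"
        using ac unfolding abs_continuous_on_def by meson
      show ?thesis
      proof (rule that[OF \<open>d > 0\<close>])
        fix D :: "(real \<times> real) set"
        assume "finite D" and b: "\<And>u v. (u, v) \<in> D \<Longrightarrow> a \<le> u \<and> u \<le> v \<and> v \<le> b"
          and "disjoint_family_on (\<lambda>(u, v). {u<..<v}) D" "(\<Sum>(u, v)\<in>D. v - u) < d"
        moreover have "\<forall>(u, v)\<in>D. a \<le> u \<and> u \<le> v \<and> v \<le> b" using b by blast
        ultimately show "(\<Sum>(u, v)\<in>D. \<bar>x v - x u\<bar>) < e / 2" using d by blast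
      qed
    qed
    obtain U where U: "open U" "N \<subseteq> U" "(U - N) \<in> lmeasurable" "emeasure lebesgue (U - N) < ennreal d"
      using sets_lebesgue_outer_open[OF negligible_imp_sets[OF N(1)] \<open>d > 0\<close>] by blast
    have UN: "U = (U - N) \<union> N" using U by auto
    have Um: "U \<in> lmeasurable"
      using fmeasurable.Un[OF U(3) negligible_imp_measurable[OF N(1)]] UN by simp
    have "emeasure lebesgue U \<le> emeasure lebesgue (U - N) + emeasure lebesgue N"
      using emeasure_subadditive[OF fmeasurableD[OF U(3)] negligible_imp_sets[OF N(1)]] UN by simp
    also have "emeasure lebesgue N = 0"
      using N(1) negligible_iff_emeasure0 negligible_imp_sets by blast
    finally have "emeasure lebesgue U < ennreal d" using U(4) by simp
    then have Ud: "measure lebesgue U < d"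
      using Um \<open>d > 0\<close> by (metis emeasure_eq_measure2 ennreal_less_iff measure_nonneg)
    \<comment> \<open>Half of \<open>e\<close> is reserved for the tags outside \<open>N\<close>:
      \<open>c * (b - a) < e / 2\<close>, and the summand 2 keeps the denominator positive when
      \<open>a = b\<close>.\<close>
    define c where "c = e / (2 * (b - a) + 2)"
    have "c > 0" using \<open>e > 0\<close> \<open>a \<le> b\<close> by (simp add: c_def)
    have "\<exists>r>0. \<forall>y. \<bar>y - t\<bar> < r \<longrightarrow> \<bar>x y - x t - h t * (y - t)\<bar> \<le> c * \<bar>y - t\<bar>" if "t \<notin> N" for t
    proof -
      have "(x has_derivative (\<lambda>s. h t * s)) (at t)"
        using N(2)[OF that] by (simp add: has_field_derivative_def)
      then show ?thesis using \<open>c > 0\<close> by (simp add: has_derivative_at_alt) 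
    qed
    then obtain r where r: "\<And>t. t \<notin> N \<Longrightarrow> r t > 0"
      "\<And>t y. t \<notin> N \<Longrightarrow> \<bar>y - t\<bar> < r t \<Longrightarrow> \<bar>x y - x t - h t * (y - t)\<bar> \<le> c * \<bar>y - t\<bar>"
      by metis
    define \<gamma> where "\<gamma> = (\<lambda>t. if t \<in> N then U else ball t (r t))"
    have "gauge \<gamma>" using U r(1) by (auto simp: gauge_def \<gamma>_def)
    have est: "norm ((\<Sum>(t, K)\<in>D. content K *\<^sub>R h' t) - (x b - x a)) < e"
      if D: "D tagged_division_of {a..b}" "\<gamma> fine D" for D
    proof -
      note DD = tagged_division_ofD[OF D(1)]
      have K: "K = {Inf K..Sup K} \<and> Inf K \<le> t \<and> t \<le> Sup K \<and> a \<le> Inf K \<and> Sup K \<le> b \<and> K \<subseteq> \<gamma> t \<and> content K = Sup K - Inf K"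
        if tK: "(t, K) \<in> D" for t K
      proof -
        obtain u v where uv: "K = {u..v}" using DD(4)[OF tK] by auto
        moreover have "t \<in> K" "K \<subseteq> {a..b}" using DD(2,3)[OF tK] by auto
        moreover have "K \<subseteq> \<gamma> t" using D(2) tK by (auto simp: fine_def)
        ultimately show ?thesis by auto
      qed
      define D1 where "D1 = {p\<in>D. fst p \<in> N}"
      define D2 where "D2 = {p\<in>D. fst p \<notin> N}"
      have fin: "finite D" "finite D1" "finite D2" using DD(1) by (auto simp: D1_def D2_def)
      have D12: "D = D1 \<union> D2" "D1 \<inter> D2 = {}" by (auto simp: D1_def D2_def)
      define g where "g = (\<lambda>(t, K). content K *\<^sub>R h' t - (x (Sup K) - x (Inf K)))"
      have "(\<Sum>(t, K)\<in>D. content K *\<^sub>R h' t) - (x b - x a) = sum g D"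
        using additive_tagged_division_1[OF \<open>a \<le> b\<close> D(1), of x, symmetric]
        by (simp add: g_def sum_subtractf split_beta)
      also have "\<dots> = sum g D1 + sum g D2"
        using D12 fin by (metis sum.union_disjoint)
      finally have eq: "(\<Sum>(t, K)\<in>D. content K *\<^sub>R h' t) - (x b - x a) = sum g D1 + sum g D2" .
      have "\<bar>sum g D2\<bar> \<le> (\<Sum>p\<in>D2. c * content (snd p))"
      proof (rule order_trans[OF sum_abs], rule sum_mono)
        fix p assume "p \<in> D2"
        then obtain t K where p: "p = (t, K)" "(t, K) \<in> D" "t \<notin> N" by (cases p) (auto simp: D2_def)
        note k = K[OF p(2)]
        then have "Inf K \<in> K" "Sup K \<in> K" by (metis atLeastAtMost_iff order_refl order_trans)+
        then have "\<bar>Inf K - t\<bar> < r t" "\<bar>Sup K - t\<bar> < r t"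
          using k p(3) by (auto simp: \<gamma>_def dist_real_def abs_minus_commute subset_iff)
        from r(2)[OF p(3) this(1)] r(2)[OF p(3) this(2)]
        have "\<bar>(x (Inf K) - x t - h t * (Inf K - t)) - (x (Sup K) - x t - h t * (Sup K - t))\<bar>
           \<le> c * \<bar>Inf K - t\<bar> + c * \<bar>Sup K - t\<bar>" by linarith
        also have "\<dots> = c * (Sup K - Inf K)" using k by (auto simp: algebra_simps)
        finally have "\<bar>(x (Inf K) - x t - h t * (Inf K - t)) - (x (Sup K) - x t - h t * (Sup K - t))\<bar>
           \<le> c * (Sup K - Inf K)" .
        moreover have ck: "content K = Sup K - Inf K" using k by blast
        moreover have "g p = (x (Inf K) - x t - h t * (Inf K - t)) - (x (Sup K) - x t - h t * (Sup K - t))"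
          using p by (simp add: g_def h'_def ck algebra_simps)
        ultimately show "\<bar>g p\<bar> \<le> c * content (snd p)" using p by simp
      qed
      also have "\<dots> = c * (\<Sum>p\<in>D2. content (snd p))" by (simp add: sum_distrib_left)
      also have "\<dots> \<le> c * (\<Sum>p\<in>D. content (snd p))"
        using \<open>c > 0\<close> fin by (intro mult_left_mono sum_mono2) (auto simp: D2_def)
      also have "(\<Sum>p\<in>D. content (snd p)) = b - a"
        using additive_content_tagged_division[of D a b] D(1) \<open>a \<le> b\<close> by (simp add: split_beta)
      also have "c * (b - a) < e / 2"
        using \<open>e > 0\<close> \<open>a \<le> b\<close> by (simp add: c_def field_simps)
      finally have g2: "\<bar>sum g D2\<bar> < e / 2" .
      define E where "E = (\<lambda>(t, K::real set). (Inf K, Sup K)) ` D1"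
      have disj: "{Inf K1<..<Sup K1} \<inter> {Inf K2<..<Sup K2} = {}"
        if "(t1, K1) \<in> D" "(t2, K2) \<in> D" "(t1, K1) \<noteq> (t2, K2)" for t1 K1 t2 K2
        using DD(5)[OF that] K[OF that(1)] K[OF that(2)] by (metis interior_atLeastAtMost_real)
      \<comment> \<open>The increments get indexed by endpoint pairs, so no pair may occur twice.
        Nonoverlapping intervals with the same endpoints are degenerate, and then both tags are
        their only point.\<close>
      have inj: "inj_on (\<lambda>(t, K::real set). (Inf K, Sup K)) D1"
      proof (rule inj_onI, clarify)
        fix t1 K1 t2 K2
        assume h: "(t1, K1) \<in> D1" "(t2, K2) \<in> D1" "Inf K1 = Inf K2" "Sup K1 = Sup K2"
        then have hD: "(t1, K1) \<in> D" "(t2, K2) \<in> D" by (auto simp: D1_def)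
        have keq: "K1 = K2" using K[OF hD(1)] K[OF hD(2)] h by metis
        moreover have "t1 = t2"
        proof (rule ccontr)
          assume "t1 \<noteq> t2"
          then have "{Inf K1<..<Sup K1} = {}" using disj[OF hD] keq by auto
          then show False using K[OF hD(1)] K[OF hD(2)] keq \<open>t1 \<noteq> t2\<close> by auto
        qed
        ultimately show "t1 = t2 \<and> K1 = K2" by simp
      qed
      have disjE: "disjoint_family_on (\<lambda>(u, v). {u<..<v}) E"
        unfolding disjoint_family_on_def
      proof (intro ballI impI)
        fix p q assume "p \<in> E" "q \<in> E" "p \<noteq> q"
        then obtain t1 K1 t2 K2 where "(t1, K1) \<in> D" "p = (Inf K1, Sup K1)"
            "(t2, K2) \<in> D" "q = (Inf K2, Sup K2)" by (auto simp: E_def D1_def)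
        then show "(\<lambda>(u, v). {u<..<v}) p \<inter> (\<lambda>(u, v). {u<..<v}) q = {}"
          using disj[of t1 K1 t2 K2] \<open>p \<noteq> q\<close> by auto
      qed
      have "(\<Sum>(u, v)\<in>E. v - u) = (\<Sum>i\<in>E. measure lebesgue ((\<lambda>(u, v). {u<..<v}) i))"
      proof (intro sum.cong refl)
        fix q assume "q \<in> E"
        then obtain t K where "(t, K) \<in> D" "q = (Inf K, Sup K)" by (auto simp: E_def D1_def)
        moreover from this have "Inf K \<le> t \<and> t \<le> Sup K" using K by blast
        ultimately show "(case q of (u, v) \<Rightarrow> v - u) = measure lebesgue ((\<lambda>(u, v). {u<..<v}) q)" by simp
      qed
      also have "\<dots> = measure lebesgue (\<Union>i\<in>E. (\<lambda>(u, v). {u<..<v}) i)"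
      proof (intro measure_finite_Union[symmetric] disjE)
        fix q assume "q \<in> E"
        obtain u v where q: "q = (u, v)" by (cases q)
        have "emeasure lebesgue {u<..<v} \<noteq> \<infinity>" by (cases "u \<le> v") auto
        then show "emeasure lebesgue ((\<lambda>(u, v). {u<..<v}) q) \<noteq> \<infinity>" by (simp add: q)
      qed (use fin in \<open>auto simp: E_def\<close>)
      also have "\<dots> \<le> measure lebesgue U"
      proof (rule measure_mono_fmeasurable)
        show "(\<Union>i\<in>E. (\<lambda>(u, v). {u<..<v}) i) \<subseteq> U"
        proof (clarsimp simp: E_def)
          fix t K s assume h: "(t, K) \<in> D1" "Inf K < s" "s < Sup K"
          then have hD: "(t, K) \<in> D" "t \<in> N" by (auto simp: D1_def)
          have "s \<in> K" using K[OF hD(1)] h by (metis atLeastAtMost_iff less_imp_le)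
          then show "s \<in> U" using K[OF hD(1)] hD by (auto simp: \<gamma>_def)
        qed
      qed (use fin Um in \<open>auto simp: E_def split_beta\<close>)
      finally have "(\<Sum>(u, v)\<in>E. v - u) < d" using Ud by simp
      then have "(\<Sum>(u, v)\<in>E. \<bar>x v - x u\<bar>) < e / 2"
      proof (intro d disjE)
        show "a \<le> u \<and> u \<le> v \<and> v \<le> b" if uv: "(u, v) \<in> E" for u v
        proof -
          obtain t K where tK: "(t, K) \<in> D" "u = Inf K" "v = Sup K" using uv by (auto simp: E_def D1_def)
          have "Inf K \<le> t \<and> t \<le> Sup K \<and> a \<le> Inf K \<and> Sup K \<le> b" using K[OF tK(1)] by blast
          then show ?thesis using tK(2,3) by linarith
        qed
      qed (use fin in \<open>auto simp: E_def\<close>)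
      also have "(\<Sum>(u, v)\<in>E. \<bar>x v - x u\<bar>) = (\<Sum>p\<in>D1. \<bar>g p\<bar>)"
        unfolding E_def by (subst sum.reindex[OF inj], intro sum.cong)
          (simp_all add: g_def h'_def D1_def split_beta)
      finally have "\<bar>sum g D1\<bar> < e / 2" using sum_abs[of g D1] by linarith
      with g2 eq show ?thesis by simp
    qed
    show "\<exists>\<gamma>. gauge \<gamma> \<and> (\<forall>D. D tagged_division_of {a..b} \<and> \<gamma> fine D \<longrightarrow>
        norm ((\<Sum>(t, K)\<in>D. content K *\<^sub>R h' t) - (x b - x a)) < e)"
      by (intro exI[of _ \<gamma>] conjI allI impI \<open>gauge \<gamma>\<close>) (elim conjE, rule est)
  qed
  then show ?thesis
    using has_integral_spike[OF N(1), of "{a..b}" h h'] by (auto simp: h'_def)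
qed

text \<open>The bad set is covered by intervals on which the difference quotient of the primitive stays
  away from the value of \<open>h\<close> at an endpoint; Henstock's lemma bounds the total length of any
  disjoint subfamily, and Vitali's covering lemma then bounds the measure of the bad set.\<close>

lemma negligible_bad_difference_quotients:
  fixes h H :: "real \<Rightarrow> real"
  assumes H: "\<And>s t. a \<le> s \<Longrightarrow> s \<le> t \<Longrightarrow> t \<le> b \<Longrightarrow> (h has_integral (H t - H s)) {s..t}"
    and "\<eta> > 0"
  shows "negligible {t\<in>{a<..<b}. \<forall>\<delta>>0. \<exists>u. \<bar>u - t\<bar> < \<delta> \<and> \<bar>H u - H t - h t * (u - t)\<bar> > \<eta> * \<bar>u - t\<bar>}"
    (is "negligible ?E")
  unfolding negligible_outer_le
proof (intro allI impI)
  fix e :: real assume "e > 0"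
  \<comment> \<open>Henstock's lemma will give total length at most
    \<open>e' / \<eta> = e / 10\<close> for disjoint bad intervals, and Vitali's lemma enlarges each
    of them by the factor 5.\<close>
  define e' where "e' = e * \<eta> / 10"
  have "e' > 0" using \<open>e > 0\<close> \<open>\<eta> > 0\<close> by (simp add: e'_def)
  show "\<exists>T. ?E \<subseteq> T \<and> T \<in> lmeasurable \<and> measure lebesgue T \<le> e"
  proof (cases "a \<le> b")
    case False
    then show ?thesis using \<open>e > 0\<close> by (intro exI[of _ "{}"]) auto
  next
    case True
    have "h integrable_on cbox a b" using H[of a b] True by auto
    then obtain \<gamma> where \<gamma>: "gauge \<gamma>"
      and hen: "\<And>p. \<lbrakk>p tagged_partial_division_of (cbox a b); \<gamma> fine p\<rbrakk> \<Longrightarrow>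
             sum (\<lambda>(x,k). norm (content k *\<^sub>R h x - integral k h)) p < e'"
      by (rule Henstock_lemma[OF _ \<open>e' > 0\<close>]) blast
    \<comment> \<open>The point \<open>u\<close> is taken so close to \<open>t\<close> that the
      interval between them lies in the gauge neighbourhood of \<open>t\<close>; with its endpoint
      \<open>t\<close> as tag it is admissible for Henstock's lemma.\<close>
    have "\<exists>u. u \<noteq> t \<and> {min t u..max t u} \<subseteq> \<gamma> t \<inter> {a..b} \<and>
          \<bar>H u - H t - h t * (u - t)\<bar> > \<eta> * \<bar>u - t\<bar>" if tE: "t \<in> ?E" for t
    proof -
      have "open (\<gamma> t \<inter> {a<..<b})" "t \<in> \<gamma> t \<inter> {a<..<b}"
        using tE \<gamma> by (auto simp: gauge_def)
      then obtain \<delta> where "\<delta> > 0" and d: "ball t \<delta> \<subseteq> \<gamma> t \<inter> {a<..<b}"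
        by (meson openE)
      obtain u where u: "\<bar>u - t\<bar> < \<delta>" "\<bar>H u - H t - h t * (u - t)\<bar> > \<eta> * \<bar>u - t\<bar>"
        using tE \<open>\<delta> > 0\<close> by blast
      have "{min t u..max t u} \<subseteq> ball t \<delta>"
        using u(1) by (auto simp: dist_real_def)
      then have "{min t u..max t u} \<subseteq> \<gamma> t \<inter> {a..b}" using d by fastforce
      moreover have "u \<noteq> t" using u by auto
      ultimately show ?thesis using u(2) by (intro exI[of _ u] conjI)
    qed
    then have "\<forall>t\<in>?E. \<exists>u. u \<noteq> t \<and> {min t u..max t u} \<subseteq> \<gamma> t \<inter> {a..b} \<and>
          \<bar>H u - H t - h t * (u - t)\<bar> > \<eta> * \<bar>u - t\<bar>" by (rule ballI)
    from bchoice[OF this] obtain u where uall: "\<forall>t\<in>?E. u t \<noteq> t \<and>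
        {min t (u t)..max t (u t)} \<subseteq> \<gamma> t \<inter> {a..b} \<and>
        \<bar>H (u t) - H t - h t * (u t - t)\<bar> > \<eta> * \<bar>u t - t\<bar>" by (rule exE)
    define E where "E = ?E"
    have u: "u t \<noteq> t" "{min t (u t)..max t (u t)} \<subseteq> \<gamma> t \<inter> {a..b}"
      "\<bar>H (u t) - H t - h t * (u t - t)\<bar> > \<eta> * \<bar>u t - t\<bar>" if "t \<in> E" for t
      by (rule bspec[OF uall that[unfolded E_def], THEN conjunct1] bspec[OF uall that[unfolded E_def], THEN conjunct2, THEN conjunct1] bspec[OF uall that[unfolded E_def], THEN conjunct2, THEN conjunct2])+
    \<comment> \<open>Centre and radius of the interval between \<open>t\<close> and
      \<open>u t\<close>, since the covering lemma speaks of balls.\<close>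
    define c r where "c = (\<lambda>t. (t + u t) / 2)" and "r = (\<lambda>t. \<bar>u t - t\<bar> / 2)"
    have cb: "cball (c t) (r t) = {min t (u t)..max t (u t)}" for t
      by (auto simp: c_def r_def cball_eq_atLeastAtMost abs_if min_def max_def field_simps)
    have rpos: "0 < r t \<and> r t \<le> b - a" if "t \<in> E" for t
    proof -
      have "t \<in> {a..b}" "u t \<in> {a..b}" using u(2)[OF that] by auto
      then show ?thesis using u(1)[OF that] by (auto simp: r_def abs_if)
    qed
    have "E \<subseteq> (\<Union>t\<in>E. cball (c t) (r t))"
    proof
      fix t assume "t \<in> E"
      moreover have "t \<in> cball (c t) (r t)" unfolding cb by simp
      ultimately show "t \<in> (\<Union>t\<in>E. cball (c t) (r t))" by blast
    qed
    note cov = this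
    obtain C where C: "countable C" "C \<subseteq> E"
      "pairwise (\<lambda>i j. disjnt (cball (c i) (r i)) (cball (c j) (r j))) C"
      "E \<subseteq> (\<Union>i\<in>C. cball (c i) (5 * r i))"
      by (rule Vitali_covering_lemma_cballs[where S = E and K = E and a = c and r = r and B = "b - a", OF cov rpos])
    \<comment> \<open>The measure of a countable union is bounded through finite subfamilies; for
      these the tagged intervals form a fine partial division.\<close>
    have fin: "measure lebesgue (\<Union>i\<in>D. cball (c i) (5 * r i)) \<le> e" if D: "D \<subseteq> C" "finite D" for D
    proof -
      define p where "p = (\<lambda>t. (t, cball (c t) (r t))) ` D"
      have DE: "t \<in> E" if "t \<in> D" for t using that D C(2) by blast
      have sub: "cball (c t) (r t) \<subseteq> \<gamma> t" "cball (c t) (r t) \<subseteq> {a..b}" if "t \<in> D" for t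
        using u(2)[OF DE[OF that]] by (auto simp: cb)
      have "p tagged_partial_division_of (cbox a b)"
        unfolding tagged_partial_division_of_def
      proof (intro conjI allI impI)
        show "finite p" using D by (simp add: p_def)
      next
        fix x K assume "(x, K) \<in> p"
        then have xK: "x \<in> D" "K = cball (c x) (r x)" by (auto simp: p_def)
        show "x \<in> K" unfolding xK(2) cb by simp
        show "K \<subseteq> cbox a b" using sub(2)[OF xK(1)] xK(2) by simp
        show "\<exists>a b. K = cbox a b" unfolding xK(2) cb by (metis interval_cbox)
      next
        fix x1 K1 x2 K2 assume h: "(x1, K1) \<in> p \<and> (x2, K2) \<in> p \<and> (x1, K1) \<noteq> (x2, K2)"
        then have "x1 \<in> C" "x2 \<in> C" "x1 \<noteq> x2" "K1 = cball (c x1) (r x1)" "K2 = cball (c x2) (r x2)"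
          using D by (auto simp: p_def)
        then have "disjnt K1 K2" using C(3) by (simp add: pairwise_def)
        then show "interior K1 \<inter> interior K2 = {}"
          using interior_subset by (auto simp: disjnt_def)
      qed
      moreover have "\<gamma> fine p" using sub(1) by (auto simp: fine_def p_def)
      ultimately have "(\<Sum>(x,k)\<in>p. norm (content k *\<^sub>R h x - integral k h)) < e'" by (rule hen)
      also have "(\<Sum>(x,k)\<in>p. norm (content k *\<^sub>R h x - integral k h))
        = (\<Sum>t\<in>D. \<bar>content (cball (c t) (r t)) * h t - integral (cball (c t) (r t)) h\<bar>)"
        unfolding p_def by (subst sum.reindex) (auto simp: inj_on_def)
      finally have le: "(\<Sum>t\<in>D. \<bar>content (cball (c t) (r t)) * h t - integral (cball (c t) (r t)) h\<bar>) < e'" .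
      have each: "\<eta> * (2 * r t) \<le> \<bar>content (cball (c t) (r t)) * h t - integral (cball (c t) (r t)) h\<bar>"
        if "t \<in> D" for t
      proof -
        have ab: "t \<in> {a..b}" "u t \<in> {a..b}" using u(2)[OF DE[OF that]] by auto
        have "(h has_integral (H (max t (u t)) - H (min t (u t)))) {min t (u t)..max t (u t)}"
          using ab by (intro H) auto
        then have i: "integral (cball (c t) (r t)) h = H (max t (u t)) - H (min t (u t))"
          unfolding cb by (rule integral_unique)
        have ct: "content (cball (c t) (r t)) = \<bar>u t - t\<bar>" unfolding cb by auto
        have "\<bar>\<bar>u t - t\<bar> * h t - (H (max t (u t)) - H (min t (u t)))\<bar> = \<bar>H (u t) - H t - h t * (u t - t)\<bar>"
        proof (cases "t \<le> u t")
          case True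
          then show ?thesis by (simp add: max_def min_def abs_minus_commute mult.commute)
        next
          case False
          then have "\<bar>u t - t\<bar> * h t - (H (max t (u t)) - H (min t (u t))) = H (u t) - H t - h t * (u t - t)"
            by (simp add: algebra_simps)
          then show ?thesis by simp
        qed
        moreover have "\<eta> * (2 * r t) = \<eta> * \<bar>u t - t\<bar>" by (simp add: r_def)
        ultimately show ?thesis using u(3)[OF DE[OF that]] unfolding i ct by linarith
      qed
      have "\<eta> * (\<Sum>t\<in>D. 2 * r t) \<le> e'"
        by (rule order_trans[OF _ less_imp_le[OF le]], unfold sum_distrib_left, rule sum_mono, rule each)
      then have s: "(\<Sum>t\<in>D. 2 * r t) \<le> e / 10"
        using \<open>\<eta> > 0\<close> by (simp add: e'_def field_simps)
      have "measure lebesgue (\<Union>i\<in>D. cball (c i) (5 * r i)) \<le> (\<Sum>i\<in>D. measure lebesgue (cball (c i) (5 * r i)))"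
        using D by (intro measure_UNION_le) auto
      also have "\<dots> = (\<Sum>i\<in>D. 5 * (2 * r i))"
      proof (intro sum.cong refl)
        fix i assume "i \<in> D"
        then have "r i > 0" using rpos[OF DE] by blast
        then show "measure lebesgue (cball (c i) (5 * r i)) = 5 * (2 * r i)"
          by (simp add: cball_eq_atLeastAtMost)
      qed
      also have "\<dots> \<le> e" using s \<open>e > 0\<close> by (simp flip: sum_distrib_left)
      finally show ?thesis .
    qed
    show ?thesis
      unfolding E_def[symmetric]
      by (rule exI[of _ "\<Union>i\<in>C. cball (c i) (5 * r i)"])
        (use C fin fmeasurable_UN_bound[of C "\<lambda>i. cball (c i) (5 * r i)" lebesgue e]
            measure_UN_bound[of C "\<lambda>i. cball (c i) (5 * r i)" lebesgue e] in auto)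
  qed
qed

text \<open>If the derivative at \<open>t\<close> is not \<open>h t\<close>, the difference
  quotients miss \<open>h t\<close> by more than some \<open>inverse (Suc k)\<close> arbitrarily
  near \<open>t\<close>. So the exceptional points lie in countably many null sets, indexed by
  \<open>k\<close> and by the window from \<open>- n\<close> to \<open>n\<close>.\<close>

lemma indefinite_integral_AE_derivative:
  fixes h H :: "real \<Rightarrow> real"
  assumes H: "\<And>s t. s \<le> t \<Longrightarrow> (h has_integral (H t - H s)) {s..t}"
  shows "AE t in lebesgue. (H has_real_derivative h t) (at t)"
proof -
  let ?E = "\<lambda>n k. {t\<in>{- real n<..<real n}. \<forall>\<delta>>0. \<exists>u. \<bar>u - t\<bar> < \<delta> \<and>
      \<bar>H u - H t - h t * (u - t)\<bar> > inverse (real (Suc k)) * \<bar>u - t\<bar>}"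
  have neg: "negligible (?E n k)" for n k
    by (rule negligible_bad_difference_quotients) (auto intro: H)
  have "negligible (\<Union>n. \<Union>k. ?E n k)"
    by (intro negligible_countable_Union countable_image countableI_type; elim imageE; hypsubst)
      (intro negligible_countable_Union countable_image countableI_type; elim imageE; hypsubst; rule neg)
  moreover have "{t. \<not> (H has_real_derivative h t) (at t)} \<subseteq> (\<Union>n. \<Union>k. ?E n k)"
  proof (rule subsetI, rule ccontr)
    fix t assume bad: "t \<in> {t. \<not> (H has_real_derivative h t) (at t)}" and no: "t \<notin> (\<Union>n. \<Union>k. ?E n k)"
    obtain n where "\<bar>t\<bar> < real n" using reals_Archimedean2 by blast
    then have n: "t \<in> {- real n<..<real n}" by auto
    have "\<exists>d>0. \<forall>u. \<bar>u - t\<bar> < d \<longrightarrow> \<bar>H u - H t - h t * (u - t)\<bar> \<le> e * \<bar>u - t\<bar>" if "e > 0" for e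
    proof -
      obtain k where k: "inverse (real (Suc k)) < e" using reals_Archimedean[OF \<open>e > 0\<close>] by blast
      have "t \<notin> ?E n k" using no by blast
      then obtain d where "d > 0"
        and d: "\<And>u. \<bar>u - t\<bar> < d \<Longrightarrow> \<bar>H u - H t - h t * (u - t)\<bar> \<le> inverse (real (Suc k)) * \<bar>u - t\<bar>"
        using n by (auto simp: not_less) (metis not_less)
      have "\<bar>H u - H t - h t * (u - t)\<bar> \<le> e * \<bar>u - t\<bar>" if "\<bar>u - t\<bar> < d" for u
        using d[OF that] mult_right_mono[OF less_imp_le[OF k], of "\<bar>u - t\<bar>"] by linarith
      then show ?thesis using \<open>d > 0\<close> by blast
    qed
    then have "(H has_real_derivative h t) (at t)"
      unfolding has_field_derivative_def has_derivative_at_alt by (auto simp: bounded_linear_mult_right)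
    then show False using bad by simp
  qed
  ultimately show ?thesis unfolding eventually_ae_filter_negligible by blast
qed

section \<open>Locally Lipschitz functions\<close>

text \<open>This class stands in for absolute continuity in the comparison arguments: it is closed
  under products and outer composition by elementary means, and bounded solutions turn out to belong
  to it.\<close>

definition loc_lipschitz :: "(real \<Rightarrow> real) \<Rightarrow> bool" where
  "loc_lipschitz x \<longleftrightarrow> (\<forall>a b. \<exists>C. C-lipschitz_on {a..b} x)"

lemma loc_lipschitzE:
  assumes "loc_lipschitz x"
  obtains C where "C-lipschitz_on {a..b} x"
  using assms unfolding loc_lipschitz_def by metis

lemma loc_lipschitz_continuous: "loc_lipschitz x \<Longrightarrow> continuous_on S x"
proof (rule continuous_on_subset[of UNIV], rule continuous_at_imp_continuous_on, intro ballI)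
  fix t :: real assume "loc_lipschitz x"
  then obtain C where "C-lipschitz_on {t - 1..t + 1} x" by (rule loc_lipschitzE)
  then have "continuous_on {t - 1..t + 1} x" by (rule lipschitz_on_continuous_on)
  then have "continuous_on {t - 1<..<t + 1} x" by (rule continuous_on_subset) auto
  then show "isCont x t" by (simp add: continuous_on_eq_continuous_at)
qed auto

lemma loc_lipschitz_abs_continuous:
  assumes "loc_lipschitz x"
  shows "abs_continuous_on a b x"
  unfolding abs_continuous_on_def
proof (intro allI impI)
  fix e :: real assume "e > 0"
  obtain C where C: "C-lipschitz_on {a..b} x" using assms by (rule loc_lipschitzE)
  have "C \<ge> 0" using C by (rule lipschitz_on_nonneg)
  show "\<exists>d>0. \<forall>D :: (real \<times> real) set.
        finite D \<and> (\<forall>(u, v)\<in>D. a \<le> u \<and> u \<le> v \<and> v \<le> b) \<and>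
        disjoint_family_on (\<lambda>(u, v). {u<..<v}) D \<and> (\<Sum>(u, v)\<in>D. v - u) < d
        \<longrightarrow> (\<Sum>(u, v)\<in>D. \<bar>x v - x u\<bar>) < e"
  proof (intro exI[of _ "e / (C + 1)"] conjI allI impI, goal_cases)
    case 1
    then show ?case using \<open>e > 0\<close> \<open>C \<ge> 0\<close> by simp
  next
    case (2 D)
    then have D: "\<forall>(u, v)\<in>D. a \<le> u \<and> u \<le> v \<and> v \<le> b" "(\<Sum>(u, v)\<in>D. v - u) < e / (C + 1)" by blast+
    have "(\<Sum>(u, v)\<in>D. \<bar>x v - x u\<bar>) \<le> (\<Sum>(u, v)\<in>D. C * (v - u))"
    proof (rule sum_mono, clarify)
      fix u v assume "(u, v) \<in> D"
      then have "a \<le> u \<and> u \<le> v \<and> v \<le> b" using D by blast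
      then show "\<bar>x v - x u\<bar> \<le> C * (v - u)"
        using lipschitz_onD[OF C, of v u] by (simp add: dist_real_def)
    qed
    also have "\<dots> = C * (\<Sum>(u, v)\<in>D. v - u)" by (simp add: sum_distrib_left split_beta)
    also have "\<dots> \<le> C * (e / (C + 1))" using D \<open>C \<ge> 0\<close> by (intro mult_left_mono) auto
    also have "\<dots> < e" using \<open>C \<ge> 0\<close> \<open>e > 0\<close> by (simp add: field_simps)
    finally show ?case .
  qed
qed

lemma loc_lipschitz_C1:
  assumes "\<And>t. (\<phi> has_real_derivative \<phi>' t) (at t)" and "continuous_on UNIV \<phi>'"
  shows "loc_lipschitz \<phi>"
  unfolding loc_lipschitz_def
proof (intro allI)
  fix a b :: real
  have "compact (\<phi>' ` {a..b})"
    using assms(2) by (intro compact_continuous_image) (auto intro: continuous_on_subset)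
  from compact_imp_bounded[OF this] obtain C where "\<forall>y\<in>\<phi>' ` {a..b}. norm y \<le> C"
    unfolding bounded_iff by blast
  then have C: "\<And>t. t \<in> {a..b} \<Longrightarrow> \<bar>\<phi>' t\<bar> \<le> C" by auto
  have "(max 0 C)-lipschitz_on {a..b} \<phi>"
  proof (rule bounded_derivative_imp_lipschitz)
    show "(\<phi> has_derivative (\<lambda>s. \<phi>' t * s)) (at t within {a..b})" for t
      using assms(1) has_field_derivative_def has_derivative_at_withinI by blast
    show "onorm (\<lambda>s. \<phi>' t * s) \<le> max 0 C" if "t \<in> {a..b}" for t
    proof (rule onorm_le)
      fix s show "norm (\<phi>' t * s) \<le> max 0 C * norm s"
        using C[OF that] by (auto simp: abs_mult intro!: mult_right_mono)
    qed
  qed auto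
  then show "\<exists>C. C-lipschitz_on {a..b} \<phi>" ..
qed

lemma loc_lipschitz_compose:
  assumes "loc_lipschitz \<phi>" and x: "loc_lipschitz x"
  shows "loc_lipschitz (\<lambda>t. \<phi> (x t))"
  unfolding loc_lipschitz_def
proof (intro allI)
  fix a b :: real
  have "compact (x ` {a..b})"
    by (intro compact_continuous_image loc_lipschitz_continuous x) auto
  then obtain B where B: "x ` {a..b} \<subseteq> {- B..B}"
    using compact_imp_bounded bounded_subset_cbox_symmetric by (metis cbox_interval)
  obtain C where "C-lipschitz_on {- B..B} \<phi>" using assms(1) by (rule loc_lipschitzE)
  then have "C-lipschitz_on (x ` {a..b}) \<phi>" using B by (rule lipschitz_on_subset)
  moreover obtain D where "D-lipschitz_on {a..b} x" using x by (rule loc_lipschitzE)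
  ultimately show "\<exists>C. C-lipschitz_on {a..b} (\<lambda>t. \<phi> (x t))"
    using lipschitz_on_compose2 by blast
qed

section \<open>Algebraic operations on locally Lipschitz functions\<close>

lemma loc_lipschitz_const: "loc_lipschitz (\<lambda>t. c)"
  unfolding loc_lipschitz_def using lipschitz_on_constant by blast

lemma loc_lipschitz_ident: "loc_lipschitz (\<lambda>t. t)"
  unfolding loc_lipschitz_def using lipschitz_on_id by blast

lemma loc_lipschitz_add: "loc_lipschitz x \<Longrightarrow> loc_lipschitz y \<Longrightarrow> loc_lipschitz (\<lambda>t. x t + y t)"
  unfolding loc_lipschitz_def using lipschitz_on_add by metis

lemma loc_lipschitz_diff: "loc_lipschitz x \<Longrightarrow> loc_lipschitz y \<Longrightarrow> loc_lipschitz (\<lambda>t. x t - y t)"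
  unfolding loc_lipschitz_def using lipschitz_on_diff by metis

lemma loc_lipschitz_square: "loc_lipschitz (\<lambda>t::real. t\<^sup>2)"
  by (rule loc_lipschitz_C1[where \<phi>' = "\<lambda>t. 2 * t"]) (auto intro!: derivative_eq_intros continuous_intros)

lemma loc_lipschitz_exp: "loc_lipschitz (exp :: real \<Rightarrow> real)"
  by (rule loc_lipschitz_C1[where \<phi>' = exp]) (auto intro!: derivative_eq_intros continuous_intros)

lemma loc_lipschitz_cmult: "loc_lipschitz x \<Longrightarrow> loc_lipschitz (\<lambda>t. c * x t)"
  by (rule loc_lipschitz_compose[of "\<lambda>s. c * s"])
    (auto intro!: loc_lipschitz_C1[where \<phi>' = "\<lambda>_. c"] derivative_eq_intros)

text \<open>Polarisation reduces the product to squares, that is, to composition with a fixed smooth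
  function.\<close>

lemma loc_lipschitz_mult:
  assumes "loc_lipschitz x" "loc_lipschitz y"
  shows "loc_lipschitz (\<lambda>t. x t * y t)"
proof -
  have "loc_lipschitz (\<lambda>t. (1 / 4) * ((x t + y t)\<^sup>2 - (x t - y t)\<^sup>2))"
    using assms by (intro loc_lipschitz_cmult loc_lipschitz_diff loc_lipschitz_add
        loc_lipschitz_compose[OF loc_lipschitz_square])
  moreover have "(\<lambda>t. (1 / 4) * ((x t + y t)\<^sup>2 - (x t - y t)\<^sup>2)) = (\<lambda>t. x t * y t)"
    by (auto simp: power2_eq_square algebra_simps)
  ultimately show ?thesis by simp
qed

text \<open>Unlike the positive part itself, its square is continuously differentiable, so it can be
  differentiated along a difference of solutions also at the times where they touch.\<close>

lemma DERIV_max_square: "((\<lambda>t::real. (max 0 t)\<^sup>2) has_real_derivative 2 * max 0 t) (at t)"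
proof -
  consider "t > 0" | "t < 0" | "t = 0" by linarith
  then show ?thesis
  proof cases
    case 1
    have "((\<lambda>s::real. s\<^sup>2) has_real_derivative 2 * max 0 t) (at t)"
      using 1 by (auto intro!: derivative_eq_intros)
    then show ?thesis
      by (rule has_field_derivative_transform_within_open[of _ _ _ "{0<..}"]) (use 1 in auto)
  next
    case 2
    have "((\<lambda>s::real. 0) has_real_derivative 2 * max 0 t) (at t)"
      using 2 by (auto intro!: derivative_eq_intros)
    then show ?thesis
      by (rule has_field_derivative_transform_within_open[of _ _ _ "{..<0}"]) (use 2 in auto)
  next
    case 3
    have "((\<lambda>h::real. (max 0 h)\<^sup>2 / h) \<longlongrightarrow> 0) (at 0)"
    proof (rule Lim_null_comparison)
      show "\<forall>\<^sub>F h in at 0. norm ((max 0 h)\<^sup>2 / h) \<le> \<bar>h::real\<bar>"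
        by (rule always_eventually) (auto simp: max_def power2_eq_square)
    qed (auto intro!: tendsto_eq_intros)
    then show ?thesis using 3 by (simp add: DERIV_def)
  qed
qed

lemma loc_lipschitz_max_square: "loc_lipschitz (\<lambda>t::real. (max 0 t)\<^sup>2)"
  by (rule loc_lipschitz_C1[OF DERIV_max_square]) (intro continuous_intros)

text \<open>A locally Lipschitz function is the integral of its a.e. derivative; this excludes
  singular growth on the exceptional null set.\<close>

lemma loc_lipschitz_decreasing:
  assumes "loc_lipschitz y"
    and der: "AE t in lebesgue. \<exists>D. (y has_real_derivative D) (at t) \<and> D \<le> 0"
    and "s \<le> t"
  shows "y t \<le> y s"
proof -
  \<comment> \<open>A total choice of nonpositive derivatives: the default 0 at exceptional times
    makes the sign hold everywhere, so that the integral can be estimated.\<close>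
  define D where "D = (\<lambda>t. if \<exists>D. (y has_real_derivative D) (at t) \<and> D \<le> 0
     then SOME D. (y has_real_derivative D) (at t) \<and> D \<le> 0 else 0)"
  have D: "D t \<le> 0" "(\<exists>D. (y has_real_derivative D) (at t) \<and> D \<le> 0) \<Longrightarrow> (y has_real_derivative D t) (at t)" for t
  proof -
    have "(\<exists>D. (y has_real_derivative D) (at t) \<and> D \<le> 0) \<Longrightarrow> (y has_real_derivative D t) (at t) \<and> D t \<le> 0"
      unfolding D_def using someI_ex[of "\<lambda>D. (y has_real_derivative D) (at t) \<and> D \<le> 0"] by auto
    then show "D t \<le> 0" "(\<exists>D. (y has_real_derivative D) (at t) \<and> D \<le> 0) \<Longrightarrow> (y has_real_derivative D t) (at t)"
      by (auto simp: D_def)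
  qed
  have "AE t in lebesgue. (y has_real_derivative D t) (at t)"
    using der by eventually_elim (rule D(2))
  then have "(D has_integral (y t - y s)) {s..t}"
    by (intro abs_continuous_has_integral loc_lipschitz_abs_continuous assms)
  then have "y t - y s \<le> 0"
    by (rule has_integral_le[OF _ has_integral_0]) (rule D(1))
  then show ?thesis by simp
qed

text \<open>\<open>exp (- H)\<close> is an integrating factor; an antiderivative \<open>H\<close>
  stands for a coefficient that is only defined a.e. As \<open>y\<close> may have either sign,
  negative \<open>y\<close> yields lower growth bounds.\<close>

lemma gronwall_AE:
  assumes y: "loc_lipschitz y" and H: "loc_lipschitz H"
    and der: "AE t in lebesgue. \<exists>D D'. (y has_real_derivative D) (at t) \<and>
        (H has_real_derivative D') (at t) \<and> D \<le> D' * y t"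
    and "s \<le> t"
  shows "y t \<le> y s * exp (H t - H s)"
proof -
  have "loc_lipschitz (\<lambda>t. y t * exp (- 1 * H t))"
    by (intro loc_lipschitz_mult y loc_lipschitz_compose[OF loc_lipschitz_exp] loc_lipschitz_cmult H)
  moreover have "AE t in lebesgue. \<exists>D. ((\<lambda>t. y t * exp (- 1 * H t)) has_real_derivative D) (at t) \<and> D \<le> 0"
    using der
  proof eventually_elim
    case (elim t)
    then obtain D D' where D: "(y has_real_derivative D) (at t)" "(H has_real_derivative D') (at t)"
      "D \<le> D' * y t" by blast
    have "((\<lambda>t. y t * exp (- 1 * H t)) has_real_derivative (D - D' * y t) * exp (- H t)) (at t)"
      using D(1,2) by (auto intro!: derivative_eq_intros simp: algebra_simps)
    moreover have "(D - D' * y t) * exp (- H t) \<le> 0" using D(3) by (intro mult_nonpos_nonneg) auto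
    ultimately show ?case by blast
  qed
  ultimately have "y t * exp (- 1 * H t) \<le> y s * exp (- 1 * H s)"
    using \<open>s \<le> t\<close> by (rule loc_lipschitz_decreasing)
  then have "y t * exp (- H t) * exp (H t) \<le> y s * exp (- H s) * exp (H t)"
    by (intro mult_right_mono) auto
  then show ?thesis by (simp add: exp_diff exp_minus field_simps)
qed

text \<open>A function that is bounded towards \<open>-\<infinity>\<close> has no room for exponential decay.\<close>

lemma nonpos_if_decaying:
  assumes y: "loc_lipschitz y" and "c > 0" and bd: "\<And>t. y t \<le> B"
    and der: "AE t in lebesgue. \<exists>D. (y has_real_derivative D) (at t) \<and> D \<le> - c * y t"
  shows "y t \<le> 0"
proof (rule ccontr)
  assume "\<not> y t \<le> 0"
  then have pos: "y t > 0" by simp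
  have "y t \<le> y (t - r) * exp (- c * r)" if "r \<ge> 0" for r
  proof -
    have "AE t in lebesgue. \<exists>D D'. (y has_real_derivative D) (at t) \<and>
        ((\<lambda>t. - c * t) has_real_derivative D') (at t) \<and> D \<le> D' * y t"
      using der
    proof eventually_elim
      case (elim t)
      moreover have "((\<lambda>t. - c * t) has_real_derivative - c) (at t)"
        by (auto intro!: derivative_eq_intros)
      ultimately show ?case by blast
    qed
    from gronwall_AE[OF y loc_lipschitz_cmult[OF loc_lipschitz_ident] this, of "t - r" t] that
    show ?thesis by (simp add: algebra_simps)
  qed
  then have le: "y t \<le> B * exp (- c * r)" if "r \<ge> 0" for r
    using that bd[of "t - r"] by (meson exp_ge_zero mult_right_mono order_trans)
  have "((\<lambda>r. B * exp (- c * r)) \<longlongrightarrow> 0) at_top" using \<open>c > 0\<close> by real_asymp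
  then have "y t \<le> 0"
    by (rule tendsto_lowerbound) (use le in \<open>auto intro: eventually_at_top_linorderI[of 0]\<close>)
  then show False using pos by simp
qed

section \<open>Bounded Lipschitz fields\<close>

text \<open>The form of the equation that survives pointwise limits of solutions.\<close>

definition integral_solution :: "(real \<Rightarrow> real \<Rightarrow> real) \<Rightarrow> (real \<Rightarrow> real) \<Rightarrow> bool" where
  "integral_solution F x \<longleftrightarrow> (\<forall>s t. s \<le> t \<longrightarrow> ((\<lambda>u. F u (x u)) has_integral (x t - x s)) {s..t})"

definition subsolution :: "(real \<Rightarrow> real \<Rightarrow> real) \<Rightarrow> (real \<Rightarrow> real) \<Rightarrow> bool" where
  "subsolution F x \<longleftrightarrow> loc_lipschitz x \<and>
     (AE t in lebesgue. \<exists>D. (x has_real_derivative D) (at t) \<and> D \<le> F t (x t))"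

definition supersolution :: "(real \<Rightarrow> real \<Rightarrow> real) \<Rightarrow> (real \<Rightarrow> real) \<Rightarrow> bool" where
  "supersolution F x \<longleftrightarrow> loc_lipschitz x \<and>
     (AE t in lebesgue. \<exists>D. (x has_real_derivative D) (at t) \<and> F t (x t) \<le> D)"

definition mirror :: "(real \<Rightarrow> real) \<Rightarrow> real \<Rightarrow> real" where
  "mirror x = (\<lambda>t. - x (- t))"

definition mirror_field :: "(real \<Rightarrow> real \<Rightarrow> real) \<Rightarrow> real \<Rightarrow> real \<Rightarrow> real" where
  "mirror_field F = (\<lambda>t x. F (- t) (- x))"

section \<open>Reflection in time and state\<close>

lemma mirror_mirror [simp]: "mirror (mirror x) = x"
  by (simp add: mirror_def)

lemma mirror_field_mirror_field [simp]: "mirror_field (mirror_field F) = F"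
  by (simp add: mirror_field_def)

lemma integral_solution_mirror:
  assumes "integral_solution F x"
  shows "integral_solution (mirror_field F) (mirror x)"
  unfolding integral_solution_def
proof (intro allI impI)
  fix s t :: real assume "s \<le> t"
  then have "((\<lambda>u. F u (x u)) has_integral (x (- s) - x (- t))) {- t..- s}"
    using assms unfolding integral_solution_def by auto
  then have "((\<lambda>u. F (- u) (x (- u))) has_integral (x (- s) - x (- t))) {s..t}"
    using has_integral_reflect_real[where f = "\<lambda>u. F u (x u)" and a = "- t" and b = "- s"] by simp
  then show "((\<lambda>u. mirror_field F u (mirror x u)) has_integral (mirror x t - mirror x s)) {s..t}"
    by (simp add: mirror_field_def mirror_def)
qed

lemma AE_lebesgue_uminus:
  assumes "AE t :: real in lebesgue. P t"
  shows "AE t in lebesgue. P (- t)"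
proof -
  obtain N where N: "negligible N" "{t. \<not> P t} \<subseteq> N"
    using assms unfolding eventually_ae_filter_negligible by blast
  have "negligible (uminus ` N)"
    by (intro negligible_differentiable_image_negligible[OF _ N(1)] derivative_intros) auto
  moreover have "{t. \<not> P (- t)} \<subseteq> uminus ` N" using N(2) by (force simp: image_iff)
  ultimately show ?thesis unfolding eventually_ae_filter_negligible by blast
qed

section \<open>Indefinite integrals and their Lipschitz bounds\<close>

lemma has_integral_abs_le:
  fixes h g :: "real \<Rightarrow> real"
  assumes h: "(h has_integral i) S" and g: "(g has_integral j) S"
    and le: "\<And>u. u \<in> S \<Longrightarrow> \<bar>h u\<bar> \<le> g u"
  shows "\<bar>i\<bar> \<le> j"
proof -
  have "i \<le> j" using le by (intro has_integral_le[OF h g]) (simp add: abs_le_iff)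
  moreover have "- i \<le> j" using le by (intro has_integral_le[OF has_integral_neg[OF h] g]) (simp add: abs_le_iff)
  ultimately show ?thesis by simp
qed

definition primitive :: "(real \<Rightarrow> real) \<Rightarrow> real \<Rightarrow> real" where
  "primitive h t = (if 0 \<le> t then integral {0..t} h else - integral {t..0} h)"

lemma has_integral_primitive:
  assumes int: "\<And>a b. h integrable_on {a..b}" and "s \<le> t"
  shows "(h has_integral (primitive h t - primitive h s)) {s..t}"
proof -
  have "integral {a..b} h + integral {b..c} h = integral {a..c} h" if "a \<le> b" "b \<le> c" for a b c
    using that int by (rule Henstock_Kurzweil_Integration.integral_combine)
  from this[of 0 s t] this[of s 0 t] this[of s t 0]
  have "primitive h t - primitive h s = integral {s..t} h"
    using \<open>s \<le> t\<close> by (auto simp: primitive_def not_le)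
  then show ?thesis using int by (simp add: integrable_integral)
qed

lemma primitive_lipschitz:
  fixes h H :: "real \<Rightarrow> real"
  assumes H: "\<And>s t. s \<le> t \<Longrightarrow> (h has_integral (H t - H s)) {s..t}"
    and bd: "AE t in lebesgue. \<bar>h t\<bar> \<le> M" and "0 \<le> M"
  shows "\<bar>H t - H s\<bar> \<le> M * \<bar>t - s\<bar>"
proof -
  obtain N where N: "negligible N" "{t. \<not> \<bar>h t\<bar> \<le> M} \<subseteq> N"
    using bd unfolding eventually_ae_filter_negligible by blast
  have *: "\<bar>H t - H s\<bar> \<le> M * (t - s)" if "s \<le> t" for s t
  proof -
    have i: "((\<lambda>u. if u \<in> N then 0 else h u) has_integral (H t - H s)) {s..t}"
      by (rule has_integral_spike[OF N(1) _ H[OF that]]) auto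
    have b: "- M \<le> (if u \<in> N then 0 else h u) \<and> (if u \<in> N then 0 else h u) \<le> M" for u
    proof (cases "u \<in> N")
      case False
      then have "\<bar>h u\<bar> \<le> M" using N(2) by blast
      then show ?thesis using False by (simp add: abs_le_iff)
    qed (use \<open>0 \<le> M\<close> in simp)
    have "H t - H s \<le> (t - s) * M" "(t - s) * (- M) \<le> H t - H s"
      using has_integral_le[OF i has_integral_const_real[of M s t]]
        has_integral_le[OF has_integral_const_real[of "- M" s t] i] b that by auto
    then show ?thesis by (simp add: abs_le_iff mult.commute)
  qed
  show ?thesis
    using *[of s t] *[of t s] by (cases "s \<le> t") (auto simp: abs_minus_commute)
qed

lemma loc_lipschitzI:
  assumes "\<And>s t. \<bar>x t - x s\<bar> \<le> M * \<bar>t - s\<bar>"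
  shows "loc_lipschitz x"
proof -
  have "0 \<le> M" using assms[of 1 0] by simp
  then have "M-lipschitz_on {a..b} x" for a b
    using assms by (intro lipschitz_onI) (auto simp: dist_real_def)
  then show ?thesis unfolding loc_lipschitz_def by blast
qed

text \<open>\<open>integrable\<close> asks for what the Picard operator integrates, the field along
  a continuous curve; it is the trace that measurability in time leaves here. The bounds hold at
  every time, which the clamped fields will achieve by a default value off a set of full
  measure.\<close>

locale bounded_lipschitz_field =
  fixes F :: "real \<Rightarrow> real \<Rightarrow> real" and M L :: real
  assumes integrable: "continuous_on UNIV x \<Longrightarrow> (\<lambda>u. F u (x u)) integrable_on {a..b}"
    and bound: "\<bar>F t p\<bar> \<le> M"
    and lipschitz: "\<bar>F t p - F t q\<bar> \<le> L * \<bar>p - q\<bar>"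
    and L_pos: "0 < L"
begin

section \<open>Existence, order and limits of solutions of bounded Lipschitz fields\<close>

lemma M_nonneg: "0 \<le> M"
  using bound[of 0 0] by linarith

lemma solution_lipschitz:
  "integral_solution F x \<Longrightarrow> \<bar>x t - x s\<bar> \<le> M * \<bar>t - s\<bar>"
  unfolding integral_solution_def
  by (rule primitive_lipschitz[where h = "\<lambda>u. F u (x u)"]) (auto simp: bound M_nonneg)

lemma solution_loc_lipschitz: "integral_solution F x \<Longrightarrow> loc_lipschitz x"
  using solution_lipschitz by (rule loc_lipschitzI)

lemma solution_AE_derivative:
  "integral_solution F x \<Longrightarrow> AE t in lebesgue. (x has_real_derivative F t (x t)) (at t)"
  unfolding integral_solution_def by (rule indefinite_integral_AE_derivative) blast

lemma solution_subsolution: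
  assumes "integral_solution F x"
  shows "subsolution F x"
  unfolding subsolution_def
proof (rule conjI[OF solution_loc_lipschitz[OF assms]])
  show "AE t in lebesgue. \<exists>D. (x has_real_derivative D) (at t) \<and> D \<le> F t (x t)"
    using solution_AE_derivative[OF assms] by eventually_elim blast
qed

lemma solution_supersolution:
  assumes "integral_solution F x"
  shows "supersolution F x"
  unfolding supersolution_def
proof (rule conjI[OF solution_loc_lipschitz[OF assms]])
  show "AE t in lebesgue. \<exists>D. (x has_real_derivative D) (at t) \<and> F t (x t) \<le> D"
    using solution_AE_derivative[OF assms] by eventually_elim blast
qed

text \<open>The squared positive part \<open>y\<close> of \<open>\<alpha> - \<beta>\<close>
  satisfies \<open>y' \<le> 2 * L * y\<close> a.e., so it stays 0 once it is 0.\<close>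

lemma comparison:
  assumes \<alpha>: "subsolution F \<alpha>" and \<beta>: "supersolution F \<beta>"
    and "\<alpha> s \<le> \<beta> s" "s \<le> t"
  shows "\<alpha> t \<le> \<beta> t"
proof -
  have "AE t in lebesgue. \<exists>D D'. ((\<lambda>t. (max 0 (\<alpha> t - \<beta> t))\<^sup>2) has_real_derivative D) (at t) \<and>
        ((\<lambda>t. 2 * L * t) has_real_derivative D') (at t) \<and> D \<le> D' * (max 0 (\<alpha> t - \<beta> t))\<^sup>2"
    using \<alpha>[unfolded subsolution_def, THEN conjunct2] \<beta>[unfolded supersolution_def, THEN conjunct2]
  proof eventually_elim
    case (elim t)
    then obtain D E where D: "(\<alpha> has_real_derivative D) (at t)" "D \<le> F t (\<alpha> t)"
      and E: "(\<beta> has_real_derivative E) (at t)" "F t (\<beta> t) \<le> E" by blast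
    let ?m = "max 0 (\<alpha> t - \<beta> t)"
    have "((\<lambda>t. (max 0 (\<alpha> t - \<beta> t))\<^sup>2) has_real_derivative 2 * ?m * (D - E)) (at t)"
      using DERIV_chain2[OF DERIV_max_square DERIV_diff[OF D(1) E(1)]] .
    moreover have "((\<lambda>t. 2 * L * t) has_real_derivative 2 * L) (at t)"
      by (auto intro!: derivative_eq_intros)
    moreover have "2 * ?m * (D - E) \<le> 2 * L * ?m\<^sup>2"
    proof (cases "\<alpha> t \<le> \<beta> t")
      case False
      have "D - E \<le> L * ?m" using D(2) E(2) lipschitz[of t "\<alpha> t" "\<beta> t"] False by auto
      then have "2 * ?m * (D - E) \<le> 2 * ?m * (L * ?m)" by (intro mult_left_mono) auto
      then show ?thesis by (simp add: power2_eq_square algebra_simps)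
    qed (simp add: max_def)
    ultimately show ?case by blast
  qed
  moreover have "loc_lipschitz (\<lambda>t. (max 0 (\<alpha> t - \<beta> t))\<^sup>2)"
    using \<alpha> \<beta> unfolding subsolution_def supersolution_def
    by (intro loc_lipschitz_compose[OF loc_lipschitz_max_square] loc_lipschitz_diff) auto
  ultimately have "(max 0 (\<alpha> t - \<beta> t))\<^sup>2 \<le> (max 0 (\<alpha> s - \<beta> s))\<^sup>2 * exp (2 * L * t - 2 * L * s)"
    using \<open>s \<le> t\<close> by (intro gronwall_AE loc_lipschitz_cmult loc_lipschitz_ident)
  then show ?thesis using \<open>\<alpha> s \<le> \<beta> s\<close> by (auto simp: max_def split: if_splits)
qed

lemma mirror: "bounded_lipschitz_field (mirror_field F) M L"
proof
  fix x :: "real \<Rightarrow> real" and a b assume "continuous_on UNIV x"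
  then have "continuous_on UNIV (\<lambda>u. - x (- u))"
    by (auto intro!: continuous_intros continuous_on_compose2[of UNIV x])
  from integrable[OF this, of "- b" "- a"]
  have "(\<lambda>u. F (- u) (- x u)) integrable_on {a..b}"
    using Henstock_Kurzweil_Integration.integrable_reflect_real[where f = "\<lambda>u. F u (- x (- u))" and a = "- b" and b = "- a"] by simp
  then show "(\<lambda>u. mirror_field F u (x u)) integrable_on {a..b}" by (simp add: mirror_field_def)
next
  show "\<bar>mirror_field F t p\<bar> \<le> M" for t p by (simp add: mirror_field_def bound)
  show "\<bar>mirror_field F t p - mirror_field F t q\<bar> \<le> L * \<bar>p - q\<bar>" for t p q
    using lipschitz[of "- t" "- p" "- q"] by (simp add: mirror_field_def abs_minus_commute)
qed (rule L_pos)

text \<open>Comparison of sub- and supersolutions works forwards in time. For \<open>t < s\<close>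
  it is applied to the mirrored field, where the two solutions change places.\<close>

lemma solution_order:
  assumes x: "integral_solution F x" and y: "integral_solution F y" and "x s \<le> y s"
  shows "x t \<le> y t"
proof (cases "s \<le> t")
  case True
  then show ?thesis using comparison assms solution_subsolution solution_supersolution by blast
next
  case False
  interpret m: bounded_lipschitz_field "mirror_field F" M L by (rule mirror)
  have "mirror y (- t) \<le> mirror x (- t)"
  proof (rule m.comparison[where \<alpha> = "mirror y" and \<beta> = "mirror x" and s = "- s" and t = "- t"])
    show "subsolution (mirror_field F) (mirror y)"
      by (rule m.solution_subsolution[OF integral_solution_mirror[OF y]])
    show "supersolution (mirror_field F) (mirror x)"
      by (rule m.solution_supersolution[OF integral_solution_mirror[OF x]])
    show "mirror y (- s) \<le> mirror x (- s)" "- s \<le> - t"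
      using False \<open>x s \<le> y s\<close> by (simp_all add: mirror_def)
  qed
  then show ?thesis by (simp add: mirror_def)
qed

text \<open>The Picard operator is a contraction in the norm
  \<open>sup\<^sub>t exp (- 2 * L * \<bar>t - s\<bar>) * \<bar>x t\<bar>\<close>; here it acts on the weighted functions.\<close>

lemma picard:
  obtains x where "integral_solution F x" "x s = x0"
proof -
  \<comment> \<open>The factor 2 in the exponent produces the contraction constant
    \<open>1 / 2\<close>: between \<open>s\<close> and \<open>t\<close> the integral of
    \<open>L * w\<close> is at most \<open>w t / 2\<close>.\<close>
  define w where "w = (\<lambda>t. exp (2 * L * \<bar>t - s\<bar>))"
  have w0: "w t > 0" for t by (simp add: w_def)
  have wc: "continuous_on UNIV w" unfolding w_def by (intro continuous_intros)
  define h where "h = (\<lambda>(y :: real \<Rightarrow>\<^sub>C real) u. F u (w u * y u))"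
  have hint: "h y integrable_on {a..b}" for y a b
    unfolding h_def by (intro integrable continuous_intros wc) auto
  have hb: "\<bar>h y u\<bar> \<le> M" for y u unfolding h_def by (rule bound)
  define P where "P = (\<lambda>y t. x0 + (primitive (h y) t - primitive (h y) s))"
  have Plip: "\<bar>P y t - P y r\<bar> \<le> M * \<bar>t - r\<bar>" for y t r
    using primitive_lipschitz[OF has_integral_primitive[OF hint] _ M_nonneg, of y t r] hb
    by (simp add: P_def)
  have Pc: "continuous_on UNIV (P y)" for y
    by (intro loc_lipschitz_continuous loc_lipschitzI[OF Plip])
  have Pb: "\<bar>P y t\<bar> \<le> \<bar>x0\<bar> + M * \<bar>t - s\<bar>" for y t
    using Plip[of y t s] by (simp add: P_def)
  \<comment> \<open>The image curves grow at most linearly, and \<open>w t\<close> dominates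
    \<open>2 * L * \<bar>t - s\<bar>\<close>; divided by the weight they are bounded.\<close>
  have Tb: "norm (P y t / w t) \<le> \<bar>x0\<bar> + M / (2 * L)" for y t
  proof -
    have "2 * L * \<bar>t - s\<bar> \<le> w t" unfolding w_def using exp_ge_add_one_self[of "2 * L * \<bar>t - s\<bar>"] by linarith
    then have "M * \<bar>t - s\<bar> \<le> M / (2 * L) * w t"
      using M_nonneg L_pos mult_left_mono[of "2 * L * \<bar>t - s\<bar>" "w t" "M / (2 * L)"] by simp
    moreover have "\<bar>x0\<bar> * 1 \<le> \<bar>x0\<bar> * w t" unfolding w_def using L_pos by (intro mult_left_mono) auto
    ultimately have "\<bar>P y t\<bar> \<le> (\<bar>x0\<bar> + M / (2 * L)) * w t" using Pb[of y t] by (simp add: algebra_simps)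
    then show ?thesis using w0[of t] by (simp add: divide_le_eq)
  qed
  have Tin: "(\<lambda>t. P y t / w t) \<in> bcontfun" for y
    using Tb by (intro bcontfun_normI continuous_intros Pc wc) (auto simp: w_def)
  define T where "T = (\<lambda>y. Bcontfun (\<lambda>t. P y t / w t))"
  have T: "apply_bcontfun (T y) t = P y t / w t" for y t
    unfolding T_def by (simp add: Bcontfun_inverse[OF Tin])
  have diff: "\<bar>P y t - P z t\<bar> \<le> 1 / 2 * dist y z * w t" for y z t
  proof -
    define d where "d = dist y z"
    have "d \<ge> 0" by (simp add: d_def)
    define G where "G = (\<lambda>u. primitive (h y) u - primitive (h z) u)"
    have G: "((\<lambda>u. h y u - h z u) has_integral (G b - G a)) {a..b}" if "a \<le> b" for a b
      using has_integral_diff[OF has_integral_primitive[OF hint that, of y] has_integral_primitive[OF hint that, of z]]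
      by (simp add: G_def algebra_simps)
    have hd: "\<bar>h y u - h z u\<bar> \<le> L * d * w u" for u
    proof -
      have "\<bar>y u - z u\<bar> \<le> d" using dist_bounded[of y u z] by (simp add: dist_real_def d_def)
      then have "L * (w u * \<bar>y u - z u\<bar>) \<le> L * (w u * d)"
        using w0[of u] L_pos by (intro mult_left_mono) auto
      moreover have "\<bar>h y u - h z u\<bar> \<le> L * \<bar>w u * y u - w u * z u\<bar>" unfolding h_def by (rule lipschitz)
      moreover have "\<bar>w u * y u - w u * z u\<bar> = w u * \<bar>y u - z u\<bar>"
        using w0[of u] by (simp add: abs_mult flip: right_diff_distrib)
      ultimately show ?thesis by (simp add: algebra_simps)
    qed
    have "\<bar>G t - G s\<bar> \<le> 1 / 2 * d * w t"
    proof (cases "s \<le> t")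
      case True
      have "((\<lambda>u. L * d * exp (2 * L * (u - s))) has_integral
          (d / 2 * exp (2 * L * (t - s)) - d / 2 * exp (2 * L * (s - s)))) {s..t}"
        using True by (intro fundamental_theorem_of_calculus)
          (auto intro!: derivative_eq_intros simp flip: has_real_derivative_iff_has_vector_derivative)
      then have "\<bar>G t - G s\<bar> \<le> d / 2 * exp (2 * L * (t - s)) - d / 2 * exp (2 * L * (s - s))"
      proof (rule has_integral_abs_le[OF G[OF True]])
        show "\<bar>h y u - h z u\<bar> \<le> L * d * exp (2 * L * (u - s))" if "u \<in> {s..t}" for u
          using hd[of u] that by (simp add: w_def)
      qed
      then show ?thesis using True \<open>d \<ge> 0\<close> by (simp add: w_def)
    next
      case False
      then have "t \<le> s" by simp
      have "((\<lambda>u. L * d * exp (2 * L * (s - u))) has_integral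
          (- d / 2 * exp (2 * L * (s - s)) - (- d / 2) * exp (2 * L * (s - t)))) {t..s}"
        using False by (intro fundamental_theorem_of_calculus)
          (auto intro!: derivative_eq_intros simp flip: has_real_derivative_iff_has_vector_derivative)
      then have "\<bar>G s - G t\<bar> \<le> - d / 2 * exp (2 * L * (s - s)) - (- d / 2) * exp (2 * L * (s - t))"
      proof (rule has_integral_abs_le[OF G[OF \<open>t \<le> s\<close>]])
        show "\<bar>h y u - h z u\<bar> \<le> L * d * exp (2 * L * (s - u))" if "u \<in> {t..s}" for u
          using hd[of u] that by (simp add: w_def)
      qed
      then have "\<bar>G t - G s\<bar> \<le> d / 2 * exp (2 * L * (s - t)) - d / 2"
        by (simp add: abs_minus_commute)
      then show ?thesis using False \<open>d \<ge> 0\<close> by (simp add: w_def)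
    qed
    then show ?thesis by (simp add: P_def G_def d_def algebra_simps)
  qed
  have "dist (T y) (T z) \<le> 1 / 2 * dist y z" for y z
  proof (rule dist_bound)
    fix t
    have "dist (T y t) (T z t) = \<bar>P y t - P z t\<bar> / w t"
      using w0[of t] by (simp add: T dist_real_def flip: diff_divide_distrib)
    also have "\<dots> \<le> 1 / 2 * dist y z"
      using diff[of y t z] w0[of t] by (simp add: divide_le_eq)
    finally show "dist (T y t) (T z t) \<le> 1 / 2 * dist y z" .
  qed
  then obtain y where y: "T y = y" using banach_fix_type[of "1/2" T] by auto
  define x where "x = (\<lambda>t. w t * y t)"
  have x: "x t = P y t" for t
    using T[of y t] w0[of t] unfolding x_def y by simp
  have "h y = (\<lambda>u. F u (x u))" by (simp add: h_def x_def)
  then have "integral_solution F x"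
    unfolding integral_solution_def x using has_integral_primitive[OF hint, of _ _ y] by (simp add: P_def x)
  moreover have "x s = x0" by (simp add: x P_def)
  ultimately show thesis by (rule that)
qed

text \<open>Dominated convergence with the constant majorant \<open>M + B\<close>. The additive
  constants vary so that limits in the parameter are covered as well.\<close>

lemma solution_limit:
  assumes sol: "\<And>n. integral_solution (\<lambda>t x. F t x + c n) (X n)"
    and c: "c \<longlonglongrightarrow> c'" and lim: "\<And>t. (\<lambda>n. X n t) \<longlonglongrightarrow> x t"
  shows "integral_solution (\<lambda>t x. F t x + c') x"
  unfolding integral_solution_def
proof (intro allI impI)
  fix s t :: real assume "s \<le> t"
  obtain B where B: "\<And>n. \<bar>c n\<bar> \<le> B"
    using convergent_imp_Bseq[OF convergentI[OF c]] unfolding Bseq_def by auto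
  let ?g = "\<lambda>n u. F u (X n u) + c n"
  have i: "(?g n has_integral (X n t - X n s)) {s..t}" for n
    using sol \<open>s \<le> t\<close> unfolding integral_solution_def by blast
  have conv: "(\<lambda>n. ?g n u) \<longlonglongrightarrow> F u (x u) + c'" for u
  proof (intro tendsto_add c)
    have "(\<lambda>n. F u (X n u) - F u (x u)) \<longlonglongrightarrow> 0"
    proof (rule Lim_null_comparison)
      show "\<forall>\<^sub>F n in sequentially. norm (F u (X n u) - F u (x u)) \<le> L * \<bar>X n u - x u\<bar>"
        using lipschitz by simp
      show "(\<lambda>n. L * \<bar>X n u - x u\<bar>) \<longlonglongrightarrow> 0"
        using lim[of u] by (auto intro!: tendsto_eq_intros)
    qed
    then show "(\<lambda>n. F u (X n u)) \<longlonglongrightarrow> F u (x u)" by (simp add: LIM_zero_iff)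
  qed
  have le: "norm (?g n u) \<le> M + B" for n u using bound[of u "X n u"] B[of n] by (simp add: abs_le_iff)
  have 1: "(\<lambda>u. F u (x u) + c') integrable_on {s..t}"
    and 2: "(\<lambda>n. integral {s..t} (?g n)) \<longlonglongrightarrow> integral {s..t} (\<lambda>u. F u (x u) + c')"
    using dominated_convergence[of ?g "{s..t}" "\<lambda>_. M + B", OF _ _ le conv] i by (auto simp: integrable_on_def)
  have "(\<lambda>n. X n t - X n s) \<longlonglongrightarrow> x t - x s" by (intro tendsto_diff lim)
  moreover have "integral {s..t} (?g n) = X n t - X n s" for n using i by (rule integral_unique)
  ultimately have "integral {s..t} (\<lambda>u. F u (x u) + c') = x t - x s"
    using 2 LIMSEQ_unique by simp
  then show "((\<lambda>u. F u (x u) + c') has_integral (x t - x s)) {s..t}"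
    using 1 by (simp add: has_integral_integrable_integral)
qed

end

section \<open>Bounded solutions for concave coercive fields\<close>

text \<open>One set \<open>T\<close> of full measure replaces all exceptional sets. The last two
  inequalities of \<open>estimates\<close> place the graph over \<open>{- N..N}\<close> between two
  parabolas touching it at \<open>p\<close>: the upper one expresses strict concavity, the lower one
  the Lipschitz bound on the derivative. \<open>coercive\<close> keeps from (f6) that
  \<open>f\<close> tends to minus infinity uniformly on \<open>T\<close>.\<close>

locale concave_field =
  fixes f fx :: "real \<Rightarrow> real \<Rightarrow> real" and T :: "real set"
  assumes f_measurable: "(\<lambda>(t, x). f t x) \<in> borel_measurable borel"
    and AE_T: "AE t in lebesgue. t \<in> T"
    and f_derivative: "t \<in> T \<Longrightarrow> (f t has_real_derivative fx t p) (at p)"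
    and estimates: "\<exists>b>0. \<exists>d>0. \<forall>t\<in>T. \<forall>p\<in>{- N..N}. \<forall>q\<in>{- N..N}.
        \<bar>f t p\<bar> \<le> b \<and> \<bar>fx t p\<bar> \<le> b \<and> \<bar>f t p - f t q\<bar> \<le> b * \<bar>p - q\<bar> \<and>
        f t q \<le> f t p + fx t p * (q - p) - d * (q - p)\<^sup>2 \<and>
        f t p + fx t p * (q - p) - b * (q - p)\<^sup>2 \<le> f t q"
    and coercive: "\<exists>K>0. \<forall>t\<in>T. \<forall>p. K \<le> \<bar>p\<bar> \<longrightarrow> f t p \<le> c"
begin

definition bounds :: "real \<Rightarrow> real \<Rightarrow> real \<Rightarrow> bool" where
  "bounds N b d \<longleftrightarrow> b > 0 \<and> d > 0 \<and> (\<forall>t\<in>T. \<forall>p\<in>{- N..N}. \<forall>q\<in>{- N..N}.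
        \<bar>f t p\<bar> \<le> b \<and> \<bar>fx t p\<bar> \<le> b \<and> \<bar>f t p - f t q\<bar> \<le> b * \<bar>p - q\<bar> \<and>
        f t q \<le> f t p + fx t p * (q - p) - d * (q - p)\<^sup>2 \<and>
        f t p + fx t p * (q - p) - b * (q - p)\<^sup>2 \<le> f t q)"

lemma boundsE:
  obtains b d where "bounds N b d"
  unfolding bounds_def using estimates[of N] by (elim exE conjE) blast

lemma boundsD:
  assumes "bounds N b d"
  shows "b > 0" "d > 0"
    "t \<in> T \<Longrightarrow> \<bar>p\<bar> \<le> N \<Longrightarrow> \<bar>f t p\<bar> \<le> b"
    "t \<in> T \<Longrightarrow> \<bar>p\<bar> \<le> N \<Longrightarrow> \<bar>fx t p\<bar> \<le> b"
    "t \<in> T \<Longrightarrow> \<bar>p\<bar> \<le> N \<Longrightarrow> \<bar>q\<bar> \<le> N \<Longrightarrow> \<bar>f t p - f t q\<bar> \<le> b * \<bar>p - q\<bar>"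
    "t \<in> T \<Longrightarrow> \<bar>p\<bar> \<le> N \<Longrightarrow> \<bar>q\<bar> \<le> N \<Longrightarrow> f t q \<le> f t p + fx t p * (q - p) - d * (q - p)\<^sup>2"
    "t \<in> T \<Longrightarrow> \<bar>p\<bar> \<le> N \<Longrightarrow> \<bar>q\<bar> \<le> N \<Longrightarrow> f t p + fx t p * (q - p) - b * (q - p)\<^sup>2 \<le> f t q"
proof -
  have *: "\<forall>t\<in>T. \<forall>p\<in>{- N..N}. \<forall>q\<in>{- N..N}.
        \<bar>f t p\<bar> \<le> b \<and> \<bar>fx t p\<bar> \<le> b \<and> \<bar>f t p - f t q\<bar> \<le> b * \<bar>p - q\<bar> \<and>
        f t q \<le> f t p + fx t p * (q - p) - d * (q - p)\<^sup>2 \<and>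
        f t p + fx t p * (q - p) - b * (q - p)\<^sup>2 \<le> f t q"
    using assms unfolding bounds_def by (elim conjE)
  have e: "\<bar>f t p\<bar> \<le> b \<and> \<bar>fx t p\<bar> \<le> b \<and> \<bar>f t p - f t q\<bar> \<le> b * \<bar>p - q\<bar> \<and>
        f t q \<le> f t p + fx t p * (q - p) - d * (q - p)\<^sup>2 \<and>
        f t p + fx t p * (q - p) - b * (q - p)\<^sup>2 \<le> f t q"
    if "t \<in> T" "\<bar>p\<bar> \<le> N" "\<bar>q\<bar> \<le> N" for t p q
    by (rule *[rule_format]) (use that in auto)
  show "b > 0" using assms unfolding bounds_def by (elim conjE)
  show "d > 0" using assms unfolding bounds_def by (elim conjE)
  show "t \<in> T \<Longrightarrow> \<bar>p\<bar> \<le> N \<Longrightarrow> \<bar>f t p\<bar> \<le> b"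
    "t \<in> T \<Longrightarrow> \<bar>p\<bar> \<le> N \<Longrightarrow> \<bar>fx t p\<bar> \<le> b"
    "t \<in> T \<Longrightarrow> \<bar>p\<bar> \<le> N \<Longrightarrow> \<bar>q\<bar> \<le> N \<Longrightarrow> \<bar>f t p - f t q\<bar> \<le> b * \<bar>p - q\<bar>"
    "t \<in> T \<Longrightarrow> \<bar>p\<bar> \<le> N \<Longrightarrow> \<bar>q\<bar> \<le> N \<Longrightarrow> f t q \<le> f t p + fx t p * (q - p) - d * (q - p)\<^sup>2"
    "t \<in> T \<Longrightarrow> \<bar>p\<bar> \<le> N \<Longrightarrow> \<bar>q\<bar> \<le> N \<Longrightarrow> f t p + fx t p * (q - p) - b * (q - p)\<^sup>2 \<le> f t q"
    by (simp_all add: e)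
qed

text \<open>The derivative in the state changes sign, but the second-order terms in
  \<open>(q - p)\<^sup>2\<close> do not, so concavity survives the reflection; coercivity only sees
  \<open>\<bar>p\<bar>\<close>.\<close>

lemma mirror_concave_field:
  "concave_field (mirror_field f) (\<lambda>t x. - fx (- t) (- x)) {t. - t \<in> T}"
proof
  have "(\<lambda>(t, x). (- t :: real, - x :: real)) \<in> borel_measurable borel"
    unfolding split_beta
    by (intro borel_measurable_continuous_onI continuous_intros)
  from measurable_compose[OF this f_measurable]
  show "(\<lambda>(t, x). mirror_field f t x) \<in> borel_measurable borel"
    by (simp add: mirror_field_def split_beta)
  show "AE t in lebesgue. t \<in> {t. - t \<in> T}"
    using AE_lebesgue_uminus[OF AE_T] by simp
  show "(mirror_field f t has_real_derivative - fx (- t) (- p)) (at p)" if "t \<in> {t. - t \<in> T}" for t p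
  proof -
    have "((\<lambda>x. f (- t) (- x)) has_real_derivative fx (- t) (- p) * - 1) (at p)"
      using that by (intro DERIV_chain2[OF f_derivative]) (auto intro!: derivative_eq_intros)
    then show ?thesis by (simp add: mirror_field_def)
  qed
  show "\<exists>K>0. \<forall>t\<in>{t. - t \<in> T}. \<forall>p. K \<le> \<bar>p\<bar> \<longrightarrow> mirror_field f t p \<le> c" for c
    using coercive[of c] unfolding mirror_field_def by (metis abs_minus_cancel mem_Collect_eq)
  fix N :: real
  obtain b d where bd: "b > 0" "d > 0" and *: "\<forall>t\<in>T. \<forall>p\<in>{- N..N}. \<forall>q\<in>{- N..N}.
        \<bar>f t p\<bar> \<le> b \<and> \<bar>fx t p\<bar> \<le> b \<and> \<bar>f t p - f t q\<bar> \<le> b * \<bar>p - q\<bar> \<and>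
        f t q \<le> f t p + fx t p * (q - p) - d * (q - p)\<^sup>2 \<and>
        f t p + fx t p * (q - p) - b * (q - p)\<^sup>2 \<le> f t q"
    using estimates[of N] by (elim exE conjE) (rule that)
  have "\<forall>t\<in>{t. - t \<in> T}. \<forall>p\<in>{- N..N}. \<forall>q\<in>{- N..N}.
        \<bar>mirror_field f t p\<bar> \<le> b \<and> \<bar>- fx (- t) (- p)\<bar> \<le> b \<and>
        \<bar>mirror_field f t p - mirror_field f t q\<bar> \<le> b * \<bar>p - q\<bar> \<and>
        mirror_field f t q \<le> mirror_field f t p + - fx (- t) (- p) * (q - p) - d * (q - p)\<^sup>2 \<and>
        mirror_field f t p + - fx (- t) (- p) * (q - p) - b * (q - p)\<^sup>2 \<le> mirror_field f t q"
  proof (intro ballI)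
    fix t p q assume "t \<in> {t. - t \<in> T}" "p \<in> {- N..N}" "q \<in> {- N..N}"
    then have "- t \<in> T" "- p \<in> {- N..N}" "- q \<in> {- N..N}" by auto
    note h = *[rule_format, OF this]
    have "\<bar>- p - - q\<bar> = \<bar>p - q\<bar>" "(- q - - p)\<^sup>2 = (q - p)\<^sup>2"
      "fx (- t) (- p) * (- q - - p) = - fx (- t) (- p) * (q - p)"
      by (simp_all add: power2_eq_square algebra_simps abs_minus_commute)
    then show "\<bar>mirror_field f t p\<bar> \<le> b \<and> \<bar>- fx (- t) (- p)\<bar> \<le> b \<and>
        \<bar>mirror_field f t p - mirror_field f t q\<bar> \<le> b * \<bar>p - q\<bar> \<and>
        mirror_field f t q \<le> mirror_field f t p + - fx (- t) (- p) * (q - p) - d * (q - p)\<^sup>2 \<and>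
        mirror_field f t p + - fx (- t) (- p) * (q - p) - b * (q - p)\<^sup>2 \<le> mirror_field f t q"
      using h unfolding mirror_field_def abs_minus_cancel by metis
  qed
  with bd show "\<exists>b>0. \<exists>d>0. \<forall>t\<in>{t. - t \<in> T}. \<forall>p\<in>{- N..N}. \<forall>q\<in>{- N..N}.
        \<bar>mirror_field f t p\<bar> \<le> b \<and> \<bar>- fx (- t) (- p)\<bar> \<le> b \<and>
        \<bar>mirror_field f t p - mirror_field f t q\<bar> \<le> b * \<bar>p - q\<bar> \<and>
        mirror_field f t q \<le> mirror_field f t p + - fx (- t) (- p) * (q - p) - d * (q - p)\<^sup>2 \<and>
        mirror_field f t p + - fx (- t) (- p) * (q - p) - b * (q - p)\<^sup>2 \<le> mirror_field f t q"
    by (intro exI[of _ b] exI[of _ d] conjI)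
qed

text \<open>The value 0 off \<open>T\<close> turns a.e. bounds into bounds at every time, as
  \<open>bounded_lipschitz_field\<close> requires.\<close>

definition trunc :: "real \<Rightarrow> real \<Rightarrow> real \<Rightarrow> real" where
  "trunc N t x = (if t \<in> T then f t (max (- N) (min N x)) else 0)"

lemma trunc_eq: "t \<in> T \<Longrightarrow> \<bar>x\<bar> \<le> N \<Longrightarrow> trunc N t x = f t x"
  by (auto simp: trunc_def max_def min_def abs_le_iff)

lemma T_measurable: "T \<in> sets lebesgue"
proof -
  obtain Z where "negligible Z" "{t. \<not> t \<in> T} \<subseteq> Z"
    using AE_T unfolding eventually_ae_filter_negligible by blast
  then have "negligible (- T)" by (metis Collect_mem_eq Collect_neg_eq negligible_subset)
  then have "- T \<in> sets lebesgue" by (rule negligible_imp_sets)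
  then show ?thesis using sets.compl_sets[of "- T" lebesgue] by (simp add: Compl_eq_Diff_UNIV double_diff)
qed

lemma f_compose_measurable:
  assumes "continuous_on UNIV x"
  shows "(\<lambda>u. f u (x u)) \<in> borel_measurable borel"
proof -
  have "(\<lambda>u. (u, x u)) \<in> borel_measurable borel"
    using assms by (intro borel_measurable_continuous_onI continuous_intros)
  from measurable_compose[OF this f_measurable] show ?thesis by simp
qed

lemma trunc_bounded_lipschitz_field:
  assumes "N > 0"
  obtains M L where "bounded_lipschitz_field (\<lambda>t x. trunc N t x + l) M L"
proof -
  obtain b d where "bounds N b d" by (rule boundsE)
  note bd = boundsD(1,3,5)[OF this]
  have cl: "\<bar>max (- N) (min N x)\<bar> \<le> N" for x using \<open>N > 0\<close> by (auto simp: max_def min_def)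
  have tb: "\<bar>trunc N t x\<bar> \<le> b" for t x
    using bd(1) bd(2)[OF _ cl] by (auto simp: trunc_def)
  have "bounded_lipschitz_field (\<lambda>t x. trunc N t x + l) (b + \<bar>l\<bar>) b"
  proof
    fix x :: "real \<Rightarrow> real" and a c assume x: "continuous_on UNIV x"
    \<comment> \<open>Borel measurability is given up here: \<open>T\<close> is known to be Lebesgue
      measurable, so the case distinction in \<open>trunc\<close> lives in the completion.\<close>
    have "(\<lambda>u. f u (max (- N) (min N (x u)))) \<in> borel_measurable lebesgue"
      by (intro measurable_completion) (simp, intro f_compose_measurable continuous_intros x)
    then have "(\<lambda>u. trunc N u (x u)) \<in> borel_measurable lebesgue"
      unfolding trunc_def using T_measurable by (intro measurable_If) auto
    then have "(\<lambda>u. trunc N u (x u)) \<in> borel_measurable (lebesgue_on {a..c})"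
      by (rule measurable_restrict_space1)
    then have "(\<lambda>u. trunc N u (x u)) integrable_on {a..c}"
      by (rule measurable_bounded_by_integrable_imp_integrable[of _ _ "\<lambda>_. b"]) (use tb in auto)
    then show "(\<lambda>u. trunc N u (x u) + l) integrable_on {a..c}"
      by (intro integrable_add integrable_const_ivl)
  next
    show "\<bar>trunc N t p + l\<bar> \<le> b + \<bar>l\<bar>" for t p
      using tb[of t p] by linarith
    show "\<bar>trunc N t p + l - (trunc N t q + l)\<bar> \<le> b * \<bar>p - q\<bar>" for t p q
    proof (cases "t \<in> T")
      case True
      have "\<bar>trunc N t p - trunc N t q\<bar> \<le> b * \<bar>max (- N) (min N p) - max (- N) (min N q)\<bar>"
        using bd(3)[OF True cl cl] True by (simp add: trunc_def)
      also have "\<dots> \<le> b * \<bar>p - q\<bar>" using bd(1) by (intro mult_left_mono) (auto simp: max_def min_def)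
      finally show ?thesis by simp
    qed (use bd(1) in \<open>simp add: trunc_def\<close>)
  qed (rule bd(1))
  then show thesis by (rule that)
qed

text \<open>The bridge between the solutions of the theorem and the clamped fields: along such a
  curve the fields agree on \<open>T\<close>, absolute continuity gives the integral equation, and
  conversely an indefinite integral is differentiable a.e.\<close>

lemma bounded_solution_iff_trunc:
  assumes "N > 0" and x: "\<And>t. \<bar>x t\<bar> \<le> N"
  shows "bounded_solution f l x \<longleftrightarrow> integral_solution (\<lambda>t x. trunc N t x + l) x"
proof
  assume "bounded_solution f l x"
  then have ac: "\<And>a b. abs_continuous_on a b x"
    and der: "AE t in lebesgue. (x has_real_derivative f t (x t) + l) (at t)"
    unfolding bounded_solution_def global_solution_def by blast+
  have "AE t in lebesgue. (x has_real_derivative trunc N t (x t) + l) (at t)"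
    using der AE_T by eventually_elim (simp add: trunc_eq x)
  then show "integral_solution (\<lambda>t x. trunc N t x + l) x"
    unfolding integral_solution_def by (intro allI impI abs_continuous_has_integral ac)
next
  assume sol: "integral_solution (\<lambda>t x. trunc N t x + l) x"
  obtain M L where "bounded_lipschitz_field (\<lambda>t x. trunc N t x + l) M L"
    using trunc_bounded_lipschitz_field[OF \<open>N > 0\<close>] .
  then interpret F: bounded_lipschitz_field "\<lambda>t x. trunc N t x + l" M L .
  have "AE t in lebesgue. (x has_real_derivative f t (x t) + l) (at t)"
    using F.solution_AE_derivative[OF sol] AE_T by eventually_elim (simp add: trunc_eq x)
  moreover have "bounded (range x)" using x by (auto simp: bounded_iff)
  ultimately show "bounded_solution f l x"
    unfolding bounded_solution_def global_solution_def
    using loc_lipschitz_abs_continuous[OF F.solution_loc_lipschitz[OF sol]] by blast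
qed

section \<open>A priori bounds for bounded solutions\<close>

lemma bounded_solution_boundE:
  assumes "bounded_solution f l x"
  obtains N where "N > 0" "\<And>t. \<bar>x t\<bar> \<le> N"
proof -
  obtain N where "N > 0" "\<forall>y\<in>range x. norm y \<le> N"
    using assms unfolding bounded_solution_def bounded_pos by blast
  then show thesis by (intro that[of N]) auto
qed

lemma bounded_solution_AE_derivative:
  "bounded_solution f l x \<Longrightarrow> AE t in lebesgue. (x has_real_derivative f t (x t) + l) (at t)"
  unfolding bounded_solution_def global_solution_def by blast

lemma bounded_solution_loc_lipschitz:
  assumes "bounded_solution f l x"
  shows "loc_lipschitz x"
proof -
  obtain N where N: "N > 0" "\<And>t. \<bar>x t\<bar> \<le> N" by (rule bounded_solution_boundE[OF assms]) blast
  obtain M L where "bounded_lipschitz_field (\<lambda>t x. trunc N t x + l) M L"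
    using trunc_bounded_lipschitz_field[OF \<open>N > 0\<close>] .
  then interpret F: bounded_lipschitz_field "\<lambda>t x. trunc N t x + l" M L .
  show ?thesis
    using F.solution_loc_lipschitz bounded_solution_iff_trunc[where x = x, OF N] assms by blast
qed

lemma bounded_solution_mirror:
  assumes "bounded_solution f l x"
  shows "bounded_solution (mirror_field f) l (mirror x)"
proof -
  interpret m: concave_field "mirror_field f" "\<lambda>t x. - fx (- t) (- x)" "{t. - t \<in> T}"
    by (rule mirror_concave_field)
  obtain N where N: "N > 0" "\<And>t. \<bar>x t\<bar> \<le> N" by (rule bounded_solution_boundE[OF assms]) blast
  have sol: "integral_solution (\<lambda>t x. trunc N t x + l) x"
    using bounded_solution_iff_trunc[where x = x, OF N] assms by blast
  have "mirror_field (\<lambda>t x. trunc N t x + l) = (\<lambda>t x. m.trunc N t x + l)"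
  proof (intro ext)
    fix t x
    have "max (- N) (min N (- x)) = - max (- N) (min N x)" using N(1) by (auto simp: max_def min_def)
    then show "mirror_field (\<lambda>t x. trunc N t x + l) t x = m.trunc N t x + l"
      unfolding m.trunc_def unfolding mirror_field_def trunc_def by simp
  qed
  then have "integral_solution (\<lambda>t x. m.trunc N t x + l) (mirror x)"
    using integral_solution_mirror[OF sol] by simp
  then show ?thesis
    using m.bounded_solution_iff_trunc[OF N(1), of "mirror x"] N(2) by (simp add: mirror_def)
qed

text \<open>Above level \<open>K\<close> a solution falls with speed at least 1, so a point above
  \<open>K\<close> would force it to be unbounded in the past.\<close>

lemma bounded_solution_upper_bound:
  assumes K: "\<And>t p. t \<in> T \<Longrightarrow> K \<le> \<bar>p\<bar> \<Longrightarrow> f t p + l \<le> - 1" "K > 0"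
    and sol: "bounded_solution f l x"
  shows "x t \<le> K"
proof -
  obtain N where N: "N > 0" "\<And>t. \<bar>x t\<bar> \<le> N" by (rule bounded_solution_boundE[OF sol]) blast
  let ?y = "\<lambda>t. (max 0 (x t - K))\<^sup>2"
  have m: "max 0 (x t - K) \<le> N" for t using N(1) N(2)[of t] \<open>K > 0\<close> by (auto simp: abs_le_iff)
  \<comment> \<open>The excess \<open>m\<close> over \<open>K\<close> lies between 0 and
    \<open>N\<close> and, where positive, has slope at most -1. Hence \<open>m\<^sup>2\<close> has
    slope at most \<open>- 2 * m\<close>, and \<open>- 2 * m \<le> - (2 / N) * m\<^sup>2\<close>;
    this explains the rate \<open>2 / N\<close>.\<close>
  have "?y t \<le> 0"
  proof (rule nonpos_if_decaying[of ?y "2 / N" "N\<^sup>2"])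
    show "loc_lipschitz ?y"
      by (intro loc_lipschitz_compose[OF loc_lipschitz_max_square] loc_lipschitz_diff bounded_solution_loc_lipschitz[OF sol] loc_lipschitz_const)
    show "?y t \<le> N\<^sup>2" for t using m[of t] by (intro power_mono) auto
    show "AE t in lebesgue. \<exists>D. (?y has_real_derivative D) (at t) \<and> D \<le> - (2 / N) * ?y t"
      using bounded_solution_AE_derivative[OF sol] AE_T
    proof eventually_elim
      case (elim t)
      let ?m = "max 0 (x t - K)"
      have "((\<lambda>t. x t - K) has_real_derivative f t (x t) + l) (at t)"
        using elim(1) by (auto intro!: derivative_eq_intros)
      from DERIV_chain2[OF DERIV_max_square this]
      have "(?y has_real_derivative 2 * ?m * (f t (x t) + l)) (at t)" .
      moreover have "2 * ?m * (f t (x t) + l) \<le> - (2 / N) * ?m\<^sup>2"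
      proof (cases "x t \<le> K")
        case False
        then have "f t (x t) + l \<le> - 1" using K elim(2) by auto
        then have "2 * ?m * (f t (x t) + l) \<le> 2 * ?m * (- 1)" by (intro mult_left_mono) auto
        moreover have "?m * ?m \<le> N * ?m" using m[of t] by (intro mult_right_mono) auto
        then have "(2 / N) * ?m\<^sup>2 \<le> 2 * ?m" using N(1) by (simp add: power2_eq_square divide_le_eq algebra_simps)
        ultimately show ?thesis by linarith
      qed (simp add: max_def)
      ultimately show ?case by blast
    qed
  qed (use N(1) in auto)
  then show ?thesis by (simp add: max_def split: if_splits)
qed

text \<open>Below \<open>- K\<close> a solution falls as well, hence would leave every bounded set
  in the future. The reflection turns this into the upper bound, as the assumption on
  \<open>K\<close> is symmetric.\<close>

lemma bounded_solution_bound: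
  assumes K: "\<And>t p. t \<in> T \<Longrightarrow> K \<le> \<bar>p\<bar> \<Longrightarrow> f t p + l \<le> - 1" "K > 0"
    and sol: "bounded_solution f l x"
  shows "\<bar>x t\<bar> \<le> K"
proof -
  interpret m: concave_field "mirror_field f" "\<lambda>t x. - fx (- t) (- x)" "{t. - t \<in> T}"
    by (rule mirror_concave_field)
  have "mirror x (- t) \<le> K"
    by (rule m.bounded_solution_upper_bound[OF _ K(2) bounded_solution_mirror[OF sol]])
      (auto simp: mirror_field_def intro!: K(1))
  then show ?thesis
    using bounded_solution_upper_bound[OF K sol, of t] by (simp add: mirror_def abs_le_iff)
qed

text \<open>One \<open>K\<close> serves all parameters up to \<open>l1\<close>; this gives a common
  bound along a decreasing sequence of parameters.\<close>

lemma coercive_shiftE: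
  obtains K where "K > 0" "\<And>t p l. t \<in> T \<Longrightarrow> K \<le> \<bar>p\<bar> \<Longrightarrow> l \<le> l1 \<Longrightarrow> f t p + l \<le> - 1"
proof -
  obtain K where "K > 0" and K: "\<forall>t\<in>T. \<forall>p. K \<le> \<bar>p\<bar> \<longrightarrow> f t p \<le> - 1 - l1" using coercive by blast
  show thesis
  proof (rule that[OF \<open>K > 0\<close>])
    fix t p l assume "t \<in> T" "K \<le> \<bar>p\<bar>" "l \<le> l1"
    then have "f t p \<le> - 1 - l1" using K by blast
    then show "f t p + l \<le> - 1" using \<open>l \<le> l1\<close> by linarith
  qed
qed

text \<open>Maximality: a bounded solution is below \<open>N\<close> at the starting time of every
  approximation, hence below all of them. The subsolution is the barrier that keeps their decreasing
  limit finite.\<close>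

lemma maximal_bounded_solution:
  assumes sub: "subsolution (\<lambda>t x. f t x + l) \<alpha>" and \<alpha>: "\<And>t. \<bar>\<alpha> t\<bar> \<le> A"
  obtains a where "bounded_solution f l a" "\<alpha> \<le> a" "\<And>x. bounded_solution f l x \<Longrightarrow> x \<le> a"
proof -
  obtain K where K: "K > 0" "\<And>t p l'. t \<in> T \<Longrightarrow> K \<le> \<bar>p\<bar> \<Longrightarrow> l' \<le> l \<Longrightarrow> f t p + l' \<le> - 1"
    by (rule coercive_shiftE[of l]) blast
  note Kl = K(2)[OF _ _ order_refl]
  \<comment> \<open>\<open>N \<ge> K\<close> makes the constant \<open>N\<close> a supersolution, so
    the approximations stay below \<open>N\<close> after their start; \<open>N \<ge> A\<close> puts
    \<open>\<alpha>\<close> below that level.\<close>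
  define N where "N = max K A"
  have "N > 0" "K \<le> N" "A \<le> N" using K(1) by (auto simp: N_def)
  have \<alpha>N: "\<bar>\<alpha> t\<bar> \<le> N" for t using \<alpha>[of t] \<open>A \<le> N\<close> by linarith
  let ?F = "\<lambda>t x. trunc N t x + l"
  obtain M L where "bounded_lipschitz_field ?F M L"
    using trunc_bounded_lipschitz_field[OF \<open>N > 0\<close>] .
  then interpret F: bounded_lipschitz_field ?F M L .
  have "\<forall>n. \<exists>x. integral_solution ?F x \<and> x (- real n) = N"
  proof
    fix n show "\<exists>x. integral_solution ?F x \<and> x (- real n) = N"
      by (rule F.picard[of "- real n" N]) blast
  qed
  from choice[OF this] obtain X where X: "\<And>n. integral_solution ?F (X n)" "\<And>n. X n (- real n) = N" by blast
  have "supersolution ?F (\<lambda>_. N)"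
    unfolding supersolution_def
  proof (intro conjI loc_lipschitz_const)
    show "AE t in lebesgue. \<exists>D. ((\<lambda>_. N) has_real_derivative D) (at t) \<and> ?F t N \<le> D"
      using AE_T
    proof eventually_elim
      case (elim t)
      have "?F t N \<le> 0" using Kl[OF elim, of N] \<open>K \<le> N\<close> \<open>N > 0\<close> elim by (simp add: trunc_eq)
      then show ?case by (intro exI[of _ 0]) auto
    qed
  qed
  note XN = F.comparison[OF F.solution_subsolution[OF X(1)] this]
  have le_N: "X n t \<le> N" if "- real n \<le> t" for n t
    using XN[of n "- real n" t] X(2)[of n] that by simp
  \<comment> \<open>\<open>X (Suc n)\<close> starts at level \<open>N\<close> one unit earlier and
    has dropped to at most \<open>N\<close> when \<open>X n\<close> starts there; the order then
    holds at all times, earlier ones included.\<close>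
  have dec: "decseq (\<lambda>n. X n t)" for t
  proof (rule decseq_SucI)
    fix n show "X (Suc n) t \<le> X n t"
      by (rule F.solution_order[OF X(1) X(1), of _ "- real n"]) (use le_N[of "Suc n" "- real n"] X(2) in simp)
  qed
  \<comment> \<open>For \<open>t < - real n\<close> forward comparison with \<open>X n\<close> says
    nothing. A larger index \<open>k\<close>, whose start precedes \<open>t\<close>, is compared
    instead, and \<open>X k \<le> X n\<close>.\<close>
  have below: "y t \<le> X n t" if y: "subsolution ?F y" "\<And>t. y t \<le> N" for y n t
  proof -
    define k where "k = max n (nat \<lceil>- t\<rceil>)"
    have "- real k \<le> t" unfolding k_def by linarith
    then have "y t \<le> X k t"
      using F.comparison[OF y(1) F.solution_supersolution[OF X(1)], of "- real k" k t] y(2) X(2) by simp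
    also have "\<dots> \<le> X n t" using dec[of t] unfolding k_def by (simp add: decseq_def)
    finally show ?thesis .
  qed
  have sub': "subsolution ?F \<alpha>"
    unfolding subsolution_def
  proof
    show "AE t in lebesgue. \<exists>D. (\<alpha> has_real_derivative D) (at t) \<and> D \<le> ?F t (\<alpha> t)"
      using sub[unfolded subsolution_def, THEN conjunct2] AE_T
      by eventually_elim (simp add: trunc_eq \<alpha>N)
  qed (use sub in \<open>simp add: subsolution_def\<close>)
  have \<alpha>_le: "\<alpha> t \<le> X n t" for n t using below[OF sub'] \<alpha>N by (simp add: abs_le_iff)
  have "\<exists>z. (\<lambda>n. X n t) \<longlonglongrightarrow> z" for t
    using decseq_convergent[OF dec[of t], of "\<alpha> t"] \<alpha>_le by metis
  then obtain a where a: "\<And>t. (\<lambda>n. X n t) \<longlonglongrightarrow> a t" by metis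
  have "integral_solution (\<lambda>t x. ?F t x + 0) a"
    by (rule F.solution_limit[of "\<lambda>_. 0" X]) (use X(1) a in auto)
  then have sol: "integral_solution ?F a" by simp
  have \<alpha>a: "\<alpha> t \<le> a t" for t using a[of t] \<alpha>_le by (intro LIMSEQ_le_const) auto
  have aN: "a t \<le> N" for t
    using a[of t]
  proof (rule LIMSEQ_le_const2)
    show "\<exists>k. \<forall>n\<ge>k. X n t \<le> N"
    proof (intro exI allI impI)
      fix n assume "nat \<lceil>- t\<rceil> \<le> n"
      then have "- real n \<le> t" by linarith
      then show "X n t \<le> N" by (rule le_N)
    qed
  qed
  have "\<bar>a t\<bar> \<le> N" for t using \<alpha>N[of t] \<alpha>a[of t] aN[of t] by linarith
  then have "bounded_solution f l a" using bounded_solution_iff_trunc[OF \<open>N > 0\<close>] sol by blast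
  moreover have "\<alpha> \<le> a" using \<alpha>a by (rule le_funI)
  moreover have "x \<le> a" if x: "bounded_solution f l x" for x
  proof (rule le_funI)
    fix t
    have xK: "\<bar>x t\<bar> \<le> N" for t using bounded_solution_bound[OF Kl K(1) x, of t] \<open>K \<le> N\<close> by simp
    have "integral_solution ?F x" using bounded_solution_iff_trunc[where x = x, OF \<open>N > 0\<close> xK] x by blast
    moreover have "x t \<le> N" for t using xK[of t] by linarith
    ultimately have "x t \<le> X n t" for n using below F.solution_subsolution by blast
    then show "x t \<le> a t" using a[of t] by (intro LIMSEQ_le_const) auto
  qed
  ultimately show thesis by (rule that)
qed

lemma bounded_solution_subsolution:
  assumes "bounded_solution f l x" "l \<le> l'"
  shows "subsolution (\<lambda>t x. f t x + l') x"
proof -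
  have "AE t in lebesgue. \<exists>D. (x has_real_derivative D) (at t) \<and> D \<le> f t (x t) + l'"
    using bounded_solution_AE_derivative[OF assms(1)]
  proof eventually_elim
    case (elim t)
    then show ?case using assms(2) by (intro exI[of _ "f t (x t) + l"]) simp
  qed
  then show ?thesis
    unfolding subsolution_def using bounded_solution_loc_lipschitz[OF assms(1)] by blast
qed

lemma bdd_set_nonempty_iff: "bdd_set f l \<noteq> {} \<longleftrightarrow> (\<exists>x. bounded_solution f l x)"
  unfolding bdd_set_def by auto

text \<open>This gives meaning to the definite descriptions. The lower solution is the mirror image
  of the maximal one for the mirrored field, and a solution starting between the two stays between
  them in both time directions, so it is bounded.\<close>

lemma extremal_solutions:
  assumes "bdd_set f l \<noteq> {}"
  shows "bounded_solution f l (upper_sol f l)" "bounded_solution f l (lower_sol f l)"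
    "\<And>x. bounded_solution f l x \<Longrightarrow> lower_sol f l \<le> x \<and> x \<le> upper_sol f l"
    "bdd_set f l = {(s, x0). lower_sol f l s \<le> x0 \<and> x0 \<le> upper_sol f l s}"
proof -
  interpret m: concave_field "mirror_field f" "\<lambda>t x. - fx (- t) (- x)" "{t. - t \<in> T}"
    by (rule mirror_concave_field)
  obtain x where x: "bounded_solution f l x" using assms bdd_set_nonempty_iff by blast
  obtain N where "N > 0" and N: "\<And>t. \<bar>x t\<bar> \<le> N" by (rule bounded_solution_boundE[OF x]) blast
  obtain a where a: "bounded_solution f l a" "x \<le> a" "\<And>y. bounded_solution f l y \<Longrightarrow> y \<le> a"
    by (rule maximal_bounded_solution[OF bounded_solution_subsolution[OF x order_refl] N]) blast
  have mx: "bounded_solution (mirror_field f) l (mirror x)" using x by (rule bounded_solution_mirror)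
  have mN: "\<bar>mirror x t\<bar> \<le> N" for t using N by (simp add: mirror_def)
  obtain r' where r': "bounded_solution (mirror_field f) l r'" "mirror x \<le> r'"
    "\<And>y. bounded_solution (mirror_field f) l y \<Longrightarrow> y \<le> r'"
    by (rule m.maximal_bounded_solution[OF m.bounded_solution_subsolution[OF mx order_refl] mN]) blast
  define r where "r = mirror r'"
  have r: "bounded_solution f l r" using m.bounded_solution_mirror[OF r'(1)] by (simp add: r_def)
  have r_min: "r \<le> y" if "bounded_solution f l y" for y
  proof (rule le_funI)
    fix t show "r t \<le> y t"
      using le_funD[OF r'(3)[OF bounded_solution_mirror[OF that]], of "- t"] by (simp add: r_def mirror_def)
  qed
  have set: "bdd_set f l = {(s, x0). r s \<le> x0 \<and> x0 \<le> a s}"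
  proof (intro set_eqI iffI)
    fix p assume "p \<in> bdd_set f l"
    then show "p \<in> {(s, x0). r s \<le> x0 \<and> x0 \<le> a s}"
      using r_min a(3) unfolding bdd_set_def le_fun_def by auto
  next
    fix p assume "p \<in> {(s, x0). r s \<le> x0 \<and> x0 \<le> a s}"
    then obtain s x0 where p: "p = (s, x0)" "r s \<le> x0" "x0 \<le> a s" by auto
    obtain N1 where N1: "N1 > 0" "\<And>t. \<bar>r t\<bar> \<le> N1" by (rule bounded_solution_boundE[OF r]) blast
    obtain N2 where N2: "N2 > 0" "\<And>t. \<bar>a t\<bar> \<le> N2" by (rule bounded_solution_boundE[OF a(1)]) blast
    define N where "N = max N1 N2"
    have N: "N > 0" "\<And>t. \<bar>r t\<bar> \<le> N" "\<And>t. \<bar>a t\<bar> \<le> N"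
      using N1 N2 by (auto simp: N_def le_max_iff_disj)
    let ?F = "\<lambda>t x. trunc N t x + l"
    obtain M L where "bounded_lipschitz_field ?F M L"
      using trunc_bounded_lipschitz_field[OF \<open>N > 0\<close>] .
    then interpret F: bounded_lipschitz_field ?F M L .
    obtain y where y: "integral_solution ?F y" "y s = x0" using F.picard .
    have ra: "integral_solution ?F r" "integral_solution ?F a"
      using bounded_solution_iff_trunc[where x = r, OF N(1,2)] bounded_solution_iff_trunc[where x = a, OF N(1,3)] r a(1) by blast+
    have ry: "r t \<le> y t" "y t \<le> a t" for t
      using F.solution_order[OF ra(1) y(1), of s t] F.solution_order[OF y(1) ra(2), of s t] p y(2) by auto
    have "\<bar>y t\<bar> \<le> N" for t using N(2)[of t] N(3)[of t] ry[of t] by linarith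
    then have "bounded_solution f l y" using bounded_solution_iff_trunc[OF N(1)] y(1) by blast
    then show "p \<in> bdd_set f l" using p y(2) unfolding bdd_set_def by auto
  qed
  have ep: "extremal_pair f l r a"
    unfolding extremal_pair_def using r a set r_min by blast
  \<comment> \<open>\<open>r \<le> a\<close> makes every time section of \<open>bdd_set f l\<close>
    a nonempty closed interval, and such an interval determines its endpoints.\<close>
  have uniq: "r' = r \<and> a' = a" if "extremal_pair f l r' a'" for r' a'
  proof -
    have e: "r' s \<le> x0 \<and> x0 \<le> a' s \<longleftrightarrow> r s \<le> x0 \<and> x0 \<le> a s" for s x0
    proof -
      have "(s, x0) \<in> {(s, x0). r' s \<le> x0 \<and> x0 \<le> a' s} \<longleftrightarrow> (s, x0) \<in> {(s, x0). r s \<le> x0 \<and> x0 \<le> a s}"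
        using that set unfolding extremal_pair_def by simp
      then show ?thesis by simp
    qed
    have le: "r' s \<le> a' s" "r s \<le> a s" for s
      using that ep unfolding extremal_pair_def le_fun_def by auto
    have "r' s = r s" "a' s = a s" for s
      using e[of s "r' s"] e[of s "r s"] e[of s "a' s"] e[of s "a s"] le[of s] by auto
    then show ?thesis by auto
  qed
  have u: "upper_sol f l = a"
    unfolding upper_sol_def
  proof (rule the_equality)
    show "\<exists>r. extremal_pair f l r a" using ep by blast
    show "a' = a" if "\<exists>r. extremal_pair f l r a'" for a' using that uniq by blast
  qed
  have lo: "lower_sol f l = r"
    unfolding lower_sol_def
  proof (rule the_equality)
    show "\<exists>a. extremal_pair f l r a" using ep by blast
    show "r' = r" if "\<exists>a. extremal_pair f l r' a" for r' using that uniq by blast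
  qed
  show "bounded_solution f l (upper_sol f l)" unfolding u by (rule a(1))
  show "bounded_solution f l (lower_sol f l)" unfolding lo by (rule r)
  show "lower_sol f l \<le> x \<and> x \<le> upper_sol f l" if "bounded_solution f l x" for x
    unfolding u lo using that a(3) r_min by blast
  show "bdd_set f l = {(s, x0). lower_sol f l s \<le> x0 \<and> x0 \<le> upper_sol f l s}"
    unfolding u lo by (rule set)
qed

end

section \<open>Dependence on the parameter\<close>

text \<open>Makes exponential bounds independent of the chosen antiderivative of the
  linearisation.\<close>

lemma AE_derivative_unique:
  assumes H: "loc_lipschitz H" "AE t in lebesgue. (H has_real_derivative h t) (at t)"
    and G: "loc_lipschitz G" "AE t in lebesgue. (G has_real_derivative h t) (at t)"
  shows "H t - H s = G t - G s"
proof -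
  have *: "(h has_integral (H t - H s)) {s..t}" "(h has_integral (G t - G s)) {s..t}" if "s \<le> t" for s t
    using that by (auto intro!: abs_continuous_has_integral loc_lipschitz_abs_continuous assms)
  show ?thesis
  proof (cases "s \<le> t")
    case True
    then show ?thesis using *[of s t] has_integral_unique by blast
  next
    case False
    then have "H s - H t = G s - G t" using *[of t s] has_integral_unique by (metis linear)
    then show ?thesis by linarith
  qed
qed

lemma primitive_has_derivative:
  assumes h: "continuous_on UNIV h"
  shows "(primitive h has_real_derivative h t) (at t)"
proof -
  have int: "h integrable_on {a..b}" for a b
    using h by (intro integrable_continuous_real) (auto intro: continuous_on_subset)
  \<comment> \<open>The integral is differentiated within \<open>{a..t + 1}\<close>; the base point
    \<open>t - 1\<close> makes \<open>t\<close> interior to it.\<close>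
  define a where "a = t - 1"
  have "((\<lambda>u. primitive h a + integral {a..u} h) has_real_derivative h t) (at t within {a..t + 1})"
    by (auto intro!: derivative_eq_intros integral_has_real_derivative continuous_on_subset[OF h] simp: a_def)
  moreover have "at t within {a..t + 1} = at t" by (rule at_within_interior) (simp add: a_def)
  ultimately have "((\<lambda>u. primitive h a + integral {a..u} h) has_real_derivative h t) (at t)" by simp
  then show ?thesis
  proof (rule has_field_derivative_transform_within_open[of _ _ _ "{a<..}"])
    fix u assume "u \<in> {a<..}"
    then have "(h has_integral (primitive h u - primitive h a)) {a..u}" by (intro has_integral_primitive int) auto
    then show "primitive h a + integral {a..u} h = primitive h u" by (simp add: integral_unique)
  qed (auto simp: a_def)
qed

context concave_field
begin

section \<open>Monotone dependence on the parameter\<close>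

lemma subsolution_imp_upper_sol:
  assumes "subsolution (\<lambda>t x. f t x + l) \<alpha>" "\<And>t. \<bar>\<alpha> t\<bar> \<le> A"
  shows "bdd_set f l \<noteq> {}" "\<alpha> t \<le> upper_sol f l t"
proof -
  obtain a where a: "bounded_solution f l a" "\<alpha> \<le> a" "\<And>x. bounded_solution f l x \<Longrightarrow> x \<le> a"
    by (rule maximal_bounded_solution[OF assms]) blast
  show ne: "bdd_set f l \<noteq> {}" using a(1) bdd_set_nonempty_iff by blast
  have "a \<le> upper_sol f l" using extremal_solutions(3)[OF ne a(1)] by blast
  then show "\<alpha> t \<le> upper_sol f l t" using a(2) by (meson le_funD order_trans)
qed

lemma constant_subsolution:
  assumes "AE t in lebesgue. 0 \<le> f t K + l"
  shows "bdd_set f l \<noteq> {}" "K \<le> upper_sol f l t"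
proof -
  have "AE t in lebesgue. \<exists>D. ((\<lambda>_. K) has_real_derivative D) (at t) \<and> D \<le> f t K + l"
    using assms by eventually_elim (auto intro!: exI[of _ 0])
  then have "subsolution (\<lambda>t x. f t x + l) (\<lambda>_. K)"
    unfolding subsolution_def using loc_lipschitz_const by blast
  from subsolution_imp_upper_sol[OF this, of "\<bar>K\<bar>"]
  show "bdd_set f l \<noteq> {}" "K \<le> upper_sol f l t" by auto
qed

lemma bdd_set_mono:
  assumes "bdd_set f l1 \<noteq> {}" "l1 \<le> l2"
  shows "bdd_set f l2 \<noteq> {}" "upper_sol f l1 t \<le> upper_sol f l2 t"
proof -
  have a: "bounded_solution f l1 (upper_sol f l1)" by (rule extremal_solutions(1)[OF assms(1)])
  obtain N where "N > 0" "\<And>t. \<bar>upper_sol f l1 t\<bar> \<le> N" by (rule bounded_solution_boundE[OF a]) blast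
  from subsolution_imp_upper_sol[OF bounded_solution_subsolution[OF a assms(2)] this(2)]
  show "bdd_set f l2 \<noteq> {}" "upper_sol f l1 t \<le> upper_sol f l2 t" .
qed

lemma mirror_nonempty: "bdd_set f l \<noteq> {} \<Longrightarrow> bdd_set (mirror_field f) l \<noteq> {}"
  using bounded_solution_mirror concave_field.bdd_set_nonempty_iff[OF mirror_concave_field]
    bdd_set_nonempty_iff by blast

text \<open>The reflection is an order-reversing bijection between the bounded solutions of the two
  fields; results on upper solutions transfer to lower ones through this identity.\<close>

lemma lower_sol_eq_mirror:
  assumes ne: "bdd_set f l \<noteq> {}"
  shows "lower_sol f l t = - upper_sol (mirror_field f) l (- t)"
proof -
  interpret m: concave_field "mirror_field f" "\<lambda>t x. - fx (- t) (- x)" "{t. - t \<in> T}"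
    by (rule mirror_concave_field)
  note em = m.extremal_solutions[OF mirror_nonempty[OF ne]] and e = extremal_solutions[OF ne]
  have "lower_sol f l \<le> mirror (upper_sol (mirror_field f) l)"
    using e(3) m.bounded_solution_mirror[OF em(1)] by simp
  moreover have "mirror (lower_sol f l) \<le> upper_sol (mirror_field f) l"
    using em(3) bounded_solution_mirror[OF e(2)] by blast
  ultimately show ?thesis
    unfolding le_fun_def mirror_def by (metis antisym minus_le_iff minus_minus)
qed

text \<open>The gap is uniform because uniform separation will be derived from it. With
  \<open>\<eta> = l2 - l1\<close> the difference \<open>w\<close> of the upper solutions satisfies
  \<open>w' \<ge> \<eta> - C * w\<close> a.e. on the whole line, and \<open>w \<ge> 0\<close> then
  forces \<open>w \<ge> \<eta> / C\<close>.\<close>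

lemma upper_sol_strict_mono:
  assumes ne: "bdd_set f l1 \<noteq> {}" and "l1 < l2"
  obtains c where "c > 0" "\<forall>t. upper_sol f l1 t + c \<le> upper_sol f l2 t"
proof -
  let ?a = "upper_sol f l1" and ?b = "upper_sol f l2"
  note ne2 = bdd_set_mono(1)[OF ne less_imp_le[OF \<open>l1 < l2\<close>]]
  note le = bdd_set_mono(2)[OF ne less_imp_le[OF \<open>l1 < l2\<close>]]
  have a: "bounded_solution f l1 ?a" and b: "bounded_solution f l2 ?b"
    using extremal_solutions ne ne2 by blast+
  obtain N1 where N1: "N1 > 0" "\<And>t. \<bar>?a t\<bar> \<le> N1" by (rule bounded_solution_boundE[OF a]) blast
  obtain N2 where N2: "N2 > 0" "\<And>t. \<bar>?b t\<bar> \<le> N2" by (rule bounded_solution_boundE[OF b]) blast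
  define N where "N = max N1 N2"
  have N: "\<bar>?a t\<bar> \<le> N" "\<bar>?b t\<bar> \<le> N" for t using N1(2)[of t] N2(2)[of t] by (auto simp: N_def)
  obtain C d where "bounds N C d" by (rule boundsE)
  note bd = boundsD(1,5)[OF this]
  define \<eta> where "\<eta> = l2 - l1"
  have "\<eta> > 0" using assms by (simp add: \<eta>_def)
  \<comment> \<open>How far the gap falls short of its equilibrium \<open>\<eta> / C\<close>: this
    deficit decays at rate \<open>C\<close> and is bounded above.\<close>
  define y where "y = (\<lambda>t. \<eta> / C - (?b t - ?a t))"
  have "y t \<le> 0" for t
  proof (rule nonpos_if_decaying[where y = y and c = C and B = "\<eta> / C"])
    show "loc_lipschitz y"
      unfolding y_def by (intro loc_lipschitz_diff loc_lipschitz_const bounded_solution_loc_lipschitz[OF a]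
          bounded_solution_loc_lipschitz[OF b])
    show "y t \<le> \<eta> / C" for t using le[of t] by (simp add: y_def)
    show "AE t in lebesgue. \<exists>D. (y has_real_derivative D) (at t) \<and> D \<le> - C * y t"
      using bounded_solution_AE_derivative[OF a] bounded_solution_AE_derivative[OF b] AE_T
    proof eventually_elim
      case (elim t)
      have "(y has_real_derivative 0 - ((f t (?b t) + l2) - (f t (?a t) + l1))) (at t)"
        unfolding y_def by (intro DERIV_diff DERIV_const elim(1,2))
      moreover have "f t (?a t) - f t (?b t) \<le> C * (?b t - ?a t)"
        using bd(2)[OF elim(3) N(1)[of t] N(2)[of t]] le[of t] by (simp add: abs_le_iff)
      then have "0 - ((f t (?b t) + l2) - (f t (?a t) + l1)) \<le> - C * y t"
      proof -
        have "C * y t = l2 - l1 - C * (?b t - ?a t)"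
          using bd(1) by (simp add: y_def \<eta>_def field_simps)
        then show ?thesis using \<open>f t (?a t) - f t (?b t) \<le> C * (?b t - ?a t)\<close> by simp
      qed
      ultimately show ?case by blast
    qed
  qed (rule bd(1))
  then show thesis
    using \<open>\<eta> > 0\<close> bd(1) by (intro that[of "\<eta> / C"]) (auto simp: y_def algebra_simps)
qed

lemma lower_sol_strict_mono:
  assumes ne: "bdd_set f l1 \<noteq> {}" and "l1 < l2"
  obtains c where "c > 0" "\<forall>t. lower_sol f l2 t + c \<le> lower_sol f l1 t"
proof -
  interpret m: concave_field "mirror_field f" "\<lambda>t x. - fx (- t) (- x)" "{t. - t \<in> T}"
    by (rule mirror_concave_field)
  note ne2 = bdd_set_mono(1)[OF ne less_imp_le[OF \<open>l1 < l2\<close>]]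
  obtain c where c: "c > 0" "\<forall>t. upper_sol (mirror_field f) l1 t + c \<le> upper_sol (mirror_field f) l2 t"
    using m.upper_sol_strict_mono[OF mirror_nonempty[OF ne] \<open>l1 < l2\<close>] .
  show thesis
  proof (rule that[OF c(1)], rule allI)
    fix t show "lower_sol f l2 t + c \<le> lower_sol f l1 t"
      using c(2)[rule_format, of "- t"] by (simp add: lower_sol_eq_mirror[OF ne] lower_sol_eq_mirror[OF ne2])
  qed
qed

text \<open>Once \<open>l\<close> reaches the bound of \<open>\<bar>f\<bar>\<close> on
  \<open>{- \<bar>K\<bar>..\<bar>K\<bar>}\<close>, the constant \<open>K\<close> is a
  subsolution.\<close>

lemma upper_sol_at_top:
  "\<exists>l0. \<forall>l\<ge>l0. bdd_set f l \<noteq> {} \<and> (\<forall>t. K \<le> upper_sol f l t)"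
proof -
  obtain C d where "bounds \<bar>K\<bar> C d" by (rule boundsE)
  note bd = boundsD(3)[OF this]
  have "bdd_set f l \<noteq> {} \<and> (\<forall>t. K \<le> upper_sol f l t)" if "C \<le> l" for l
  proof -
    have "AE t in lebesgue. 0 \<le> f t K + l"
      using AE_T
    proof eventually_elim
      case (elim t)
      then have "\<bar>f t K\<bar> \<le> C" using bd by simp
      then show ?case using that by linarith
    qed
    then show ?thesis using constant_subsolution by blast
  qed
  then show ?thesis by blast
qed

lemma lower_sol_at_bot:
  "\<exists>l0. \<forall>l\<ge>l0. \<forall>t. lower_sol f l t \<le> K"
proof -
  interpret m: concave_field "mirror_field f" "\<lambda>t x. - fx (- t) (- x)" "{t. - t \<in> T}"
    by (rule mirror_concave_field)
  obtain l1 where l1: "\<And>l. l1 \<le> l \<Longrightarrow> bdd_set f l \<noteq> {}" using upper_sol_at_top by blast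
  obtain l2 where l2: "\<And>l t. l2 \<le> l \<Longrightarrow> - K \<le> upper_sol (mirror_field f) l t"
    using m.upper_sol_at_top[of "- K"] by blast
  have "lower_sol f l t \<le> K" if "max l1 l2 \<le> l" for l t
    using l2[of l "- t"] lower_sol_eq_mirror[OF l1[of l], of t] that by simp
  then show ?thesis by blast
qed

text \<open>If \<open>m + l < 0\<close>, every solution has slope at most \<open>m + l\<close> a.e.
  and escapes to minus infinity.\<close>

lemma parameter_lower_bound:
  assumes m: "AE t in lebesgue. \<forall>p. f t p \<le> m" and ne: "bdd_set f l \<noteq> {}"
  shows "- m \<le> l"
proof (rule ccontr)
  assume "\<not> - m \<le> l"
  define e where "e = - (m + l)"
  have "e > 0" using \<open>\<not> - m \<le> l\<close> by (simp add: e_def)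
  obtain x where x: "bounded_solution f l x" using ne bdd_set_nonempty_iff by blast
  obtain N where N: "N > 0" "\<And>t. \<bar>x t\<bar> \<le> N" by (rule bounded_solution_boundE[OF x]) blast
  have dec: "x t + e * t \<le> x 0 + e * 0" if "0 \<le> t" for t
  proof (rule loc_lipschitz_decreasing[of "\<lambda>t. x t + e * t", OF _ _ that])
    show "loc_lipschitz (\<lambda>t. x t + e * t)"
      by (intro loc_lipschitz_add loc_lipschitz_cmult loc_lipschitz_ident bounded_solution_loc_lipschitz[OF x])
    show "AE t in lebesgue. \<exists>D. ((\<lambda>t. x t + e * t) has_real_derivative D) (at t) \<and> D \<le> 0"
      using bounded_solution_AE_derivative[OF x] m
    proof eventually_elim
      case (elim t)
      have "((\<lambda>t. x t + e * t) has_real_derivative (f t (x t) + l) + e) (at t)"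
        using elim(1) by (auto intro!: derivative_eq_intros)
      moreover have "(f t (x t) + l) + e \<le> 0" using elim(2) by (simp add: e_def)
      ultimately show ?case by blast
    qed
  qed
  \<comment> \<open>The solution varies by at most \<open>2 * N\<close>; at this time the
    accumulated descent \<open>e * t\<close> exceeds that by 1.\<close>
  define t where "t = (2 * N + 1) / e"
  have "0 \<le> t" "e * t = 2 * N + 1" using \<open>e > 0\<close> N(1) by (auto simp: t_def)
  then show False using dec[of t] N(2)[of t] N(2)[of 0] by (simp add: abs_le_iff)
qed

lemma bdd_set_closed:
  assumes ne: "\<And>l. c < l \<Longrightarrow> bdd_set f l \<noteq> {}"
  shows "bdd_set f c \<noteq> {}"
proof -
  define l where "l = (\<lambda>n. c + inverse (real (Suc n)))"
  have lc: "c < l n" "l n \<le> c + 1" for n by (auto simp: l_def inverse_le_1_iff)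
  have ldec: "l (Suc n) \<le> l n" for n by (simp add: l_def)
  have llim: "l \<longlonglongrightarrow> c" unfolding l_def using LIMSEQ_inverse_real_of_nat_add by simp
  note nel = ne[OF lc(1)]
  let ?a = "\<lambda>n. upper_sol f (l n)"
  have a: "bounded_solution f (l n) (?a n)" for n by (rule extremal_solutions(1)[OF nel])
  \<comment> \<open>The bound must not depend on \<open>n\<close>; all parameters \<open>l n\<close>
    are at most \<open>c + 1\<close>.\<close>
  obtain K where K: "K > 0" "\<And>t p l'. t \<in> T \<Longrightarrow> K \<le> \<bar>p\<bar> \<Longrightarrow> l' \<le> c + 1 \<Longrightarrow> f t p + l' \<le> - 1"
    by (rule coercive_shiftE[of "c + 1"]) blast
  have aK: "\<bar>?a n t\<bar> \<le> K" for n t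
    by (rule bounded_solution_bound[OF K(2) K(1) a]) (use lc in auto)
  obtain M L where "bounded_lipschitz_field (\<lambda>t x. trunc K t x + 0) M L"
    using trunc_bounded_lipschitz_field[OF \<open>K > 0\<close>] .
  then interpret F: bounded_lipschitz_field "trunc K" M L by simp
  have sol: "integral_solution (\<lambda>t x. trunc K t x + l n) (?a n)" for n
    using bounded_solution_iff_trunc[where x = "?a n", OF \<open>K > 0\<close> aK] a by blast
  have "decseq (\<lambda>n. ?a n t)" for t
    by (rule decseq_SucI) (rule bdd_set_mono(2)[OF nel ldec])
  then have "\<exists>z. (\<lambda>n. ?a n t) \<longlonglongrightarrow> z" for t
    using decseq_convergent[of "\<lambda>n. ?a n t" "- K"] aK[of _ t] by (metis abs_le_iff minus_le_iff)
  then obtain x where x: "\<And>t. (\<lambda>n. ?a n t) \<longlonglongrightarrow> x t" by metis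
  have "integral_solution (\<lambda>t x. trunc K t x + c) x"
    by (rule F.solution_limit[OF sol llim x])
  moreover have "\<bar>x t\<bar> \<le> K" for t
    by (rule tendsto_upperbound[OF tendsto_rabs[OF x[of t]]]) (use aK in auto)
  ultimately have "bounded_solution f c x"
    using bounded_solution_iff_trunc[where x = x, OF \<open>K > 0\<close>] by blast
  then show ?thesis using bdd_set_nonempty_iff by blast
qed

section \<open>Linearisation along bounded solutions\<close>

lemma partial_x_eq: "t \<in> T \<Longrightarrow> partial_x f t p = fx t p"
  unfolding partial_x_def by (rule DERIV_imp_deriv[OF f_derivative])

text \<open>Replaces the oriented Lebesgue integrals in the definition of hyperbolicity by
  increments of one locally Lipschitz function, to which \<open>gronwall_AE\<close> applies.\<close>

lemma linearization:
  assumes b: "bounded_solution f l b"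
  obtains H where "loc_lipschitz H" "AE t in lebesgue. (H has_real_derivative fx t (b t)) (at t)"
    "\<forall>s t. interval_lebesgue_integral lebesgue (ereal s) (ereal t) (\<lambda>u. partial_x f u (b u)) = H t - H s"
proof -
  obtain N where N: "N > 0" "\<And>t. \<bar>b t\<bar> \<le> N" by (rule bounded_solution_boundE[OF b]) blast
  have bc: "continuous_on UNIV b" by (rule loc_lipschitz_continuous[OF bounded_solution_loc_lipschitz[OF b]])
  obtain C d where "bounds N C d" by (rule boundsE)
  note bd = boundsD(1,4)[OF this]
  define h where "h = (\<lambda>u. partial_x f u (b u))"
  \<comment> \<open>Off \<open>T\<close> nothing is known about \<open>partial_x f\<close>; the
    default 0 gives a bounded function that equals \<open>h\<close> a.e.\<close>
  define h' where "h' = (\<lambda>u. if u \<in> T then fx u (b u) else 0)"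
  have hb: "\<bar>h' u\<bar> \<le> C" for u using bd N(2) by (simp add: h'_def)
  \<comment> \<open>On \<open>T\<close> the derivative along \<open>b\<close> is the limit of
    difference quotients of \<open>f\<close>, which are measurable in time because \<open>b\<close>
    is continuous.\<close>
  have "h' \<in> borel_measurable lebesgue"
  proof (rule borel_measurable_LIMSEQ_real)
    fix n :: nat
    have "(\<lambda>u. (f u (b u + inverse (real (Suc n))) - f u (b u)) / inverse (real (Suc n))) \<in> borel_measurable borel"
      by (intro borel_measurable_divide borel_measurable_diff f_compose_measurable continuous_intros bc) auto
    then have "(\<lambda>u. (f u (b u + inverse (real (Suc n))) - f u (b u)) / inverse (real (Suc n))) \<in> borel_measurable lebesgue"
      by (intro measurable_completion) simp
    then show "(\<lambda>u. if u \<in> T then (f u (b u + inverse (real (Suc n))) - f u (b u)) / inverse (real (Suc n)) else 0)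
        \<in> borel_measurable lebesgue"
      using T_measurable by (intro measurable_If) auto
  next
    fix u
    show "(\<lambda>n. if u \<in> T then (f u (b u + inverse (real (Suc n))) - f u (b u)) / inverse (real (Suc n)) else 0)
        \<longlonglongrightarrow> h' u"
    proof (cases "u \<in> T")
      case True
      have "((\<lambda>k. (f u (b u + k) - f u (b u)) / k) \<longlongrightarrow> fx u (b u)) (at 0)"
        using f_derivative[OF True, of "b u"] by (simp add: DERIV_def)
      moreover have "filterlim (\<lambda>n. inverse (real (Suc n))) (at 0) sequentially"
        unfolding filterlim_at using LIMSEQ_inverse_real_of_nat by auto
      ultimately have "(\<lambda>n. (f u (b u + inverse (real (Suc n))) - f u (b u)) / inverse (real (Suc n))) \<longlonglongrightarrow> fx u (b u)"
        by (rule filterlim_compose)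
      then show ?thesis using True by (simp add: h'_def)
    qed (simp add: h'_def)
  qed
  then have ai: "h' absolutely_integrable_on {s..t}" for s t
    by (intro measurable_bounded_by_integrable_imp_absolutely_integrable[of _ _ "\<lambda>_. C"] measurable_restrict_space1)
      (use hb in auto)
  then have int: "h' integrable_on {s..t}" for s t
    using set_lebesgue_integral_eq_integral(1) by blast
  define H where "H = primitive h'"
  note Hi = has_integral_primitive[OF int, folded H_def]
  have "\<bar>H t - H s\<bar> \<le> C * \<bar>t - s\<bar>" for s t
    by (rule primitive_lipschitz[OF Hi]) (use hb bd(1) in auto)
  then have "loc_lipschitz H" by (rule loc_lipschitzI)
  moreover have "AE t in lebesgue. (H has_real_derivative fx t (b t)) (at t)"
  proof -
    have "AE t in lebesgue. (H has_real_derivative h' t) (at t)"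
      by (rule indefinite_integral_AE_derivative) (rule Hi)
    then show ?thesis using AE_T by eventually_elim (simp add: h'_def)
  qed
  moreover have "\<forall>s t. interval_lebesgue_integral lebesgue (ereal s) (ereal t) h = H t - H s"
  proof -
    obtain Z where Z: "negligible Z" "{t. \<not> t \<in> T} \<subseteq> Z"
      using AE_T unfolding eventually_ae_filter_negligible by blast
    have hh: "h u = h' u" if "u \<in> S - Z" for u S
      using that Z(2) by (auto simp: h_def h'_def partial_x_eq)
    have *: "set_lebesgue_integral lebesgue {s<..<t} h = H t - H s" if "s \<le> t" for s t
    proof -
      have "h absolutely_integrable_on {s..t}" by (rule absolutely_integrable_spike[OF ai Z(1) hh])
      then have "h absolutely_integrable_on {s<..<t}" by (simp add: absolutely_integrable_on_Icc_iff_Ioo)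
      then have "set_lebesgue_integral lebesgue {s<..<t} h = integral {s<..<t} h"
        by (rule set_lebesgue_integral_eq_integral(2))
      also have "\<dots> = integral {s..t} h" by (simp add: integral_open_interval_real)
      also have "\<dots> = H t - H s"
        by (rule integral_unique[OF has_integral_spike[OF Z(1) hh Hi[OF that]]])
      finally show ?thesis .
    qed
    show ?thesis
    proof (intro allI)
      fix s t
      show "interval_lebesgue_integral lebesgue (ereal s) (ereal t) h = H t - H s"
        using *[of s t] *[of t s] by (auto simp: interval_lebesgue_integral_def)
    qed
  qed
  ultimately show thesis unfolding h_def by (rule that)
qed

text \<open>The first alternative of hyperbolicity, with the integral replaced by an antiderivative
  of the linearisation.\<close>

definition attractive :: "real \<Rightarrow> (real \<Rightarrow> real) \<Rightarrow> bool" where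
  "attractive l b \<longleftrightarrow> bounded_solution f l b \<and>
    (\<exists>H k \<beta>. loc_lipschitz H \<and> (AE t in lebesgue. (H has_real_derivative fx t (b t)) (at t)) \<and>
       1 \<le> k \<and> 0 < \<beta> \<and> (\<forall>s t. s \<le> t \<longrightarrow> exp (H t - H s) \<le> k * exp (- \<beta> * (t - s))))"

lemma attractiveE:
  assumes "attractive l b"
  obtains H k \<beta> where "loc_lipschitz H" "AE t in lebesgue. (H has_real_derivative fx t (b t)) (at t)"
    "1 \<le> k" "0 < \<beta>" "\<forall>s t. s \<le> t \<longrightarrow> exp (H t - H s) \<le> k * exp (- \<beta> * (t - s))"
  using assms unfolding attractive_def by (elim conjE exE) (rule that)

text \<open>Along an attractive solution \<open>b\<close> the linearised equation \<open>v' = f\<^sub>x(t, b) v + 1\<close> has a bounded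
  solution \<open>v \<ge> 0\<close>; then \<open>b - \<epsilon> v\<close> is a subsolution for a smaller parameter.\<close>

lemma attractive_imp_smaller_parameter:
  assumes "attractive l b"
  shows "\<exists>l'<l. bdd_set f l' \<noteq> {}"
proof -
  have b: "bounded_solution f l b" using assms by (simp add: attractive_def)
  obtain H k \<beta> where H: "loc_lipschitz H" "AE t in lebesgue. (H has_real_derivative fx t (b t)) (at t)"
    "1 \<le> k" "0 < \<beta>" "\<forall>s t. s \<le> t \<longrightarrow> exp (H t - H s) \<le> k * exp (- \<beta> * (t - s))"
    using attractiveE[OF assms] .
  \<comment> \<open>Variation of constants: \<open>v t\<close> will be the integral of
    \<open>exp (H t - H u)\<close> over \<open>u\<close> from minus infinity to \<open>t\<close>, so
    \<open>exp (- H)\<close> is integrated first.\<close>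
  define g where "g = (\<lambda>t. exp (- 1 * H t))"
  have gl: "loc_lipschitz g"
    unfolding g_def by (intro loc_lipschitz_compose[OF loc_lipschitz_exp] loc_lipschitz_cmult H(1))
  have gc: "continuous_on UNIV g" by (rule loc_lipschitz_continuous[OF gl])
  define P where "P = primitive g"
  have P': "(P has_real_derivative g t) (at t)" for t
    unfolding P_def by (rule primitive_has_derivative[OF gc])
  have gpos: "g t > 0" for t by (simp add: g_def)
  have Pmono: "P s \<le> P t" if "s \<le> t" for s t
    using that by (rule DERIV_nonneg_imp_nondecreasing) (use P' gpos less_imp_le in blast)
  \<comment> \<open>The decay of \<open>exp (H t - H u)\<close> in \<open>t - u\<close>, multiplied
    by \<open>g t\<close> and integrated over \<open>u\<close>, bounds the increment uniformly in
    \<open>s\<close>.\<close>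
  have Pbd: "P t - P s \<le> k / \<beta> * g t" if "s \<le> t" for s t
  proof -
    have "(g has_integral (P t - P s)) {s..t}"
      using that P' by (intro fundamental_theorem_of_calculus)
        (auto simp flip: has_real_derivative_iff_has_vector_derivative intro: has_field_derivative_at_within)
    moreover have "((\<lambda>u. k * g t * exp (- \<beta> * (t - u))) has_integral
        (k / \<beta> * g t * exp (- \<beta> * (t - t)) - k / \<beta> * g t * exp (- \<beta> * (t - s)))) {s..t}"
      using that H(4) by (intro fundamental_theorem_of_calculus)
        (auto intro!: derivative_eq_intros simp flip: has_real_derivative_iff_has_vector_derivative)
    ultimately have "P t - P s \<le> k / \<beta> * g t * exp (- \<beta> * (t - t)) - k / \<beta> * g t * exp (- \<beta> * (t - s))"
    proof (rule has_integral_le)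
      fix u assume "u \<in> {s..t}"
      then have "exp (H t - H u) \<le> k * exp (- \<beta> * (t - u))" using H(5) by simp
      then have "exp (H t - H u) * g t \<le> k * exp (- \<beta> * (t - u)) * g t"
        using gpos[of t] by (intro mult_right_mono) auto
      moreover have "exp (H t - H u) * g t = g u" by (simp add: g_def flip: exp_add)
      ultimately show "g u \<le> k * g t * exp (- \<beta> * (t - u))" by (simp add: mult.commute mult.left_commute)
    qed
    moreover have "0 \<le> k / \<beta> * g t * exp (- \<beta> * (t - s))" using H(3,4) gpos[of t] by simp
    ultimately show ?thesis by simp
  qed
  \<comment> \<open>\<open>P\<close> is increasing, so its infimum is the limit at minus infinity
    and \<open>P t - P0\<close> is the improper integral of \<open>g\<close> up to
    \<open>t\<close>.\<close>
  define P0 where "P0 = Inf (range P)"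
  have Plow: "P 0 - k / \<beta> * g 0 \<le> P s" for s
  proof (cases "s \<le> 0")
    case True
    then show ?thesis using Pbd[of s 0] by simp
  next
    case False
    have "0 \<le> k / \<beta> * g 0" using H(3,4) gpos[of 0] by simp
    then show ?thesis using Pmono[of 0 s] False by simp
  qed
  have bb: "bdd_below (range P)" using Plow by (intro bdd_belowI2)
  have G0: "0 \<le> P t - P0" for t unfolding P0_def using cINF_lower[OF bb, of t] by simp
  have G1: "P t - P0 \<le> k / \<beta> * g t" for t
  proof -
    have "P t - k / \<beta> * g t \<le> P s" for s
    proof (cases "s \<le> t")
      case True
      then show ?thesis using Pbd[of s t] by simp
    next
      case False
      have "0 \<le> k / \<beta> * g t" using H(3,4) gpos[of t] by simp
      then show ?thesis using Pmono[of t s] False by simp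
    qed
    then have "P t - k / \<beta> * g t \<le> P0" unfolding P0_def by (intro cINF_greatest) auto
    then show ?thesis by simp
  qed
  define v where "v = (\<lambda>t. exp (H t) * (P t - P0))"
  define V where "V = k / \<beta>"
  have "V > 0" using H(3,4) by (simp add: V_def)
  have v0: "0 \<le> v t" for t using G0 by (simp add: v_def)
  have vV: "v t \<le> V" for t
  proof -
    have "v t \<le> exp (H t) * (k / \<beta> * g t)" unfolding v_def using G1 by (intro mult_left_mono) auto
    also have "\<dots> = V" by (simp add: V_def g_def exp_minus)
    finally show ?thesis .
  qed
  have Pl: "loc_lipschitz P" by (rule loc_lipschitz_C1[OF P' gc])
  have vl: "loc_lipschitz v"
    unfolding v_def by (intro loc_lipschitz_mult loc_lipschitz_compose[OF loc_lipschitz_exp] H(1)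
        loc_lipschitz_diff Pl loc_lipschitz_const)
  have v': "AE t in lebesgue. (v has_real_derivative fx t (b t) * v t + 1) (at t)"
    using H(2)
  proof eventually_elim
    case (elim t)
    have "(v has_real_derivative exp (H t) * fx t (b t) * (P t - P0) + exp (H t) * g t) (at t)"
      unfolding v_def using elim P'[of t] by (auto intro!: derivative_eq_intros simp: algebra_simps)
    moreover have "exp (H t) * fx t (b t) * (P t - P0) + exp (H t) * g t = fx t (b t) * v t + 1"
      by (simp add: v_def g_def exp_minus)
    ultimately show ?case by simp
  qed
  obtain N where N: "N > 0" "\<And>t. \<bar>b t\<bar> \<le> N" by (rule bounded_solution_boundE[OF b]) blast
  obtain C d where "bounds (N + 1) C d" by (rule boundsE)
  note bd = boundsD(1,7)[OF this]
  \<comment> \<open>The first bound keeps \<open>\<alpha>\<close> within distance 1 of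
    \<open>b\<close>, where \<open>C\<close> is valid. The second makes the quadratic error
    \<open>C * (\<eta> * v t)\<^sup>2\<close> at most half of the gain \<open>\<eta>\<close> from
    the inhomogeneity, so the parameter can drop by \<open>\<eta> / 2\<close>.\<close>
  define \<eta> where "\<eta> = min (1 / V) (1 / (2 * C * V\<^sup>2))"
  have \<eta>: "\<eta> > 0" "\<eta> * V \<le> 1" "\<eta> * (C * V\<^sup>2) \<le> 1 / 2"
  proof -
    show "\<eta> > 0" using \<open>V > 0\<close> bd(1) by (simp add: \<eta>_def)
    have "\<eta> * V \<le> 1 / V * V" using \<open>V > 0\<close> by (intro mult_right_mono) (auto simp: \<eta>_def)
    then show "\<eta> * V \<le> 1" using \<open>V > 0\<close> by simp
    have "\<eta> * (C * V\<^sup>2) \<le> 1 / (2 * C * V\<^sup>2) * (C * V\<^sup>2)"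
      using \<open>V > 0\<close> bd(1) by (intro mult_right_mono) (auto simp: \<eta>_def)
    then show "\<eta> * (C * V\<^sup>2) \<le> 1 / 2" using \<open>V > 0\<close> bd(1) by simp
  qed
  define \<alpha> where "\<alpha> = (\<lambda>t. b t - \<eta> * v t)"
  have \<eta>v: "0 \<le> \<eta> * v t" "\<eta> * v t \<le> 1" for t
  proof -
    show "0 \<le> \<eta> * v t" using \<eta>(1) v0[of t] by simp
    have "\<eta> * v t \<le> \<eta> * V" using \<eta>(1) by (intro mult_left_mono vV) simp
    then show "\<eta> * v t \<le> 1" using \<eta>(2) by linarith
  qed
  have \<alpha>N: "\<bar>\<alpha> t\<bar> \<le> N + 1" for t
    using N(2)[of t] \<eta>v[of t] by (simp add: \<alpha>_def abs_le_iff)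
  have "subsolution (\<lambda>t x. f t x + (l - \<eta> / 2)) \<alpha>"
    unfolding subsolution_def
  proof
    show "loc_lipschitz \<alpha>"
      unfolding \<alpha>_def by (intro loc_lipschitz_diff loc_lipschitz_cmult vl bounded_solution_loc_lipschitz[OF b])
    show "AE t in lebesgue. \<exists>D. (\<alpha> has_real_derivative D) (at t) \<and> D \<le> f t (\<alpha> t) + (l - \<eta> / 2)"
      using v' bounded_solution_AE_derivative[OF b] AE_T
    proof eventually_elim
      case (elim t)
      have "(\<alpha> has_real_derivative (f t (b t) + l) - \<eta> * (fx t (b t) * v t + 1)) (at t)"
        unfolding \<alpha>_def by (intro DERIV_diff DERIV_cmult elim(1,2))
      moreover have "(f t (b t) + l) - \<eta> * (fx t (b t) * v t + 1) \<le> f t (\<alpha> t) + (l - \<eta> / 2)"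
      proof -
        have "f t (b t) + fx t (b t) * (\<alpha> t - b t) - C * (\<alpha> t - b t)\<^sup>2 \<le> f t (\<alpha> t)"
          using N(2)[of t] by (intro bd(2) elim(3) \<alpha>N) simp
        moreover have "\<alpha> t - b t = - (\<eta> * v t)" by (simp add: \<alpha>_def)
        moreover have "C * (\<eta> * v t)\<^sup>2 \<le> \<eta> / 2"
        proof -
          have "(v t)\<^sup>2 \<le> V\<^sup>2" using v0[of t] vV[of t] by (intro power_mono)
          then have "\<eta> * \<eta> * (C * (v t)\<^sup>2) \<le> \<eta> * \<eta> * (C * V\<^sup>2)"
            using bd(1) \<eta>(1) by (intro mult_left_mono) auto
          also have "\<dots> \<le> \<eta> * (1 / 2)"
            using \<eta>(1) mult_left_mono[OF \<eta>(3), of \<eta>] by (simp add: mult.assoc)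
          finally show ?thesis by (simp add: power2_eq_square algebra_simps)
        qed
        ultimately show ?thesis by (simp add: algebra_simps)
      qed
      ultimately show ?case by blast
    qed
  qed
  then have "bdd_set f (l - \<eta> / 2) \<noteq> {}" using \<alpha>N by (rule subsolution_imp_upper_sol(1))
  then show ?thesis using \<eta>(1) by (intro exI[of _ "l - \<eta> / 2"]) simp
qed

text \<open>By concavity the gap between \<open>b\<close> and the upper solution grows no faster
  than the linearised equation along \<open>b\<close>. The gap is bounded and contracts from
  arbitrarily remote times, so it is 0.\<close>

lemma attractive_eq_upper_sol:
  assumes att: "attractive l b"
  shows "b = upper_sol f l"
proof -
  let ?a = "upper_sol f l"
  have b: "bounded_solution f l b" using att by (simp add: attractive_def)
  have ne: "bdd_set f l \<noteq> {}" using b bdd_set_nonempty_iff by blast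
  have a: "bounded_solution f l ?a" by (rule extremal_solutions(1)[OF ne])
  have le: "b t \<le> ?a t" for t using extremal_solutions(3)[OF ne b] by (simp add: le_fun_def)
  obtain N1 where N1: "N1 > 0" "\<And>t. \<bar>?a t\<bar> \<le> N1" by (rule bounded_solution_boundE[OF a]) blast
  obtain N2 where N2: "N2 > 0" "\<And>t. \<bar>b t\<bar> \<le> N2" by (rule bounded_solution_boundE[OF b]) blast
  define N where "N = max N1 N2"
  have N: "\<bar>?a t\<bar> \<le> N" "\<bar>b t\<bar> \<le> N" for t using N1(2)[of t] N2(2)[of t] by (auto simp: N_def)
  obtain C d where "bounds N C d" by (rule boundsE)
  note bd = boundsD(2,6)[OF this]
  obtain H k \<beta> where H: "loc_lipschitz H" "AE t in lebesgue. (H has_real_derivative fx t (b t)) (at t)"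
    "1 \<le> k" "0 < \<beta>" "\<forall>s t. s \<le> t \<longrightarrow> exp (H t - H s) \<le> k * exp (- \<beta> * (t - s))"
    using attractiveE[OF att] .
  have ld: "loc_lipschitz (\<lambda>t. ?a t - b t)"
    by (intro loc_lipschitz_diff bounded_solution_loc_lipschitz[OF a] bounded_solution_loc_lipschitz[OF b])
  have der: "AE t in lebesgue. \<exists>D D'. ((\<lambda>t. ?a t - b t) has_real_derivative D) (at t) \<and>
        (H has_real_derivative D') (at t) \<and> D \<le> D' * (?a t - b t)"
    using bounded_solution_AE_derivative[OF a] bounded_solution_AE_derivative[OF b] H(2) AE_T
  proof eventually_elim
    case (elim t)
    have "((\<lambda>t. ?a t - b t) has_real_derivative (f t (?a t) + l) - (f t (b t) + l)) (at t)"
      by (intro DERIV_diff elim(1,2))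
    moreover have "f t (?a t) \<le> f t (b t) + fx t (b t) * (?a t - b t) - d * (?a t - b t)\<^sup>2"
      by (rule bd(2)[OF elim(4) N(2) N(1)])
    moreover have "0 \<le> d * (?a t - b t)\<^sup>2" using bd(1) by simp
    ultimately have "((\<lambda>t. ?a t - b t) has_real_derivative (f t (?a t) + l) - (f t (b t) + l)) (at t)"
      "(f t (?a t) + l) - (f t (b t) + l) \<le> fx t (b t) * (?a t - b t)" by simp_all
    then show ?case using elim(3) by blast
  qed
  have "?a t - b t \<le> 0" for t
  proof -
    have est: "?a t - b t \<le> 2 * N * (k * exp (- \<beta> * r))" if "r \<ge> 0" for r
    proof -
      have "?a t - b t \<le> (?a (t - r) - b (t - r)) * exp (H t - H (t - r))"
        by (rule gronwall_AE[OF ld H(1) der]) (use that in simp)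
      also have "\<dots> \<le> 2 * N * (k * exp (- \<beta> * r))"
      proof (rule mult_mono)
        show "?a (t - r) - b (t - r) \<le> 2 * N" using N[of "t - r"] by (simp add: abs_le_iff)
        show "exp (H t - H (t - r)) \<le> k * exp (- \<beta> * r)" using H(5)[rule_format, of "t - r" t] that by simp
        show "0 \<le> 2 * N" using N(1)[of 0] by (simp add: abs_le_iff)
      qed simp
      finally show ?thesis .
    qed
    have "((\<lambda>r. 2 * N * (k * exp (- \<beta> * r))) \<longlongrightarrow> 0) at_top" using H(4) by real_asymp
    then show "?a t - b t \<le> 0"
      by (rule tendsto_lowerbound) (use est in \<open>auto intro: eventually_at_top_linorderI[of 0]\<close>)
  qed
  then show ?thesis using le by (intro ext antisym) simp_all
qed

text \<open>With \<open>w = a - r \<ge> \<epsilon>\<close>, strict concavity gives \<open>w' \<ge> (f\<^sub>x(t, a) + d \<epsilon>) w\<close>, and \<open>w\<close> is bounded.\<close>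

lemma upper_sol_attractive:
  assumes ne: "bdd_set f l \<noteq> {}" and "\<epsilon> > 0"
    and sep: "\<And>t. \<epsilon> \<le> upper_sol f l t - lower_sol f l t"
  shows "attractive l (upper_sol f l)"
proof -
  let ?a = "upper_sol f l" and ?r = "lower_sol f l"
  have a: "bounded_solution f l ?a" and r: "bounded_solution f l ?r"
    by (rule extremal_solutions[OF ne])+
  obtain N1 where N1: "N1 > 0" "\<And>t. \<bar>?a t\<bar> \<le> N1" by (rule bounded_solution_boundE[OF a]) blast
  obtain N2 where N2: "N2 > 0" "\<And>t. \<bar>?r t\<bar> \<le> N2" by (rule bounded_solution_boundE[OF r]) blast
  define N where "N = max N1 N2"
  have N: "\<bar>?a t\<bar> \<le> N" "\<bar>?r t\<bar> \<le> N" for t using N1(2)[of t] N2(2)[of t] by (auto simp: N_def)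
  obtain C d where "bounds N C d" by (rule boundsE)
  note bd = boundsD(2,6)[OF this]
  obtain H where H: "loc_lipschitz H" "AE t in lebesgue. (H has_real_derivative fx t (?a t)) (at t)"
    by (rule linearization[OF a])
  define \<beta> where "\<beta> = d * \<epsilon>"
  have "\<beta> > 0" using bd(1) \<open>\<epsilon> > 0\<close> by (simp add: \<beta>_def)
  \<comment> \<open>\<open>?y\<close> is \<open>- w\<close>, hence negative, so Gronwall's
    inequality with the coefficient raised by \<open>\<beta>\<close> bounds \<open>w\<close> from
    below.\<close>
  let ?y = "\<lambda>t. ?r t - ?a t" and ?G = "\<lambda>t. H t + \<beta> * t"
  have ly: "loc_lipschitz ?y"
    by (intro loc_lipschitz_diff bounded_solution_loc_lipschitz[OF a] bounded_solution_loc_lipschitz[OF r])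
  have lG: "loc_lipschitz ?G" by (intro loc_lipschitz_add H(1) loc_lipschitz_cmult loc_lipschitz_ident)
  have der: "AE t in lebesgue. \<exists>D D'. (?y has_real_derivative D) (at t) \<and>
        (?G has_real_derivative D') (at t) \<and> D \<le> D' * ?y t"
    using bounded_solution_AE_derivative[OF a] bounded_solution_AE_derivative[OF r] H(2) AE_T
  proof eventually_elim
    case (elim t)
    have "(?y has_real_derivative (f t (?r t) + l) - (f t (?a t) + l)) (at t)"
      by (intro DERIV_diff elim(1,2))
    moreover have "(?G has_real_derivative fx t (?a t) + \<beta>) (at t)"
      using elim(3) by (auto intro!: derivative_eq_intros)
    moreover have "f t (?r t) \<le> f t (?a t) + fx t (?a t) * ?y t - d * (?y t)\<^sup>2"
      by (rule bd(2)[OF elim(4) N(1) N(2)])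
    moreover have "d * (?y t)\<^sup>2 \<ge> - (\<beta> * ?y t)"
    proof -
      have "d * (- ?y t) * \<epsilon> \<le> d * (- ?y t) * (- ?y t)"
        using sep[of t] \<open>\<epsilon> > 0\<close> bd(1) by (intro mult_left_mono mult_nonneg_nonneg) auto
      then show ?thesis by (simp add: \<beta>_def power2_eq_square algebra_simps)
    qed
    ultimately have "(?y has_real_derivative (f t (?r t) + l) - (f t (?a t) + l)) (at t)"
      "(?G has_real_derivative fx t (?a t) + \<beta>) (at t)"
      "(f t (?r t) + l) - (f t (?a t) + l) \<le> (fx t (?a t) + \<beta>) * ?y t" by (simp_all add: algebra_simps)
    then show ?case by blast
  qed
  \<comment> \<open>As \<open>w\<close> lies between \<open>\<epsilon>\<close> and
    \<open>2 * N\<close>, the exponential with raised coefficient is at most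
    \<open>2 * N / \<epsilon>\<close>; taking \<open>\<beta>\<close> out again leaves decay. The
    maximum with 1 meets the requirement \<open>1 \<le> k\<close>.\<close>
  have "exp (H t - H s) \<le> max 1 (2 * N / \<epsilon>) * exp (- \<beta> * (t - s))" if "s \<le> t" for s t
  proof -
    have "?y t \<le> ?y s * exp (?G t - ?G s)" by (rule gronwall_AE[OF ly lG der that])
    then have "(?a s - ?r s) * exp (?G t - ?G s) \<le> ?a t - ?r t" by (simp add: algebra_simps)
    moreover have "\<epsilon> * exp (?G t - ?G s) \<le> (?a s - ?r s) * exp (?G t - ?G s)"
      using sep[of s] by (intro mult_right_mono) auto
    moreover have "?a t - ?r t \<le> 2 * N" using N[of t] by (simp add: abs_le_iff)
    ultimately have "\<epsilon> * exp (?G t - ?G s) \<le> 2 * N" by linarith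
    then have "exp (?G t - ?G s) \<le> 2 * N / \<epsilon>" using \<open>\<epsilon> > 0\<close> by (simp add: field_simps)
    then have "exp (?G t - ?G s) \<le> max 1 (2 * N / \<epsilon>)" by simp
    then have *: "exp (?G t - ?G s) * exp (- \<beta> * (t - s)) \<le> max 1 (2 * N / \<epsilon>) * exp (- \<beta> * (t - s))"
      by (intro mult_right_mono) auto
    have eq: "exp (?G t - ?G s) * exp (- \<beta> * (t - s)) = exp (H t - H s)"
      by (simp add: algebra_simps flip: exp_add)
    show ?thesis using * unfolding eq .
  qed
  then show ?thesis
    unfolding attractive_def using a H \<open>\<beta> > 0\<close> by (intro conjI exI[of _ H] exI[of _ "max 1 (2 * N / \<epsilon>)"] exI[of _ \<beta>]) auto
qed

end

section \<open>The bifurcation value\<close>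

context concave_field
begin

text \<open>The second alternative of hyperbolicity, decay backwards in time, read through the
  reflection.\<close>

abbreviation repulsive :: "real \<Rightarrow> (real \<Rightarrow> real) \<Rightarrow> bool" where
  "repulsive l b \<equiv> concave_field.attractive (mirror_field f) (\<lambda>t x. - fx (- t) (- x)) l (mirror b)"

lemma hyperbolic_cases:
  assumes "hyperbolic_solution f l b"
  shows "attractive l b \<or> repulsive l b"
proof -
  interpret m: concave_field "mirror_field f" "\<lambda>t x. - fx (- t) (- x)" "{t. - t \<in> T}"
    by (rule mirror_concave_field)
  have b: "bounded_solution f l b" using assms by (simp add: hyperbolic_solution_def)
  obtain H where H: "loc_lipschitz H" "AE t in lebesgue. (H has_real_derivative fx t (b t)) (at t)"
    and int: "\<forall>s t. interval_lebesgue_integral lebesgue (ereal s) (ereal t) (\<lambda>u. partial_x f u (b u)) = H t - H s"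
    by (rule linearization[OF b])
  obtain k \<beta> where k: "1 \<le> k" "0 < \<beta>" and
    or: "(\<forall>s t. s \<le> t \<longrightarrow> exp (H t - H s) \<le> k * exp (- \<beta> * (t - s))) \<or>
      (\<forall>s t. t \<le> s \<longrightarrow> exp (H t - H s) \<le> k * exp (\<beta> * (t - s)))"
    using assms unfolding hyperbolic_solution_def int[rule_format] by blast
  from or show ?thesis
  proof
    assume "\<forall>s t. s \<le> t \<longrightarrow> exp (H t - H s) \<le> k * exp (- \<beta> * (t - s))"
    then have "attractive l b"
      unfolding attractive_def using b H k by blast
    then show ?thesis ..
  next
    assume dec: "\<forall>s t. t \<le> s \<longrightarrow> exp (H t - H s) \<le> k * exp (\<beta> * (t - s))"
    have "loc_lipschitz (\<lambda>t. H (- 1 * t))"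
      by (rule loc_lipschitz_compose[OF H(1) loc_lipschitz_cmult[OF loc_lipschitz_ident]])
    then have "loc_lipschitz (\<lambda>t. H (- t))" by simp
    \<comment> \<open>Reversing time supplies the minus sign of the mirrored derivative, so
      \<open>H (- t)\<close> is an antiderivative of the mirrored linearisation.\<close>
    moreover have "AE t in lebesgue. ((\<lambda>t. H (- t)) has_real_derivative - fx (- t) (- mirror b t)) (at t)"
      using AE_lebesgue_uminus[OF H(2)]
    proof eventually_elim
      case (elim t)
      have "((\<lambda>t. H (- t)) has_real_derivative fx (- t) (b (- t)) * - 1) (at t)"
        by (rule DERIV_chain2[where f = H and g = uminus, OF elim]) (auto intro!: derivative_eq_intros)
      then show ?case by (simp add: mirror_def)
    qed
    moreover have "\<forall>s t. s \<le> t \<longrightarrow> exp (H (- t) - H (- s)) \<le> k * exp (- \<beta> * (t - s))"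
    proof (intro allI impI)
      fix s t :: real assume "s \<le> t"
      then show "exp (H (- t) - H (- s)) \<le> k * exp (- \<beta> * (t - s))"
        using dec[rule_format, of "- t" "- s"] by (simp add: algebra_simps)
    qed
    ultimately have "m.attractive l (mirror b)"
      unfolding m.attractive_def using bounded_solution_mirror[OF b] k by blast
    then show ?thesis ..
  qed
qed

lemma attractive_hyperbolic:
  assumes att: "attractive l b"
  shows "hyperbolic_solution f l b"
proof -
  have b: "bounded_solution f l b" using att by (simp add: attractive_def)
  obtain H k \<beta> where H: "loc_lipschitz H" "AE t in lebesgue. (H has_real_derivative fx t (b t)) (at t)"
    "1 \<le> k" "0 < \<beta>" "\<forall>s t. s \<le> t \<longrightarrow> exp (H t - H s) \<le> k * exp (- \<beta> * (t - s))"
    using attractiveE[OF att] .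
  obtain G where G: "loc_lipschitz G" "AE t in lebesgue. (G has_real_derivative fx t (b t)) (at t)"
    and int: "\<forall>s t. interval_lebesgue_integral lebesgue (ereal s) (ereal t) (\<lambda>u. partial_x f u (b u)) = G t - G s"
    by (rule linearization[OF b])
  have "G t - G s = H t - H s" for s t by (rule AE_derivative_unique[OF G H(1,2)])
  then show ?thesis
    unfolding hyperbolic_solution_def int[rule_format] using b H(3-5) by auto
qed

lemma repulsive_hyperbolic:
  assumes rep: "repulsive l b"
  shows "hyperbolic_solution f l b"
proof -
  interpret m: concave_field "mirror_field f" "\<lambda>t x. - fx (- t) (- x)" "{t. - t \<in> T}"
    by (rule mirror_concave_field)
  have "bounded_solution (mirror_field f) l (mirror b)" using rep by (simp add: m.attractive_def)
  then have b: "bounded_solution f l b" using m.bounded_solution_mirror by fastforce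
  obtain H k \<beta> where H: "loc_lipschitz H"
    "AE t in lebesgue. (H has_real_derivative - fx (- t) (- mirror b t)) (at t)"
    "1 \<le> k" "0 < \<beta>" "\<forall>s t. s \<le> t \<longrightarrow> exp (H t - H s) \<le> k * exp (- \<beta> * (t - s))"
    using m.attractiveE[OF rep] .
  obtain G where G: "loc_lipschitz G" "AE t in lebesgue. (G has_real_derivative fx t (b t)) (at t)"
    and int: "\<forall>s t. interval_lebesgue_integral lebesgue (ereal s) (ereal t) (\<lambda>u. partial_x f u (b u)) = G t - G s"
    by (rule linearization[OF b])
  have "loc_lipschitz (\<lambda>t. H (- 1 * t))"
    by (rule loc_lipschitz_compose[OF H(1) loc_lipschitz_cmult[OF loc_lipschitz_ident]])
  then have Hl: "loc_lipschitz (\<lambda>t. H (- t))" by simp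
  have Hd: "AE t in lebesgue. ((\<lambda>t. H (- t)) has_real_derivative fx t (b t)) (at t)"
    using AE_lebesgue_uminus[OF H(2)]
  proof eventually_elim
    case (elim t)
    have "((\<lambda>t. H (- t)) has_real_derivative - fx (- (- t)) (- mirror b (- t)) * - 1) (at t)"
      by (rule DERIV_chain2[where f = H and g = uminus, OF elim]) (auto intro!: derivative_eq_intros)
    then show ?case by (simp add: mirror_def)
  qed
  have eq: "G t - G s = H (- t) - H (- s)" for s t by (rule AE_derivative_unique[OF G Hl Hd])
  have "\<forall>s t. t \<le> s \<longrightarrow> exp (G t - G s) \<le> k * exp (\<beta> * (t - s))"
  proof (intro allI impI)
    fix s t :: real assume "t \<le> s"
    then show "exp (G t - G s) \<le> k * exp (\<beta> * (t - s))"
      using H(5)[rule_format, of "- s" "- t"] by (simp add: eq algebra_simps)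
  qed
  then show ?thesis
    unfolding hyperbolic_solution_def int[rule_format] using b H(3,4) by auto
qed

lemma lower_sol_repulsive:
  assumes ne: "bdd_set f l \<noteq> {}" and "\<epsilon> > 0"
    and sep: "\<And>t. \<epsilon> \<le> upper_sol f l t - lower_sol f l t"
  shows "repulsive l (lower_sol f l)"
proof -
  interpret m: concave_field "mirror_field f" "\<lambda>t x. - fx (- t) (- x)" "{t. - t \<in> T}"
    by (rule mirror_concave_field)
  have ul: "upper_sol (mirror_field f) l = mirror (lower_sol f l)"
    by (simp add: fun_eq_iff mirror_def lower_sol_eq_mirror[OF ne])
  moreover have "\<epsilon> \<le> upper_sol (mirror_field f) l t - lower_sol (mirror_field f) l t" for t
    using sep[of "- t"] m.lower_sol_eq_mirror[OF mirror_nonempty[OF ne], of t] by (simp add: ul mirror_def)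
  ultimately show ?thesis
    using m.upper_sol_attractive[OF mirror_nonempty[OF ne] \<open>\<epsilon> > 0\<close>] by simp
qed

lemma repulsive_eq_lower_sol:
  assumes "repulsive l b"
  shows "b = lower_sol f l"
proof -
  interpret m: concave_field "mirror_field f" "\<lambda>t x. - fx (- t) (- x)" "{t. - t \<in> T}"
    by (rule mirror_concave_field)
  have "bounded_solution f l b"
    using repulsive_hyperbolic[OF assms] by (simp add: hyperbolic_solution_def)
  then have ne: "bdd_set f l \<noteq> {}" using bdd_set_nonempty_iff by blast
  have "mirror b = upper_sol (mirror_field f) l" by (rule m.attractive_eq_upper_sol[OF assms])
  then have "mirror (mirror b) = mirror (upper_sol (mirror_field f) l)" by simp
  then show ?thesis by (simp add: fun_eq_iff mirror_def lower_sol_eq_mirror[OF ne])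
qed

lemma hyperbolic_imp_smaller_parameter:
  assumes "hyperbolic_solution f l b"
  shows "\<exists>l'<l. bdd_set f l' \<noteq> {}"
proof -
  interpret m: concave_field "mirror_field f" "\<lambda>t x. - fx (- t) (- x)" "{t. - t \<in> T}"
    by (rule mirror_concave_field)
  from hyperbolic_cases[OF assms] show ?thesis
  proof
    assume "repulsive l b"
    then obtain l' where "l' < l" "bdd_set (mirror_field f) l' \<noteq> {}"
      using m.attractive_imp_smaller_parameter by blast
    then show ?thesis using m.mirror_nonempty[of l'] by auto
  qed (rule attractive_imp_smaller_parameter)
qed

lemma lower_le_upper: "bdd_set f l \<noteq> {} \<Longrightarrow> lower_sol f l t \<le> upper_sol f l t"
  using extremal_solutions(1,3)[of l] by (auto simp: le_fun_def)

text \<open>The value is the infimum of the parameters with bounded solutions. It is attained, and a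
  hyperbolic solution there would yield a smaller parameter; a positive infimum of the gap would
  make the upper solution hyperbolic, so that infimum is 0.\<close>

lemma ex_bifurcation_value:
  "\<exists>c. bifurcation_value f c"
proof -
  define S where "S = {l. bdd_set f l \<noteq> {}}"
  define c where "c = Inf S"
  obtain l0 where l0: "\<forall>l\<ge>l0. bdd_set f l \<noteq> {}" using upper_sol_at_top[of 0] by blast
  have "S \<noteq> {}" using l0 by (auto simp: S_def)
  obtain K where K: "K > 0" "\<forall>t\<in>T. \<forall>p. K \<le> \<bar>p\<bar> \<longrightarrow> f t p \<le> 0"
    using coercive[of 0] by blast
  obtain C d where "bounds K C d" by (rule boundsE)
  note C = boundsD(1,3)[OF this]
  \<comment> \<open>Outside \<open>{- K..K}\<close> the field is nonpositive, inside it is at most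
    \<open>C\<close>; a global upper bound of the field bounds the parameters in \<open>S\<close>
    from below.\<close>
  have "AE t in lebesgue. \<forall>p. f t p \<le> C"
    using AE_T
  proof eventually_elim
    case (elim t)
    show ?case
    proof
      fix p show "f t p \<le> C"
        using K(2) C(1) C(2)[OF elim, of p] elim by (cases "K \<le> \<bar>p\<bar>") force+
    qed
  qed
  then have bb: "bdd_below S"
    unfolding S_def by (intro bdd_belowI[of _ "- C"]) (auto intro: parameter_lower_bound)
  have gt: "bdd_set f l \<noteq> {}" if lc: "c < l" for l
  proof -
    obtain l' where "l' \<in> S" "l' < l" using lc cInf_less_iff[OF \<open>S \<noteq> {}\<close> bb] unfolding c_def by blast
    then show ?thesis using bdd_set_mono(1)[of l' l] by (simp add: S_def)
  qed
  have ne: "bdd_set f l \<noteq> {} \<longleftrightarrow> c \<le> l" for l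
  proof
    show "bdd_set f l \<noteq> {} \<Longrightarrow> c \<le> l" unfolding c_def using bb by (intro cInf_lower) (simp add: S_def)
    show "c \<le> l \<Longrightarrow> bdd_set f l \<noteq> {}" using bdd_set_closed[OF gt] gt by (cases "c = l") auto
  qed
  have ii: "bdd_set f l1 \<subset> bdd_set f l2 \<and>
         (\<forall>t. lower_sol f l2 t < lower_sol f l1 t \<and>
              lower_sol f l1 t \<le> upper_sol f l1 t \<and>
              upper_sol f l1 t < upper_sol f l2 t)" if cl: "c \<le> l1" and ll: "l1 < l2" for l1 l2
  proof -
    have n1: "bdd_set f l1 \<noteq> {}" and n2: "bdd_set f l2 \<noteq> {}" using ne cl ll by simp_all
    obtain c1 where c1: "c1 > 0" "\<forall>t. upper_sol f l1 t + c1 \<le> upper_sol f l2 t"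
      by (rule upper_sol_strict_mono[OF n1 ll])
    obtain c2 where c2: "c2 > 0" "\<forall>t. lower_sol f l2 t + c2 \<le> lower_sol f l1 t"
      by (rule lower_sol_strict_mono[OF n1 ll])
    have lt: "lower_sol f l2 t < lower_sol f l1 t" "upper_sol f l1 t < upper_sol f l2 t" for t
      using c1(1) c1(2)[rule_format, of t] c2(1) c2(2)[rule_format, of t] by linarith+
    have "(s, p) \<in> bdd_set f l2" if "(s, p) \<in> bdd_set f l1" for s p
      using that lt[of s] unfolding extremal_solutions(4)[OF n1] extremal_solutions(4)[OF n2] by simp
    then have "bdd_set f l1 \<subseteq> bdd_set f l2" by auto
    moreover have "(0, upper_sol f l2 0) \<in> bdd_set f l2" "(0, upper_sol f l2 0) \<notin> bdd_set f l1"
      unfolding extremal_solutions(4)[OF n1] extremal_solutions(4)[OF n2]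
      using lt[of 0] lower_le_upper[OF n2, of 0] by simp_all
    ultimately have "bdd_set f l1 \<subset> bdd_set f l2" by blast
    then show ?thesis using lt lower_le_upper[OF n1] by blast
  qed
  have nohyp: "\<not> (\<exists>b. hyperbolic_solution f c b)"
  proof
    assume "\<exists>b. hyperbolic_solution f c b"
    then obtain l' where "l' < c" "bdd_set f l' \<noteq> {}" using hyperbolic_imp_smaller_parameter by blast
    then show False using ne by auto
  qed
  have nec: "bdd_set f c \<noteq> {}" using ne by simp
  have inf0: "(INF t. upper_sol f c t - lower_sol f c t) = 0"
  proof (rule antisym)
    have below: "bdd_below (range (\<lambda>t. upper_sol f c t - lower_sol f c t))"
      using lower_le_upper[OF nec] by (intro bdd_belowI2[of _ 0]) simp
    show "0 \<le> (INF t. upper_sol f c t - lower_sol f c t)"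
      using lower_le_upper[OF nec] by (intro cINF_greatest) simp_all
    show "(INF t. upper_sol f c t - lower_sol f c t) \<le> 0"
    proof (rule ccontr)
      assume "\<not> (INF t. upper_sol f c t - lower_sol f c t) \<le> 0"
      then have "(INF t. upper_sol f c t - lower_sol f c t) > 0" by simp
      moreover have "(INF t. upper_sol f c t - lower_sol f c t) \<le> upper_sol f c t - lower_sol f c t" for t
        by (rule cINF_lower[OF below]) simp
      ultimately have "attractive c (upper_sol f c)" by (rule upper_sol_attractive[OF nec])
      then show False using attractive_hyperbolic nohyp by blast
    qed
  qed
  have iv: "uniformly_separated (lower_sol f l) (upper_sol f l) \<and>
        {b. hyperbolic_solution f l b} = {upper_sol f l, lower_sol f l}" if lc: "c < l" for l
  proof -
    have nel: "bdd_set f l \<noteq> {}" using ne lc by simp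
    obtain e where e: "e > 0" "\<forall>t. upper_sol f c t + e \<le> upper_sol f l t"
      by (rule upper_sol_strict_mono[OF nec lc])
    \<comment> \<open>The gap at \<open>c\<close> comes arbitrarily close to 0, so the separation is
      gained from the uniform distance \<open>e\<close> between the upper solutions for
      \<open>c\<close> and \<open>l\<close>.\<close>
    have sep: "e \<le> upper_sol f l t - lower_sol f l t" for t
    proof -
      have "lower_sol f l t < lower_sol f c t" using ii[OF order_refl lc] by blast
      then show ?thesis using e(2)[rule_format, of t] lower_le_upper[OF nec, of t] by linarith
    qed
    have "e \<le> (INF t. upper_sol f l t - lower_sol f l t)"
      using sep by (intro cINF_greatest) simp_all
    then have "uniformly_separated (lower_sol f l) (upper_sol f l)"
      using e(1) unfolding uniformly_separated_def by linarith
    moreover have "hyperbolic_solution f l b \<longleftrightarrow> b = upper_sol f l \<or> b = lower_sol f l" for b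
      using hyperbolic_cases attractive_eq_upper_sol repulsive_eq_lower_sol
        attractive_hyperbolic[OF upper_sol_attractive[OF nel e(1) sep]]
        repulsive_hyperbolic[OF lower_sol_repulsive[OF nel e(1) sep]] by blast
    ultimately show ?thesis by auto
  qed
  have top: "\<forall>\<^sub>F l in at_top. \<forall>t. K \<le> upper_sol f l t" for K
    using upper_sol_at_top[of K] unfolding eventually_at_top_linorder by blast
  have bot: "\<forall>\<^sub>F l in at_top. \<forall>t. lower_sol f l t \<le> K" for K
    using lower_sol_at_bot[of K] unfolding eventually_at_top_linorder by blast
  have "bifurcation_value f c"
    unfolding bifurcation_value_def
  proof (intro conjI inf0 nohyp)
    show "\<forall>l. bdd_set f l = {} \<longleftrightarrow> l < c"
    proof
      fix l show "bdd_set f l = {} \<longleftrightarrow> l < c" using ne[of l] by auto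
    qed
    show "\<forall>l1 l2. c \<le> l1 \<and> l1 < l2 \<longrightarrow> bdd_set f l1 \<subset> bdd_set f l2 \<and>
         (\<forall>t. lower_sol f l2 t < lower_sol f l1 t \<and>
              lower_sol f l1 t \<le> upper_sol f l1 t \<and>
              upper_sol f l1 t < upper_sol f l2 t)"
      by (intro allI impI, elim conjE) (rule ii)
    show "\<forall>K. \<forall>\<^sub>F l in at_top. \<forall>t. K \<le> upper_sol f l t" using top by (rule allI)
    show "\<forall>K. \<forall>\<^sub>F l in at_top. \<forall>t. lower_sol f l t \<le> K" using bot by (rule allI)
    show "\<forall>l>c. uniformly_separated (lower_sol f l) (upper_sol f l) \<and>
        {b. hyperbolic_solution f l b} = {upper_sol f l, lower_sol f l}"
      by (intro allI impI) (rule iv)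
  qed
  then show ?thesis ..
qed

end

section \<open>Uniqueness and translation of the bifurcation value\<close>

lemma bifurcation_value_unique:
  assumes "bifurcation_value f c" "bifurcation_value f c'"
  shows "c = c'"
proof -
  have "l < c \<longleftrightarrow> l < c'" for l using assms unfolding bifurcation_value_def by metis
  then show ?thesis by (metis linorder_neqE less_irrefl)
qed

lemma lambda_star_eq: "bifurcation_value f c \<Longrightarrow> lambda_star f = c"
  unfolding lambda_star_def using bifurcation_value_unique by blast

text \<open>All notions involved see only the sum of field and parameter, apart from
  \<open>partial_x f\<close>, which ignores additive constants. So the shifted field at
  \<open>l\<close> behaves as \<open>f\<close> at \<open>l + k\<close>.\<close>

lemma bifurcation_value_shift:
  assumes "bifurcation_value f c"
  shows "bifurcation_value (\<lambda>t x. f t x + k) (c - k)"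
proof -
  let ?g = "\<lambda>t x. f t x + k"
  have bs: "bounded_solution ?g l = bounded_solution f (l + k)" for l
    unfolding bounded_solution_def global_solution_def by (simp add: fun_eq_iff add.assoc add.commute[of k])
  have bd: "bdd_set ?g l = bdd_set f (l + k)" for l unfolding bdd_set_def bs ..
  have ep: "extremal_pair ?g l = extremal_pair f (l + k)" for l
    unfolding extremal_pair_def fun_eq_iff bs bd by simp
  have us: "upper_sol ?g l = upper_sol f (l + k)" and ls: "lower_sol ?g l = lower_sol f (l + k)" for l
    unfolding upper_sol_def lower_sol_def ep by simp_all
  have "partial_x ?g = partial_x f"
  proof (intro ext)
    fix t x
    \<comment> \<open>Where no derivative exists, \<open>deriv\<close> still chooses by the same
      predicate for both fields, so the equality holds at every point.\<close>
    have "(?g t has_field_derivative D) (at x) \<longleftrightarrow> (f t has_field_derivative D) (at x)" for D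
      using DERIV_add[of "?g t" D x UNIV "\<lambda>_. - k" 0] DERIV_add[of "f t" D x UNIV "\<lambda>_. k" 0] by auto
    then show "partial_x ?g t x = partial_x f t x" unfolding partial_x_def deriv_def by simp
  qed
  then have hs: "hyperbolic_solution ?g l = hyperbolic_solution f (l + k)" for l
    unfolding hyperbolic_solution_def fun_eq_iff bs by simp
  have ev: "\<forall>\<^sub>F l in at_top. P (l + k)" if evP: "\<forall>\<^sub>F l in at_top. P l" for P :: "real \<Rightarrow> bool"
  proof -
    obtain l0 where "\<forall>l\<ge>l0. P l" using evP unfolding eventually_at_top_linorder by blast
    then have "\<forall>l\<ge>l0 - k. P (l + k)" by simp
    then show ?thesis unfolding eventually_at_top_linorder by blast
  qed
  note B = assms[unfolded bifurcation_value_def]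
  have 1: "\<forall>l. bdd_set f l = {} \<longleftrightarrow> l < c"
    and 2: "\<forall>l1 l2. c \<le> l1 \<and> l1 < l2 \<longrightarrow>
         bdd_set f l1 \<subset> bdd_set f l2 \<and>
         (\<forall>t. lower_sol f l2 t < lower_sol f l1 t \<and>
              lower_sol f l1 t \<le> upper_sol f l1 t \<and>
              upper_sol f l1 t < upper_sol f l2 t)"
    and 3: "\<And>K. \<forall>\<^sub>F l in at_top. \<forall>t. K \<le> upper_sol f l t"
    and 4: "\<And>K. \<forall>\<^sub>F l in at_top. \<forall>t. lower_sol f l t \<le> K"
    and 5: "(INF t. upper_sol f c t - lower_sol f c t) = 0" "\<not> (\<exists>b. hyperbolic_solution f c b)"
    and 6: "\<forall>l>c. uniformly_separated (lower_sol f l) (upper_sol f l) \<and>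
        {b. hyperbolic_solution f l b} = {upper_sol f l, lower_sol f l}"
    using B by blast+
  have sh: "c - k \<le> l \<longleftrightarrow> c \<le> l + k" "c - k < l \<longleftrightarrow> c < l + k" "l < c - k \<longleftrightarrow> l + k < c" for l
    by linarith+
  have shifted: "\<forall>l1 l2. c \<le> l1 + k \<and> l1 < l2 \<longrightarrow>
         bdd_set f (l1 + k) \<subset> bdd_set f (l2 + k) \<and>
         (\<forall>t. lower_sol f (l2 + k) t < lower_sol f (l1 + k) t \<and>
              lower_sol f (l1 + k) t \<le> upper_sol f (l1 + k) t \<and>
              upper_sol f (l1 + k) t < upper_sol f (l2 + k) t)"
  proof (intro allI impI)
    fix l1 l2 assume "c \<le> l1 + k \<and> l1 < l2"
    then have "c \<le> l1 + k \<and> l1 + k < l2 + k" by simp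
    then show "bdd_set f (l1 + k) \<subset> bdd_set f (l2 + k) \<and>
         (\<forall>t. lower_sol f (l2 + k) t < lower_sol f (l1 + k) t \<and>
              lower_sol f (l1 + k) t \<le> upper_sol f (l1 + k) t \<and>
              upper_sol f (l1 + k) t < upper_sol f (l2 + k) t)"
      by (rule 2[rule_format])
  qed
  have ck: "c - k + k = c" by simp
  show ?thesis
    unfolding bifurcation_value_def bd us ls hs sh ck
  proof (intro conjI shifted 5)
    show "\<forall>l. bdd_set f (l + k) = {} \<longleftrightarrow> l + k < c" using 1 by blast
    show "\<forall>K. \<forall>\<^sub>F l in at_top. \<forall>t. K \<le> upper_sol f (l + k) t" using ev[OF 3] by (rule allI)
    show "\<forall>K. \<forall>\<^sub>F l in at_top. \<forall>t. lower_sol f (l + k) t \<le> K" using ev[OF 4] by (rule allI)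
    show "\<forall>l. c < l + k \<longrightarrow> uniformly_separated (lower_sol f (l + k)) (upper_sol f (l + k)) \<and>
        {b. hyperbolic_solution f (l + k) b} = {upper_sol f (l + k), lower_sol f (l + k)}" using 6 by blast
  qed
qed

section \<open>The hypotheses on the field\<close>

lemma DERIV_abs_le:
  fixes g :: "real \<Rightarrow> real"
  assumes D: "(g has_real_derivative D) (at p)" and "e > 0"
    and le: "\<And>q. \<bar>q - p\<bar> < e \<Longrightarrow> \<bar>g q - g p\<bar> \<le> C * \<bar>q - p\<bar>"
  shows "\<bar>D\<bar> \<le> C"
proof (rule tendsto_upperbound)
  show "((\<lambda>h. \<bar>(g (p + h) - g p) / h\<bar>) \<longlongrightarrow> \<bar>D\<bar>) (at 0)"
    using D by (intro tendsto_rabs) (simp add: DERIV_def)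
  show "\<forall>\<^sub>F h in at 0. \<bar>(g (p + h) - g p) / h\<bar> \<le> C"
    unfolding eventually_at
  proof (intro exI[of _ e] conjI ballI impI)
    fix h :: real assume "h \<noteq> 0 \<and> dist h 0 < e"
    then show "\<bar>(g (p + h) - g p) / h\<bar> \<le> C"
      using le[of "p + h"] by (simp add: divide_le_eq)
  qed (rule \<open>e > 0\<close>)
qed simp

text \<open>Up to a constant, \<open>\<phi>\<close> is \<open>g\<close> minus the claimed parabola;
  on \<open>{- N..N}\<close> it increases before \<open>p\<close> and decreases after it. With
  negative \<open>\<delta>\<close>, applied to \<open>- f\<close>, this also gives lower
  parabolas.\<close>

lemma concave_upper_parabola:
  fixes g g' :: "real \<Rightarrow> real"
  assumes der: "\<And>z. (g has_real_derivative g' z) (at z)"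
    and dec: "\<And>x y. - N \<le> x \<Longrightarrow> x < y \<Longrightarrow> y \<le> N \<Longrightarrow> g' y - g' x \<le> - \<delta> * (y - x)"
    and pq: "\<bar>p\<bar> \<le> N" "\<bar>q\<bar> \<le> N"
  shows "g q \<le> g p + g' p * (q - p) - \<delta> / 2 * (q - p)\<^sup>2"
proof -
  define \<phi> where "\<phi> = (\<lambda>y. g y - g' p * y + \<delta> / 2 * (y - p)\<^sup>2)"
  have \<phi>': "(\<phi> has_real_derivative g' y - g' p + \<delta> * (y - p)) (at y)" for y
    unfolding \<phi>_def by (auto intro!: derivative_eq_intros der)
  have "\<phi> q \<le> \<phi> p"
  proof (cases "p \<le> q")
    case True
    then show ?thesis
    proof (rule DERIV_nonpos_imp_nonincreasing)
      fix y assume "p \<le> y" "y \<le> q"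
      then have "g' y - g' p + \<delta> * (y - p) \<le> 0"
        using dec[of p y] pq by (cases "p = y") (auto simp: abs_le_iff)
      then show "\<exists>z. (\<phi> has_real_derivative z) (at y) \<and> z \<le> 0" using \<phi>' by blast
    qed
  next
    case False
    then have "q \<le> p" by simp
    then show ?thesis
    proof (rule DERIV_nonneg_imp_nondecreasing)
      fix y assume "q \<le> y" "y \<le> p"
      then have "0 \<le> g' y - g' p + \<delta> * (y - p)"
        using dec[of y p] pq by (cases "y = p") (auto simp: abs_le_iff algebra_simps)
      then show "\<exists>z. (\<phi> has_real_derivative z) (at y) \<and> 0 \<le> z" using \<phi>' by blast
    qed
  qed
  then show ?thesis by (simp add: \<phi>_def algebra_simps)
qed

text \<open>The conditions are indexed by integers \<open>j\<close>, so their exceptional sets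
  together still form a null set. \<open>T \<subseteq> R\<close> is returned because the assumption
  on \<open>\<rho>\<close> in the theorem speaks about \<open>R\<close>.\<close>

lemma concave_field_intro:
  assumes meas: "(\<lambda>(t, x). f t x) \<in> borel_measurable borel"
    and f2: "loc_bounded_ae f"
    and f3: "loc_lipschitz_ae f"
    and f4: "C1_ae f"
    and f5: "loc_lipschitz_ae (partial_x f)"
    and f6: "coercive_on R f"
    and f7: "strictly_concave_ae f"
  obtains T where "T \<subseteq> R" "concave_field f (partial_x f) T"
proof -
  obtain m where m: "\<And>j. AE t in lebesgue. (SUP x\<in>{- real j..real j}. ereal \<bar>f t x\<bar>) \<le> ereal (m j)"
    using f2 unfolding loc_bounded_ae_def by metis
  obtain L where L: "\<And>j. AE t in lebesgue. (SUP p\<in>distinct_pairs j. ereal \<bar>diff_quot (f t) p\<bar>) \<le> ereal (L j)"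
    using f3 unfolding loc_lipschitz_ae_def by metis
  obtain L' where L': "\<And>j. AE t in lebesgue. (SUP p\<in>distinct_pairs j. ereal \<bar>diff_quot (partial_x f t) p\<bar>) \<le> ereal (L' j)"
    using f5 unfolding loc_lipschitz_ae_def by metis
  obtain D where D: "\<And>j. D j > 0"
    "\<And>j. AE t in lebesgue. (SUP p\<in>distinct_pairs j. ereal (diff_quot (partial_x f t) p)) < ereal (- D j)"
    using f7 unfolding strictly_concave_ae_def by metis
  define T where "T = {t \<in> R. f t C1_differentiable_on UNIV \<and> (\<forall>j.
      (SUP x\<in>{- real j..real j}. ereal \<bar>f t x\<bar>) \<le> ereal (m j) \<and>
      (SUP p\<in>distinct_pairs j. ereal \<bar>diff_quot (f t) p\<bar>) \<le> ereal (L j) \<and>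
      (SUP p\<in>distinct_pairs j. ereal \<bar>diff_quot (partial_x f t) p\<bar>) \<le> ereal (L' j) \<and>
      (SUP p\<in>distinct_pairs j. ereal (diff_quot (partial_x f t) p)) < ereal (- D j))}"
  have "- R \<in> null_sets lebesgue" using f6 by (simp add: coercive_on_def)
  then have AER: "AE t in lebesgue. t \<in> R" using AE_not_in by fastforce
  have "AE t in lebesgue. \<forall>j.
      (SUP x\<in>{- real j..real j}. ereal \<bar>f t x\<bar>) \<le> ereal (m j) \<and>
      (SUP p\<in>distinct_pairs j. ereal \<bar>diff_quot (f t) p\<bar>) \<le> ereal (L j) \<and>
      (SUP p\<in>distinct_pairs j. ereal \<bar>diff_quot (partial_x f t) p\<bar>) \<le> ereal (L' j) \<and>
      (SUP p\<in>distinct_pairs j. ereal (diff_quot (partial_x f t) p)) < ereal (- D j)"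
    unfolding AE_all_countable
  proof
    fix j show "AE t in lebesgue.
      (SUP x\<in>{- real j..real j}. ereal \<bar>f t x\<bar>) \<le> ereal (m j) \<and>
      (SUP p\<in>distinct_pairs j. ereal \<bar>diff_quot (f t) p\<bar>) \<le> ereal (L j) \<and>
      (SUP p\<in>distinct_pairs j. ereal \<bar>diff_quot (partial_x f t) p\<bar>) \<le> ereal (L' j) \<and>
      (SUP p\<in>distinct_pairs j. ereal (diff_quot (partial_x f t) p)) < ereal (- D j)"
      using m[of j] L[of j] L'[of j] D(2)[of j] by eventually_elim (intro conjI)
  qed
  then have AET: "AE t in lebesgue. t \<in> T"
    using AER f4[unfolded C1_ae_def] unfolding T_def by eventually_elim blast
  have fb: "\<bar>f t x\<bar> \<le> m j" if t: "t \<in> T" and x: "\<bar>x\<bar> \<le> real j" for t x j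
  proof -
    have "ereal \<bar>f t x\<bar> \<le> (SUP x\<in>{- real j..real j}. ereal \<bar>f t x\<bar>)"
      using x by (intro SUP_upper) (auto simp: abs_le_iff)
    also have "\<dots> \<le> ereal (m j)" using t by (simp add: T_def)
    finally show ?thesis by simp
  qed
  have dp: "(x, y) \<in> distinct_pairs j" if "\<bar>x\<bar> \<le> real j" "\<bar>y\<bar> \<le> real j" "x \<noteq> y" for x y j
    using that by (auto simp: distinct_pairs_def abs_le_iff)
  have fl: "\<bar>f t y - f t x\<bar> \<le> L j * \<bar>y - x\<bar>"
    if t: "t \<in> T" and x: "\<bar>x\<bar> \<le> real j" and y: "\<bar>y\<bar> \<le> real j" for t x y j
  proof (cases "x = y")
    case False
    have "ereal \<bar>diff_quot (f t) (x, y)\<bar> \<le> (SUP p\<in>distinct_pairs j. ereal \<bar>diff_quot (f t) p\<bar>)"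
      by (intro SUP_upper dp x y False)
    also have "\<dots> \<le> ereal (L j)" using t by (simp add: T_def)
    finally show ?thesis using False by (simp add: diff_quot_def divide_le_eq)
  qed simp
  have gl: "\<bar>partial_x f t y - partial_x f t x\<bar> \<le> L' j * \<bar>y - x\<bar>"
    if t: "t \<in> T" and x: "\<bar>x\<bar> \<le> real j" and y: "\<bar>y\<bar> \<le> real j" for t x y j
  proof (cases "x = y")
    case False
    have "ereal \<bar>diff_quot (partial_x f t) (x, y)\<bar> \<le> (SUP p\<in>distinct_pairs j. ereal \<bar>diff_quot (partial_x f t) p\<bar>)"
      by (intro SUP_upper dp x y False)
    also have "\<dots> \<le> ereal (L' j)" using t by (simp add: T_def)
    finally show ?thesis using False by (simp add: diff_quot_def divide_le_eq)
  qed simp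
  have gd: "partial_x f t y - partial_x f t x \<le> - D j * (y - x)"
    if t: "t \<in> T" and x: "\<bar>x\<bar> \<le> real j" and y: "\<bar>y\<bar> \<le> real j" and "x < y" for t x y j
  proof -
    have "ereal (diff_quot (partial_x f t) (x, y)) \<le> (SUP p\<in>distinct_pairs j. ereal (diff_quot (partial_x f t) p))"
      using \<open>x < y\<close> by (intro SUP_upper dp x y) simp
    also have "\<dots> < ereal (- D j)" using t by (simp add: T_def)
    finally have "(partial_x f t y - partial_x f t x) / (y - x) < - D j" by (simp add: diff_quot_def)
    then show ?thesis using \<open>x < y\<close> by (simp add: divide_less_eq)
  qed
  have der: "(f t has_real_derivative partial_x f t p) (at p)" if t: "t \<in> T" for t p
  proof -
    obtain D where "\<forall>x\<in>UNIV. (f t has_vector_derivative D x) (at x)"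
      using t unfolding T_def C1_differentiable_on_def by blast
    then have "(f t has_real_derivative D p) (at p)" by (simp add: has_real_derivative_iff_has_vector_derivative)
    then show ?thesis unfolding partial_x_def using DERIV_imp_deriv by metis
  qed
  obtain d where "d > 0"
    and top: "Limsup at_top (\<lambda>x. SUP t\<in>R. ereal (f t x / x\<^sup>2)) < ereal (- d)"
    and bot: "Limsup at_bot (\<lambda>x. SUP t\<in>R. ereal (f t x / x\<^sup>2)) < ereal (- d)"
    using f6 unfolding coercive_on_def by blast
  obtain K1 where K1: "\<forall>x\<ge>K1. (SUP t\<in>R. ereal (f t x / x\<^sup>2)) < ereal (- d)"
    using Limsup_lessD[OF top] unfolding eventually_at_top_linorder by blast
  obtain K2 where K2: "\<forall>x\<le>K2. (SUP t\<in>R. ereal (f t x / x\<^sup>2)) < ereal (- d)"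
    using Limsup_lessD[OF bot] unfolding eventually_at_bot_linorder by blast
  have quad: "f t x \<le> - d * x\<^sup>2" if "t \<in> T" "max 1 (max K1 (- K2)) \<le> \<bar>x\<bar>" for t x
  proof -
    have "K1 \<le> x \<or> x \<le> K2" using that(2) by auto
    then have "(SUP t\<in>R. ereal (f t x / x\<^sup>2)) < ereal (- d)" using K1 K2 by blast
    moreover have "ereal (f t x / x\<^sup>2) \<le> (SUP t\<in>R. ereal (f t x / x\<^sup>2))"
      using that(1) by (intro SUP_upper) (simp add: T_def)
    ultimately have "ereal (f t x / x\<^sup>2) < ereal (- d)" by (rule le_less_trans[rotated])
    moreover have "x\<^sup>2 > 0" using that(2) by auto
    ultimately show ?thesis by (simp add: divide_less_eq)
  qed
  have "concave_field f (partial_x f) T"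
  proof
    show "(\<lambda>(t, x). f t x) \<in> borel_measurable borel" by (rule meas)
    show "AE t in lebesgue. t \<in> T" by (rule AET)
    show "(f t has_real_derivative partial_x f t p) (at p)" if "t \<in> T" for t p using that by (rule der)
    show "\<exists>K>0. \<forall>t\<in>T. \<forall>p. K \<le> \<bar>p\<bar> \<longrightarrow> f t p \<le> c" for c
    proof -
      \<comment> \<open>\<open>\<bar>p\<bar> \<ge> 1\<close> and
        \<open>\<bar>p\<bar> \<ge> \<bar>c\<bar> / d\<close> give
        \<open>d * p\<^sup>2 \<ge> \<bar>c\<bar>\<close>; the bounds \<open>K1\<close> and
        \<open>- K2\<close> bring \<open>p\<close> into the range of \<open>quad\<close>.\<close>
      define K where "K = max (max 1 (max K1 (- K2))) (\<bar>c\<bar> / d)"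
      show ?thesis
      proof (intro exI[of _ K] conjI ballI allI impI)
        show "0 < K" by (simp add: K_def)
        fix t p assume t: "t \<in> T" and p: "K \<le> \<bar>p\<bar>"
        have p1: "1 \<le> \<bar>p\<bar>" "\<bar>c\<bar> / d \<le> \<bar>p\<bar>" "max 1 (max K1 (- K2)) \<le> \<bar>p\<bar>" using p unfolding K_def by linarith+
        have "\<bar>c\<bar> \<le> d * \<bar>p\<bar>" using p1(2) \<open>d > 0\<close> by (simp add: divide_le_eq mult.commute)
        also have "\<dots> \<le> d * p\<^sup>2"
          using p1(1) \<open>d > 0\<close> mult_left_mono[of 1 "\<bar>p\<bar>" "\<bar>p\<bar>"] by (simp add: power2_eq_square)
        finally show "f t p \<le> c" using quad[OF t p1(3)] by (simp add: abs_le_iff)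
      qed
    qed
    fix N :: real
    \<comment> \<open>The margin 1 leaves room for difference quotients around every
      \<open>p\<close> in \<open>{- N..N}\<close>, from which the bound on the derivative is read
      off.\<close>
    obtain j where j: "N + 1 \<le> real j" using real_arch_simple by blast
    define b where "b = max 1 (max (m j) (max (L j) (L' j)))"
    have b: "1 \<le> b" "m j \<le> b" "L j \<le> b" "L' j \<le> b" by (auto simp: b_def)
    show "\<exists>b>0. \<exists>d>0. \<forall>t\<in>T. \<forall>p\<in>{- N..N}. \<forall>q\<in>{- N..N}.
        \<bar>f t p\<bar> \<le> b \<and> \<bar>partial_x f t p\<bar> \<le> b \<and> \<bar>f t p - f t q\<bar> \<le> b * \<bar>p - q\<bar> \<and>
        f t q \<le> f t p + partial_x f t p * (q - p) - d * (q - p)\<^sup>2 \<and>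
        f t p + partial_x f t p * (q - p) - b * (q - p)\<^sup>2 \<le> f t q"
    proof (rule exI[of _ b], intro exI[of _ "D j / 2"] conjI ballI)
      show "0 < b" "0 < D j / 2" using b(1) D(1) by simp_all
      fix t p q assume t: "t \<in> T" and "p \<in> {- N..N}" "q \<in> {- N..N}"
      then have pq: "\<bar>p\<bar> \<le> real j" "\<bar>q\<bar> \<le> real j" "\<bar>p\<bar> \<le> real j - 1" using j by auto
      show "\<bar>f t p\<bar> \<le> b" using fb[OF t pq(1)] b(2) by linarith
      show "\<bar>partial_x f t p\<bar> \<le> b"
      proof (rule DERIV_abs_le[OF der[OF t], of 1])
        fix q :: real assume "\<bar>q - p\<bar> < 1"
        then have "\<bar>q\<bar> \<le> real j" using pq(3) by linarith
        then have "\<bar>f t q - f t p\<bar> \<le> L j * \<bar>q - p\<bar>" by (rule fl[OF t pq(1)])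
        also have "\<dots> \<le> b * \<bar>q - p\<bar>" using b(3) by (rule mult_right_mono) simp
        finally show "\<bar>f t q - f t p\<bar> \<le> b * \<bar>q - p\<bar>" .
      qed simp
      show "\<bar>f t p - f t q\<bar> \<le> b * \<bar>p - q\<bar>"
        using fl[OF t pq(2,1)] mult_right_mono[OF b(3), of "\<bar>p - q\<bar>"] by linarith
      show "f t q \<le> f t p + partial_x f t p * (q - p) - D j / 2 * (q - p)\<^sup>2"
        by (rule concave_upper_parabola[where N = "real j", OF der[OF t] _ pq(1,2)]) (use gd[OF t] in auto)
      \<comment> \<open>The lower parabola for \<open>f\<close> is the upper one for
        \<open>- f\<close>, with constant \<open>- L' j\<close>.\<close>
      have "- f t q \<le> - f t p + - partial_x f t p * (q - p) - (- L' j) / 2 * (q - p)\<^sup>2"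
      proof (rule concave_upper_parabola[where g = "\<lambda>z. - f t z" and g' = "\<lambda>z. - partial_x f t z" and N = "real j", OF _ _ pq(1,2)])
        show "((\<lambda>z. - f t z) has_real_derivative - partial_x f t z) (at z)" for z
          by (rule DERIV_minus[OF der[OF t]])
        fix x y assume "- real j \<le> x" "x < y" "y \<le> real j"
        then show "- partial_x f t y - - partial_x f t x \<le> - (- L' j) * (y - x)"
          using gl[OF t, of x j y] by (simp add: abs_le_iff)
      qed
      moreover have "L' j / 2 * (q - p)\<^sup>2 \<le> b * (q - p)\<^sup>2"
        using b(1,4) by (intro mult_right_mono) auto
      ultimately show "f t p + partial_x f t p * (q - p) - b * (q - p)\<^sup>2 \<le> f t q"
        by simp
    qed
  qed
  moreover have "T \<subseteq> R" by (auto simp: T_def)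
  ultimately show thesis by (intro that)
qed

section \<open>Location of the bifurcation value\<close>

lemma Linf_norm_AE:
  assumes "Linf_norm g \<noteq> \<infinity>"
  obtains B where "AE t in lebesgue. \<bar>g t\<bar> \<le> ereal B" "Linf_norm g = ereal B"
proof -
  have AE: "AE t in lebesgue. \<bar>g t\<bar> \<le> Linf_norm g"
    unfolding Linf_norm_def by (rule esssup_AE)
  \<comment> \<open>No absolute value is minus infinity, so otherwise the whole line would be a null
    set.\<close>
  have "Linf_norm g \<noteq> - \<infinity>"
  proof
    assume "Linf_norm g = - \<infinity>"
    then have "AE t::real in lebesgue. False" using AE by simp
    then have "negligible (UNIV :: real set)"
      unfolding eventually_ae_filter_negligible by (auto simp: top.extremum_unique)
    then show False by simp
  qed
  then obtain B where "Linf_norm g = ereal B" using assms by (cases "Linf_norm g") auto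
  then show thesis using AE that by simp
qed

theorem theorem3p5:
  fixes f :: "real \<Rightarrow> real \<Rightarrow> real" and R :: "real set" and \<rho> :: real and m\<rho> M0 :: ereal
  assumes f1: "(\<lambda>(t, x). f t x) \<in> borel_measurable borel"
    and f2: "loc_bounded_ae f"
    and f3: "loc_lipschitz_ae f"
    and f4: "C1_ae f"
    and f5: "loc_lipschitz_ae (partial_x f)"
    and f6: "coercive_on R f"
    and f7: "strictly_concave_ae f"
    and \<rho>_pos: "0 < \<rho>"
    and \<rho>_neg: "\<forall>t\<in>R. \<forall>x. \<rho> < \<bar>x\<bar> \<longrightarrow> f t x < 0"
  defines "m\<rho> \<equiv> Linf_norm (\<lambda>t. SUP x\<in>{-\<rho>..\<rho>}. ereal (f t x))"
    and "M0 \<equiv> Linf_norm (\<lambda>t. ereal (f t 0))"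
  shows "(\<exists>!c. ereal c \<in> {- m\<rho>..M0} \<and> bifurcation_value f c) \<and>
    ereal (lambda_star f) \<in> {- m\<rho>..M0} \<and> bifurcation_value f (lambda_star f) \<and>
    (\<forall>l. lambda_star (\<lambda>t x. f t x + l) = lambda_star f - l)"
proof -
  obtain T where "T \<subseteq> R" and cf: "concave_field f (partial_x f) T"
    by (rule concave_field_intro[OF f1 f2 f3 f4 f5 f6 f7])
  interpret concave_field f "partial_x f" T by (rule cf)
  obtain c where c: "bifurcation_value f c" using ex_bifurcation_value by blast
  then have ne: "bdd_set f l = {} \<longleftrightarrow> l < c" for l unfolding bifurcation_value_def by blast
  have lower: "- m\<rho> \<le> ereal c"
  proof (cases "m\<rho> = \<infinity>")
    case False
    then obtain B where B: "AE t in lebesgue. \<bar>SUP x\<in>{-\<rho>..\<rho>}. ereal (f t x)\<bar> \<le> ereal B" "m\<rho> = ereal B"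
      unfolding m\<rho>_def by (rule Linf_norm_AE)
    \<comment> \<open>For \<open>\<bar>p\<bar> \<le> \<rho>\<close> the norm bounds
      \<open>f\<close>; outside, \<open>f\<close> is negative while \<open>B \<ge> 0\<close>. Since
      bounded solutions exist at \<open>c\<close> itself, this bounds \<open>c\<close> from
      below.\<close>
    have "AE t in lebesgue. \<forall>p. f t p \<le> B"
      using B(1) AE_T
    proof eventually_elim
      case (elim t)
      show ?case
      proof
        fix p
        have in_ivl: "f t q \<le> B" if "\<bar>q\<bar> \<le> \<rho>" for q
        proof -
          have "ereal (f t q) \<le> (SUP x\<in>{-\<rho>..\<rho>}. ereal (f t x))"
            using that by (intro SUP_upper) (auto simp: abs_le_iff)
          also have "\<dots> \<le> \<bar>SUP x\<in>{-\<rho>..\<rho>}. ereal (f t x)\<bar>"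
            by (cases "SUP x\<in>{-\<rho>..\<rho>}. ereal (f t x)") auto
          also have "\<dots> \<le> ereal B" by (rule elim(1))
          finally show ?thesis by simp
        qed
        have "0 \<le> B"
        proof -
          have "0 \<le> \<bar>SUP x\<in>{-\<rho>..\<rho>}. ereal (f t x)\<bar>" by simp
          then have "0 \<le> ereal B" using elim(1) by (rule order_trans)
          then show ?thesis by simp
        qed
        show "f t p \<le> B"
        proof (cases "\<bar>p\<bar> \<le> \<rho>")
          case False
          then have "f t p < 0" using \<rho>_neg elim(2) \<open>T \<subseteq> R\<close> by auto
          then show ?thesis using \<open>0 \<le> B\<close> by simp
        qed (rule in_ivl)
      qed
    qed
    then have "- B \<le> c" by (rule parameter_lower_bound) (simp add: ne)
    then show ?thesis by (simp add: B(2))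
  qed simp
  have upper: "ereal c \<le> M0"
  proof (cases "M0 = \<infinity>")
    case False
    then obtain B where B: "AE t in lebesgue. \<bar>ereal (f t 0)\<bar> \<le> ereal B" "M0 = ereal B"
      unfolding M0_def by (rule Linf_norm_AE)
    \<comment> \<open>For the parameter \<open>B\<close> the constant 0 is a subsolution.\<close>
    have "AE t in lebesgue. 0 \<le> f t 0 + B"
      using B(1) by eventually_elim (simp add: abs_le_iff)
    then have "bdd_set f B \<noteq> {}" by (rule constant_subsolution)
    then show ?thesis by (simp add: B(2) ne not_less)
  qed simp
  have "lambda_star (\<lambda>t x. f t x + l) = lambda_star f - l" for l
    using lambda_star_eq[OF bifurcation_value_shift[OF c]] lambda_star_eq[OF c] by simp
  then show ?thesis
    using c lower upper lambda_star_eq[OF c] bifurcation_value_unique by auto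
qed

end
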